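(* If $f(x,y,z)\in\mathcal{E}(\mathcal{P}_{3,3}^+)$, then $f(x^2,y^2,z^2)\in\mathcal{E}(\mathcal{P}_{3,6})$.
   Context: $\mathcal{H}_{3,d}$ is the real vector space of homogeneous polynomials of degree $d$ in $x,y,z$ with real coefficients (including $0$). $\mathcal{P}_{3,d}^+$ is the set of $f\in\mathcal{H}_{3,d}$ with $f(x,y,z)\ge0$ for all real $x,y,z\ge0$; $\mathcal{P}_{3,d}$ is the set of $f\in\mathcal{H}_{3,d}$ with $f(x,y,z)\ge0$ for all $(x,y,z)\in\mathbb{R}^3$. For a closed convex cone $\mathcal{P}$ containing no lines, a nonzero $f\in\mathcal{P}$ is extremal if $f=g+h$ with $g,h\in\mathcal{P}$ implies that $g$ and $h$ are scalar multiples of $f$; $\mathcal{E}(\mathcal{P})$ is the set of extremal elements of $\mathcal{P}$. *)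

theory Defs
  imports Complex_Main
begin

text \<open>
  Real ternary forms are identified with the functions they induce on
  \<open>\<real>\<times>\<real>\<times>\<real>\<close>, which loses nothing because \<open>\<real>\<close> is infinite.
\<close>

type_synonym ternary = "real \<times> real \<times> real \<Rightarrow> real"

definition ternary_forms :: "nat \<Rightarrow> ternary set" where
  "ternary_forms d =
     {f. \<exists>c :: nat \<Rightarrow> nat \<Rightarrow> real. \<forall>x y z.
           f (x, y, z) = (\<Sum>i\<le>d. \<Sum>j\<le>d - i. c i j * x ^ i * y ^ j * z ^ (d - i - j))}"

definition psd_forms :: "nat \<Rightarrow> ternary set" where
  "psd_forms d = {f \<in> ternary_forms d. \<forall>x y z. f (x, y, z) \<ge> 0}"

definition psd_forms_orthant :: "nat \<Rightarrow> ternary set" where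
  "psd_forms_orthant d =
     {f \<in> ternary_forms d. \<forall>x y z. x \<ge> 0 \<longrightarrow> y \<ge> 0 \<longrightarrow> z \<ge> 0 \<longrightarrow> f (x, y, z) \<ge> 0}"

text \<open>
  The definition makes sense for any set \<open>P\<close> of real functions; it is meant for
  closed convex cones containing no lines (under pointwise operations).
\<close>

definition extremal_elements :: "('a \<Rightarrow> real) set \<Rightarrow> ('a \<Rightarrow> real) set" where
  "extremal_elements P =
     {f \<in> P. f \<noteq> (\<lambda>p. 0) \<and>
        (\<forall>g \<in> P. \<forall>h \<in> P. f = (\<lambda>p. g p + h p) \<longrightarrow>
           (\<exists>a. g = (\<lambda>p. a * f p)) \<and> (\<exists>b. h = (\<lambda>p. b * f p)))}"

end

theory Submission
  imports Defs "HOL-Analysis.Analysis"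
begin

text \<open>
  Let \<open>f\<close> be an extremal cubic on the orthant and suppose that \<open>F = f(x^2, y^2, z^2) = G + H\<close> with
  non-negative sextics \<open>G\<close> and \<open>H\<close>, so that \<open>0 \<le> G \<le> F\<close>.  Averaging \<open>G\<close> over the sign changes of the
  coordinates gives \<open>g(x^2, y^2, z^2)\<close> with a cubic \<open>g\<close> satisfying \<open>0 \<le> g \<le> f\<close> on the orthant, hence
  \<open>g = a f\<close>.  The rest of \<open>G\<close> consists of three odd parts, such as \<open>x y A(x^2, y^2, z^2)\<close> with a
  quadratic form \<open>A\<close>, and each of them is bounded in absolute value by \<open>F\<close>.  In the coordinates
  \<open>u = x^2\<close>, \<open>v = y^2\<close>, \<open>w = z^2\<close> the bound reads \<open>sqrt (u v) |A| \<le> f\<close> on the orthant, and the theorem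
  follows once such an \<open>A\<close> must vanish (\<open>extremal_cubic_dominates_only_zero\<close>).

  Extremality is always used in the form: a cubic \<open>g\<close> with \<open>0 \<le> g \<le> C f\<close> on the orthant is a
  multiple of \<open>f\<close>.  Applied to \<open>u v w\<close> it yields a point \<open>p\<close> of the closed orthant at which \<open>f\<close> and
  its gradient vanish (\<open>exists_double_point\<close>): if \<open>f\<close> does not dominate \<open>u v w\<close>, then a limit of points at which
  \<open>f / (u v w)\<close> tends to 0 is such a point.  By scaling and permuting coordinates \<open>p\<close> becomes
  \<open>(1,1,1)\<close>, \<open>(0,1,1)\<close> or \<open>(0,0,1)\<close>.

  At a double point \<open>p\<close> one has \<open>f(x + s p) = f(x) + s Q(x)\<close>, so \<open>f\<close> is affine along every line through
  \<open>p\<close>.  Consequently the inequality \<open>l m^2 \<le> C f\<close>, for a coordinate \<open>l\<close> and a linear form \<open>m\<close> vanishing at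
  \<open>p\<close>, only has to be checked on the boundary of the orthant and for the quadratic form \<open>Q\<close>
  (\<open>edges_dominate_v_square\<close>).  On the boundary \<open>f\<close> is a binary cubic, which either has a double zero
  or is bounded below by a multiple of \<open>y^2 z + y z^2\<close> (\<open>edge_dichotomy\<close>).  If \<open>f\<close> is not divisible by a
  coordinate, then no such inequality can hold, and this forces \<open>f\<close> to have many zeros: double
  zeros on edges, zeros at vertices, or a degenerate \<open>Q\<close>.

  The form \<open>A\<close> has to vanish at these zeros as well.  It is singular at \<open>p\<close>
  (\<open>dominated_shift\<close>), it vanishes at a double zero of \<open>f\<close> on the edges \<open>u = 0\<close> and \<open>v = 0\<close>, it vanishes to second
  order at a double zero on \<open>w = 0\<close>, and it vanishes wherever \<open>Q\<close> degenerates.  Being a quadratic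
  form in two variables modulo \<open>p\<close>, it cannot satisfy all these conditions unless it is zero; when
  the required directions coincide, \<open>f\<close> vanishes on a line through \<open>p\<close>, whence \<open>f = l m^2\<close> and \<open>f\<close> is
  divisible by a coordinate (\<open>no_line_of_zeros\<close>).  This settles \<open>p = (0,1,1)\<close>
  and \<open>p = (1,1,1)\<close>, the Motzkin cubic \<open>w^3 + u^2 v + u v^2 - 3 u v w\<close> requiring a sharper estimate
  (\<open>dominated_at_motzkin_node\<close>).

  If \<open>p\<close> is a vertex, then \<open>f\<close> is divisible by a coordinate.  If \<open>f = l q\<close> with a coordinate \<open>l\<close>, then
  \<open>l\<close> divides \<open>A\<close> and \<open>q\<close> is an extremal copositive quadratic form, and the same reasoning one degree lower
  (\<open>extremal_quadric_alternatives\<close>, \<open>linear_below_extremal_quadric\<close>) shows \<open>A = 0\<close>.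
\<close>

section \<open>Compactness and growth estimates\<close>

text \<open>
  If \<open>f\<close> does not dominate any positive multiple of \<open>\<mu>\<close> on a compact set, then points with \<open>f < \<mu> / n\<close>
  accumulate at some \<open>x\<close>.  There \<open>f\<close> is as flat as \<open>\<mu>\<close> permits: when \<open>f \<ge> k h\<close> and \<open>\<mu>\<close> is at most a
  multiple of \<open>k\<close>, then \<open>h < C / n\<close> along the sequence.  With \<open>k = 1\<close> and \<open>h = f\<close> this gives
  \<open>f(x) \<le> 0\<close>; with a coordinate as \<open>k\<close> it bounds the derivative of \<open>f\<close> in that coordinate.
\<close>

lemma touching_point:
  fixes X :: "'a::metric_space set" and f \<mu> :: "'a \<Rightarrow> real"
  assumes "compact X" and "\<And>\<epsilon>. \<epsilon> > 0 \<Longrightarrow> \<exists>x\<in>X. f x < \<epsilon> * \<mu> x"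
  shows "\<exists>x\<in>X. \<forall>h k C. continuous_on X h \<longrightarrow>
           (\<forall>y\<in>X. 0 \<le> k y \<and> k y * h y \<le> f y \<and> \<mu> y \<le> C * k y) \<longrightarrow> h x \<le> 0"
proof -
  have "\<forall>n. \<exists>x\<in>X. f x < inverse (real (Suc n)) * \<mu> x"
    using assms(2) by simp
  then obtain xs where xs: "\<And>n. xs n \<in> X" "\<And>n. f (xs n) < inverse (real (Suc n)) * \<mu> (xs n)"
    by metis
  obtain x r where x: "x \<in> X" and r: "strict_mono r" and lim: "(xs \<circ> r) \<longlonglongrightarrow> x"
    using assms(1) xs(1) unfolding compact_def by metis
  have "h x \<le> 0"
    if h: "continuous_on X h"
      and hk: "\<forall>y\<in>X. 0 \<le> k y \<and> k y * h y \<le> f y \<and> \<mu> y \<le> C * k y" for h k C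
  proof -
    have bound: "h (xs n) \<le> C * inverse (real (Suc n))" for n
    proof -
      let ?y = "xs n"
      let ?i = "inverse (real (Suc n))"
      have ip: "?i > 0" by simp
      have k: "0 \<le> k ?y" "k ?y * h ?y \<le> f ?y" "\<mu> ?y \<le> C * k ?y"
        using hk xs(1) by auto
      have *: "k ?y * h ?y < ?i * (C * k ?y)"
      proof -
        have "?i * \<mu> ?y \<le> ?i * (C * k ?y)"
          using k(3) ip by (intro mult_left_mono) auto
        then show ?thesis using k(2) xs(2)[of n] by linarith
      qed
      then have "k ?y \<noteq> 0" by auto
      with k(1) have "k ?y > 0" by simp
      moreover from * have "k ?y * h ?y < k ?y * (C * ?i)" by (simp add: mult_ac)
      ultimately show ?thesis by (simp add: mult_less_cancel_left_pos)
    qed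
    have "(\<lambda>n. h ((xs \<circ> r) n)) \<longlonglongrightarrow> h x"
      using h x xs(1) lim by (auto simp: continuous_on_sequentially comp_def)
    moreover have "(\<lambda>n. C * inverse (real (Suc (r n)))) \<longlonglongrightarrow> C * 0"
      using LIMSEQ_subseq_LIMSEQ[OF LIMSEQ_inverse_real_of_nat r]
      by (intro tendsto_mult tendsto_const) (simp add: comp_def)
    ultimately have "h x \<le> C * 0"
      using bound by (intro LIMSEQ_le) auto
    then show ?thesis by simp
  qed
  with x show ?thesis by blast
qed

text \<open>
  The parameter is squared because the points approached are of the form \<open>p + x^2 y\<close>, where \<open>x\<close> is the
  order of magnitude of a square root of a coordinate.
\<close>

lemma small_order_3:
  fixes a b c K :: real
  assumes "\<And>x. 0 < x \<Longrightarrow> x \<le> 1 \<Longrightarrow> \<bar>a + b * x^2 + c * x^4\<bar> \<le> K * x^3"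
  shows "a = 0 \<and> b = 0"
proof -
  have ev: "eventually (\<lambda>x. 0 < x \<and> x \<le> (1::real)) (at_right 0)"
    by (rule eventually_at_rightI[of 0 1]) auto
  have "((\<lambda>x. K * x^3 - \<bar>a + b * x^2 + c * x^4\<bar>) \<longlongrightarrow> K * 0^3 - \<bar>a + b * 0^2 + c * 0^4\<bar>) (at_right 0)"
    by (intro tendsto_intros)
  then have "0 \<le> K * 0^3 - \<bar>a + b * 0^2 + c * 0^4\<bar>"
    by (rule tendsto_lowerbound) (use ev assms in \<open>auto elim!: eventually_mono\<close>)
  then have a: "a = 0" by simp
  have "((\<lambda>x. K * x - \<bar>b + c * x^2\<bar>) \<longlongrightarrow> K * 0 - \<bar>b + c * 0^2\<bar>) (at_right 0)"
    by (intro tendsto_intros)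
  then have "0 \<le> K * 0 - \<bar>b + c * 0^2\<bar>"
  proof (rule tendsto_lowerbound)
    show "\<forall>\<^sub>F x in at_right 0. 0 \<le> K * x - \<bar>b + c * x^2\<bar>"
      using ev
    proof eventually_elim
      case (elim x)
      have "x^2 * \<bar>b + c * x^2\<bar> = \<bar>x^2 * (b + c * x^2)\<bar>" by (simp add: abs_mult)
      also have "x^2 * (b + c * x^2) = b * x^2 + c * x^4" by algebra
      also have "\<bar>b * x^2 + c * x^4\<bar> \<le> x^2 * (K * x)"
        using assms[of x] elim a by (simp add: power2_eq_square power3_eq_cube mult_ac)
      finally show ?case using elim by simp
    qed
  qed simp
  then show ?thesis using a by simp
qed

text \<open>
  The counterpart of \<open>small_order_3\<close> at infinity, obtained by the substitution \<open>t = 1 / x\<close>.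
\<close>

lemma large_order_1:
  fixes a b c K :: real
  assumes "\<And>t. 1 \<le> t \<Longrightarrow> \<bar>a + b * t^2 + c * t^4\<bar> \<le> K * t"
  shows "b = 0 \<and> c = 0"
proof -
  have "\<bar>c + b * x^2 + a * x^4\<bar> \<le> K * x^3" if "0 < x" "x \<le> 1" for x
  proof -
    have "\<bar>a + b * (1/x)^2 + c * (1/x)^4\<bar> \<le> K * (1/x)"
      using assms[of "1/x"] that by simp
    then have "x^4 * \<bar>a + b * (1/x)^2 + c * (1/x)^4\<bar> \<le> x^4 * (K * (1/x))"
      using that by (intro mult_left_mono) auto
    also have "x^4 * \<bar>a + b * (1/x)^2 + c * (1/x)^4\<bar> = \<bar>x^4 * (a + b * (1/x)^2 + c * (1/x)^4)\<bar>"
      by (simp add: abs_mult)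
    also have "x^4 * (a + b * (1/x)^2 + c * (1/x)^4) = c + b * x^2 + a * x^4"
      using that by (simp add: field_simps power2_eq_square power4_eq_xxxx)
    also have "x^4 * (K * (1/x)) = K * x^3"
      using that by (simp add: field_simps power3_eq_cube power4_eq_xxxx)
    finally show ?thesis .
  qed
  from small_order_3[OF this] show ?thesis by simp
qed

lemma small_order_continuous:
  fixes g h :: "real \<Rightarrow> real"
  assumes "continuous_on UNIV g" "continuous_on UNIV h"
    and le: "\<And>x. 0 < x \<Longrightarrow> x \<le> 1 \<Longrightarrow> \<bar>g x\<bar> \<le> x * h x"
  shows "g 0 = 0"
proof -
  have ev: "eventually (\<lambda>x. 0 < x \<and> x \<le> (1::real)) (at_right 0)"
    by (rule eventually_at_rightI[of 0 1]) auto
  have g: "(g \<longlongrightarrow> g 0) (at_right 0)" and h: "(h \<longlongrightarrow> h 0) (at_right 0)"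
    using assms(1,2) by (auto simp: continuous_on_def intro: tendsto_within_subset)
  have "((\<lambda>x. x * h x - \<bar>g x\<bar>) \<longlongrightarrow> 0 * h 0 - \<bar>g 0\<bar>) (at_right 0)"
    by (intro tendsto_intros g h)
  then have "0 \<le> 0 * h 0 - \<bar>g 0\<bar>"
    by (rule tendsto_lowerbound) (use ev le in \<open>auto elim!: eventually_mono\<close>)
  then show ?thesis by simp
qed

lemma nonneg_at_limit:
  fixes g :: "real \<Rightarrow> real"
  assumes "continuous_on UNIV g" and le: "\<And>x. 0 < x \<Longrightarrow> 0 \<le> g x"
  shows "0 \<le> g 0"
proof -
  have "(g \<longlongrightarrow> g 0) (at_right 0)"
    using assms(1) by (auto simp: continuous_on_def intro: tendsto_within_subset)
  then show ?thesis
    by (rule tendsto_lowerbound) (use le in \<open>auto simp: eventually_at_right_less intro: eventually_mono[OF eventually_at_right_less]\<close>)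
qed

text \<open>
  A zero in the interior of the half-line is a minimum.  At the end point non-negativity only gives \<open>c1 \<ge> 0\<close>,
  and the opposite inequality comes from the hypothesis \<open>bd\<close>, which \<open>touching_point\<close> supplies.
\<close>

lemma cubic_at_minimum:
  fixes c0 c1 c2 c3 t0 :: real
  assumes nn: "\<And>t. t \<ge> 0 \<Longrightarrow> 0 \<le> c0 + c1 * t + c2 * t^2 + c3 * t^3"
    and t0: "t0 \<ge> 0" and zero: "c0 + c1 * t0 + c2 * t0^2 + c3 * t0^3 \<le> 0"
    and bd: "t0 = 0 \<Longrightarrow> c1 \<le> 0"
  shows "c0 + c1 * t0 + c2 * t0^2 + c3 * t0^3 = 0" "c1 + 2 * c2 * t0 + 3 * c3 * t0^2 = 0"
proof -
  let ?p = "\<lambda>t. c0 + c1 * t + c2 * t^2 + c3 * t^3"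
  show z: "?p t0 = 0" using nn[OF t0] zero by simp
  have D: "DERIV ?p t0 :> c1 + 2 * c2 * t0 + 3 * c3 * t0^2"
    by (auto intro!: derivative_eq_intros)
  show "c1 + 2 * c2 * t0 + 3 * c3 * t0^2 = 0"
  proof (cases "t0 = 0")
    case False
    show ?thesis
    proof (rule DERIV_local_min[OF D])
      show "0 < t0" using False t0 by simp
      show "\<forall>y. \<bar>t0 - y\<bar> < t0 \<longrightarrow> ?p t0 \<le> ?p y"
        using nn z by (auto simp: abs_less_iff)
    qed
  next
    case True
    have "\<not> c1 < 0"
    proof
      assume "c1 < 0"
      then have "c1 + 2 * c2 * t0 + 3 * c3 * t0^2 < 0" using True by simp
      from DERIV_neg_dec_right[OF D this]
      obtain d where "d > 0" "\<And>h. 0 < h \<Longrightarrow> h < d \<Longrightarrow> ?p (t0 + h) < ?p t0" by auto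
      from this(2)[of "d/2"] this(1) have "?p (t0 + d/2) < ?p t0" by simp
      with nn[of "t0 + d/2"] z t0 \<open>d > 0\<close> show False by simp
    qed
    then show ?thesis using True bd by simp
  qed
qed

lemma nonneg_linear:
  fixes a b :: real assumes "\<And>s. s \<ge> 0 \<Longrightarrow> 0 \<le> a + s * b"
  shows "0 \<le> b"
proof (rule ccontr)
  assume "\<not> 0 \<le> b"
  then have b: "b < 0" by simp
  have a: "a \<ge> 0" using assms[of 0] by simp
  have "0 \<le> a + ((a + 1) / (-b)) * b" using a b by (intro assms) (simp add: divide_nonneg_neg)
  then show False using b by (simp add: field_simps)
qed

lemma critical_point:
  fixes c1 c2 c3 d :: real
  assumes nn: "\<And>t. \<bar>t\<bar> < d \<Longrightarrow> 0 \<le> c1 * t + c2 * t^2 + c3 * t^3" and d: "d > 0"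
  shows "c1 = 0"
proof (rule DERIV_local_min[of "\<lambda>t. c1 * t + c2 * t^2 + c3 * t^3" _ 0 d])
  show "((\<lambda>t. c1 * t + c2 * t^2 + c3 * t^3) has_real_derivative c1) (at 0)"
    by (auto intro!: derivative_eq_intros)
  show "0 < d" by (rule d)
  show "\<forall>y. \<bar>0 - y\<bar> < d \<longrightarrow> c1 * 0 + c2 * 0^2 + c3 * 0^3 \<le> c1 * y + c2 * y^2 + c3 * y^3"
    using nn by simp
qed

section \<open>Cubic and quadratic forms in curried form\<close>

type_synonym real_fun3 = "real \<Rightarrow> real \<Rightarrow> real \<Rightarrow> real"

definition cubic :: "real_fun3 \<Rightarrow> bool" where
  "cubic f \<longleftrightarrow> (\<exists>a b c d e g h i j k. \<forall>u v w. f u v w =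
     a * u^3 + b * v^3 + c * w^3 + d * u^2 * v + e * u^2 * w + g * u * v^2
     + h * v^2 * w + i * u * w^2 + j * v * w^2 + k * u * v * w)"

definition quadric :: "real_fun3 \<Rightarrow> bool" where
  "quadric q \<longleftrightarrow> (\<exists>a b c d e g. \<forall>u v w. q u v w =
     a * u^2 + b * v^2 + c * w^2 + d * u * v + e * u * w + g * v * w)"

lemma cubicI:
  assumes "\<And>u v w. f u v w =
     a * u^3 + b * v^3 + c * w^3 + d * u^2 * v + e * u^2 * w + g * u * v^2
     + h * v^2 * w + i * u * w^2 + j * v * w^2 + k * u * v * w"
  shows "cubic f"
  unfolding cubic_def by (intro exI allI) (rule assms)

lemma quadricI:
  assumes "\<And>u v w. q u v w =
     a * u^2 + b * v^2 + c * w^2 + d * u * v + e * u * w + g * v * w"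
  shows "quadric q"
  unfolding quadric_def by (intro exI allI) (rule assms)

lemma cubic_linear_times_square:
  "cubic (\<lambda>u v w. (l1 * u + l2 * v + l3 * w) * (m1 * u + m2 * v + m3 * w)^2)"
  by (rule cubicI[of _ "l1 * m1^2" "l2 * m2^2" "l3 * m3^2"
        "l2 * m1^2 + 2 * l1 * m1 * m2" "l3 * m1^2 + 2 * l1 * m1 * m3"
        "l1 * m2^2 + 2 * l2 * m1 * m2" "l3 * m2^2 + 2 * l2 * m2 * m3"
        "l1 * m3^2 + 2 * l3 * m1 * m3" "l2 * m3^2 + 2 * l3 * m2 * m3"
        "2 * l1 * m2 * m3 + 2 * l2 * m1 * m3 + 2 * l3 * m1 * m2"]) (simp add: algebra_simps power2_eq_square power3_eq_cube)

lemma cubic_scale: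
  assumes "cubic f" shows "cubic (\<lambda>u v w. f (\<alpha> * u) (\<beta> * v) (\<gamma> * w))"
proof -
  obtain a b c d e g h i j k where f: "\<And>u v w. f u v w =
     a * u^3 + b * v^3 + c * w^3 + d * u^2 * v + e * u^2 * w + g * u * v^2
     + h * v^2 * w + i * u * w^2 + j * v * w^2 + k * u * v * w"
    using assms unfolding cubic_def by blast
  show ?thesis
    by (rule cubicI[of _ "a * \<alpha>^3" "b * \<beta>^3" "c * \<gamma>^3" "d * \<alpha>^2 * \<beta>" "e * \<alpha>^2 * \<gamma>" "g * \<alpha> * \<beta>^2"
          "h * \<beta>^2 * \<gamma>" "i * \<alpha> * \<gamma>^2" "j * \<beta> * \<gamma>^2" "k * \<alpha> * \<beta> * \<gamma>"])
       (simp add: f power_mult_distrib)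
qed

lemma cubic_swap12:
  assumes "cubic f" shows "cubic (\<lambda>u v w. f v u w)"
proof -
  obtain a b c d e g h i j k where f: "\<And>u v w. f u v w =
     a * u^3 + b * v^3 + c * w^3 + d * u^2 * v + e * u^2 * w + g * u * v^2
     + h * v^2 * w + i * u * w^2 + j * v * w^2 + k * u * v * w"
    using assms unfolding cubic_def by blast
  show ?thesis
    by (rule cubicI[of _ b a c g h d e j i k]) (simp add: f)
qed

lemma cubic_swap23:
  assumes "cubic f" shows "cubic (\<lambda>u v w. f u w v)"
proof -
  obtain a b c d e g h i j k where f: "\<And>u v w. f u v w =
     a * u^3 + b * v^3 + c * w^3 + d * u^2 * v + e * u^2 * w + g * u * v^2
     + h * v^2 * w + i * u * w^2 + j * v * w^2 + k * u * v * w"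
    using assms unfolding cubic_def by blast
  show ?thesis
    by (rule cubicI[of _ a c b e d i j g h k]) (simp add: f)
qed

lemma quadric_scale:
  assumes "quadric f" shows "quadric (\<lambda>u v w. \<kappa> * f (\<alpha> * u) (\<beta> * v) (\<gamma> * w))"
proof -
  obtain a b c d e g where f: "\<And>u v w. f u v w =
     a * u^2 + b * v^2 + c * w^2 + d * u * v + e * u * w + g * v * w"
    using assms unfolding quadric_def by blast
  show ?thesis
    by (rule quadricI[of _ "\<kappa> * a * \<alpha>^2" "\<kappa> * b * \<beta>^2" "\<kappa> * c * \<gamma>^2" "\<kappa> * d * \<alpha> * \<beta>"
          "\<kappa> * e * \<alpha> * \<gamma>" "\<kappa> * g * \<beta> * \<gamma>"])
       (simp add: f power_mult_distrib algebra_simps)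
qed

lemma quadric_swap12:
  assumes "quadric f" shows "quadric (\<lambda>u v w. f v u w)"
proof -
  obtain a b c d e g where f: "\<And>u v w. f u v w =
     a * u^2 + b * v^2 + c * w^2 + d * u * v + e * u * w + g * v * w"
    using assms unfolding quadric_def by blast
  show ?thesis
    by (rule quadricI[of _ b a c d g e]) (simp add: f)
qed

lemma quadric_swap23:
  assumes "quadric f" shows "quadric (\<lambda>u v w. f u w v)"
proof -
  obtain a b c d e g where f: "\<And>u v w. f u v w =
     a * u^2 + b * v^2 + c * w^2 + d * u * v + e * u * w + g * v * w"
    using assms unfolding quadric_def by blast
  show ?thesis
    by (rule quadricI[of _ a c b e d g]) (simp add: f)
qed

lemma cubic_homogeneous:
  assumes "cubic f" shows "f (t * u) (t * v) (t * w) = t^3 * f u v w"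
proof -
  obtain a b c d e g h i j k where f: "\<And>u v w. f u v w =
     a * u^3 + b * v^3 + c * w^3 + d * u^2 * v + e * u^2 * w + g * u * v^2
     + h * v^2 * w + i * u * w^2 + j * v * w^2 + k * u * v * w"
    using assms unfolding cubic_def by blast
  show ?thesis by (simp add: f algebra_simps power2_eq_square power3_eq_cube)
qed

lemma quadric_homogeneous:
  assumes "quadric q" shows "q (t * u) (t * v) (t * w) = t^2 * q u v w"
proof -
  obtain a b c d e g where q: "\<And>u v w. q u v w =
     a * u^2 + b * v^2 + c * w^2 + d * u * v + e * u * w + g * v * w"
    using assms unfolding quadric_def by blast
  show ?thesis by (simp add: q algebra_simps power2_eq_square)
qed

text \<open>
  The usual definition by decompositions \<open>f = g + h\<close> is replaced by the equivalent statement about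
  all cubics \<open>g\<close> dominated by a multiple of \<open>f\<close>, since the proofs construct dominated cubics rather than
  decompositions.
\<close>

definition extremal_cubic :: "real_fun3 \<Rightarrow> bool" where
  "extremal_cubic f \<longleftrightarrow> cubic f \<and> (\<forall>u\<ge>0. \<forall>v\<ge>0. \<forall>w\<ge>0. 0 \<le> f u v w) \<and> (\<exists>u v w. f u v w \<noteq> 0) \<and>
     (\<forall>g C. cubic g \<longrightarrow> (\<forall>u\<ge>0. \<forall>v\<ge>0. \<forall>w\<ge>0. 0 \<le> g u v w \<and> g u v w \<le> C * f u v w) \<longrightarrow>
        (\<exists>a. \<forall>u v w. g u v w = a * f u v w))"

lemma extremal_cubicD:
  assumes "extremal_cubic f"
  shows "cubic f" "\<And>u v w. u \<ge> 0 \<Longrightarrow> v \<ge> 0 \<Longrightarrow> w \<ge> 0 \<Longrightarrow> 0 \<le> f u v w"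
    "\<exists>u v w. f u v w \<noteq> 0"
  using assms by (auto simp: extremal_cubic_def)

lemma extremal_cubic_dominated:
  assumes "extremal_cubic f" "cubic g"
    and "\<And>u v w. u \<ge> 0 \<Longrightarrow> v \<ge> 0 \<Longrightarrow> w \<ge> 0 \<Longrightarrow> 0 \<le> g u v w \<and> g u v w \<le> C * f u v w"
  obtains a where "\<And>u v w. g u v w = a * f u v w"
  using assms unfolding extremal_cubic_def by metis

lemma extremal_cubicI:
  assumes "cubic f" "\<And>u v w. u \<ge> 0 \<Longrightarrow> v \<ge> 0 \<Longrightarrow> w \<ge> 0 \<Longrightarrow> 0 \<le> f u v w"
    "f u0 v0 w0 \<noteq> 0"
    "\<And>g C. cubic g \<Longrightarrow> (\<And>u v w. u \<ge> 0 \<Longrightarrow> v \<ge> 0 \<Longrightarrow> w \<ge> 0 \<Longrightarrow> 0 \<le> g u v w \<and> g u v w \<le> C * f u v w)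
       \<Longrightarrow> \<exists>a. \<forall>u v w. g u v w = a * f u v w"
  shows "extremal_cubic f"
  unfolding extremal_cubic_def
proof (intro conjI allI impI)
  show "\<exists>u v w. f u v w \<noteq> 0" using assms(3) by blast
  show "\<exists>a. \<forall>u v w. g u v w = a * f u v w"
    if "cubic g" "\<forall>u\<ge>0. \<forall>v\<ge>0. \<forall>w\<ge>0. 0 \<le> g u v w \<and> g u v w \<le> C * f u v w" for g C
    by (rule assms(4)[OF that(1), of C]) (use that(2) in auto)
qed (use assms(1,2) in auto)

lemma extremal_cubic_swap12:
  assumes "extremal_cubic f" shows "extremal_cubic (\<lambda>u v w. f v u w)"
proof -
  obtain u v w where nz: "f v u w \<noteq> 0" using extremal_cubicD(3)[OF assms] by blast
  show ?thesis
  proof (rule extremal_cubicI[OF cubic_swap12[OF extremal_cubicD(1)[OF assms]] _ nz])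
    fix g C assume "cubic g" and d: "\<And>u v w. u \<ge> 0 \<Longrightarrow> v \<ge> 0 \<Longrightarrow> w \<ge> 0 \<Longrightarrow> 0 \<le> g u v w \<and> g u v w \<le> C * f v u w"
    from extremal_cubic_dominated[OF assms cubic_swap12[OF \<open>cubic g\<close>], of C] d
    obtain a where "\<And>u v w. g v u w = a * f u v w" by blast
    then show "\<exists>a. \<forall>u v w. g u v w = a * f v u w" by blast
  qed (rule extremal_cubicD(2)[OF assms])
qed

lemma extremal_cubic_swap23:
  assumes "extremal_cubic f" shows "extremal_cubic (\<lambda>u v w. f u w v)"
proof -
  obtain u v w where nz: "f u w v \<noteq> 0" using extremal_cubicD(3)[OF assms] by blast
  show ?thesis
  proof (rule extremal_cubicI[OF cubic_swap23[OF extremal_cubicD(1)[OF assms]] _ nz])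
    fix g C assume "cubic g" and d: "\<And>u v w. u \<ge> 0 \<Longrightarrow> v \<ge> 0 \<Longrightarrow> w \<ge> 0 \<Longrightarrow> 0 \<le> g u v w \<and> g u v w \<le> C * f u w v"
    from extremal_cubic_dominated[OF assms cubic_swap23[OF \<open>cubic g\<close>], of C] d
    obtain a where "\<And>u v w. g u w v = a * f u v w" by blast
    then show "\<exists>a. \<forall>u v w. g u v w = a * f u w v" by blast
  qed (rule extremal_cubicD(2)[OF assms])
qed

lemma extremal_cubic_scale:
  assumes "extremal_cubic f" and pos: "\<alpha> > 0" "\<beta> > 0" "\<gamma> > 0"
  shows "extremal_cubic (\<lambda>u v w. f (\<alpha> * u) (\<beta> * v) (\<gamma> * w))"
proof -
  obtain u v w where "f u v w \<noteq> 0" using extremal_cubicD(3)[OF assms(1)] by blast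
  then have nz: "f (\<alpha> * (u / \<alpha>)) (\<beta> * (v / \<beta>)) (\<gamma> * (w / \<gamma>)) \<noteq> 0" using pos by simp
  show ?thesis
  proof (rule extremal_cubicI[OF cubic_scale[OF extremal_cubicD(1)[OF assms(1)]] _ nz])
    fix g C assume g: "cubic g"
      and d: "\<And>u v w. u \<ge> 0 \<Longrightarrow> v \<ge> 0 \<Longrightarrow> w \<ge> 0 \<Longrightarrow>
        0 \<le> g u v w \<and> g u v w \<le> C * f (\<alpha> * u) (\<beta> * v) (\<gamma> * w)"
    have "0 \<le> g (1/\<alpha> * u) (1/\<beta> * v) (1/\<gamma> * w) \<and> g (1/\<alpha> * u) (1/\<beta> * v) (1/\<gamma> * w) \<le> C * f u v w"
      if "u \<ge> 0" "v \<ge> 0" "w \<ge> 0" for u v w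
      using d[of "1/\<alpha> * u" "1/\<beta> * v" "1/\<gamma> * w"] pos that by simp
    from extremal_cubic_dominated[OF assms(1) cubic_scale[OF g] this]
    obtain a where a: "\<And>u v w. g (1/\<alpha> * u) (1/\<beta> * v) (1/\<gamma> * w) = a * f u v w" by blast
    have "g u v w = a * f (\<alpha> * u) (\<beta> * v) (\<gamma> * w)" for u v w
      using a[of "\<alpha> * u" "\<beta> * v" "\<gamma> * w"] pos by simp
    then show "\<exists>a. \<forall>u v w. g u v w = a * f (\<alpha> * u) (\<beta> * v) (\<gamma> * w)" by blast
  qed (use pos in \<open>auto intro!: extremal_cubicD(2)[OF assms(1)]\<close>)
qed

section \<open>Existence of a double point\<close>

text \<open>
  At a point \<open>p\<close> where \<open>f\<close> and its gradient vanish, the Taylor expansion of \<open>f(x + s p)\<close> in \<open>s\<close> has no terms of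
  order 2 and 3.  The coefficient \<open>Q\<close> of \<open>s\<close> is half the second derivative of \<open>f\<close> at \<open>p\<close>.
\<close>

definition double_point :: "real_fun3 \<Rightarrow> real \<Rightarrow> real \<Rightarrow> real \<Rightarrow> real_fun3 \<Rightarrow> bool" where
  "double_point f p1 p2 p3 Q \<longleftrightarrow> quadric Q \<and>
     (\<forall>s u v w. f (u + s * p1) (v + s * p2) (w + s * p3) = f u v w + s * Q u v w)"

definition triangle :: "(real \<times> real \<times> real) set" where
  "triangle = {(u, v, w). 0 \<le> u \<and> 0 \<le> v \<and> 0 \<le> w \<and> u + v + w = 1}"

lemma compact_triangle: "compact triangle"
proof -
  have "triangle = ({0..1} \<times> {0..1} \<times> {0..1}) \<inter> {x. fst x + fst (snd x) + snd (snd x) = 1}"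
    by (auto simp: triangle_def)
  moreover have "closed {x::real\<times>real\<times>real. fst x + fst (snd x) + snd (snd x) = 1}"
    by (intro closed_Collect_eq continuous_intros)
  moreover have "compact ({0..1} \<times> {0..1} \<times> {0..1::real} :: (real \<times> real \<times> real) set)"
    by (intro compact_Times compact_Icc)
  ultimately show ?thesis
    using compact_Int_closed by fastforce
qed

lemma triangle_normalise:
  assumes "u \<ge> 0" "v \<ge> 0" "w \<ge> 0" "u + v + w > (0::real)"
  shows "(u / (u + v + w), v / (u + v + w), w / (u + v + w)) \<in> triangle"
  using assms by (simp add: triangle_def add_divide_distrib[symmetric])

text \<open>
  By homogeneity it suffices to compare the two forms on the triangle \<open>u + v + w = 1\<close>, which is compact.
  The conclusion is that of \<open>touching_point\<close> with the constant 1.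
\<close>

lemma touching_point_on_triangle:
  fixes f \<mu> :: real_fun3
  assumes f_hom: "\<And>t u v w. f (t * u) (t * v) (t * w) = t ^ n * f u v w"
    and \<mu>_hom: "\<And>t u v w. \<mu> (t * u) (t * v) (t * w) = t ^ n * \<mu> u v w" and n: "n > 0"
    and unbounded: "\<nexists>C. \<forall>u\<ge>0. \<forall>v\<ge>0. \<forall>w\<ge>0. \<mu> u v w \<le> C * f u v w"
  obtains p q r where "p + q + r = 1" "p \<ge> 0" "q \<ge> 0" "r \<ge> 0"
    "\<forall>h k. continuous_on UNIV (\<lambda>(u, v, w). h u v w) \<longrightarrow>
      (\<forall>u v w. 0 \<le> u \<longrightarrow> 0 \<le> v \<longrightarrow> 0 \<le> w \<longrightarrow> u \<le> 1 \<longrightarrow> v \<le> 1 \<longrightarrow> w \<le> 1 \<longrightarrow>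
        0 \<le> k u v w \<and> k u v w * h u v w \<le> f u v w \<and> \<mu> u v w \<le> k u v w) \<longrightarrow> h p q r \<le> 0"
proof -
  define F where "F = (\<lambda>(u, v, w). f u v w)"
  define M where "M = (\<lambda>(u, v, w). \<mu> u v w)"
  have "\<exists>x\<in>triangle. F x < \<epsilon> * M x" if eps: "\<epsilon> > 0" for \<epsilon>
  proof (rule ccontr)
    assume no: "\<not> ?thesis"
    have "\<mu> u v w \<le> (1 / \<epsilon>) * f u v w" if nn: "u \<ge> 0" "v \<ge> 0" "w \<ge> 0" for u v w
    proof (cases "u + v + w = 0")
      case True
      then have "u = 0" "v = 0" "w = 0" using nn by linarith+
      have z: "(0::real) ^ n = 0" using n by simp
      have "f 0 0 0 = 0" "\<mu> 0 0 0 = 0" using f_hom[of 0 0 0 0] \<mu>_hom[of 0 0 0 0] unfolding z by simp_all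
      then show ?thesis using \<open>u = 0\<close> \<open>v = 0\<close> \<open>w = 0\<close> by simp
    next
      case False
      define s where "s = u + v + w"
      have s: "s > 0" using False nn by (simp add: s_def)
      have "\<epsilon> * \<mu> (u/s) (v/s) (w/s) \<le> f (u/s) (v/s) (w/s)"
        using triangle_normalise[OF nn] s no by (force simp: s_def F_def M_def)
      then have "s ^ n * (\<epsilon> * \<mu> (u/s) (v/s) (w/s)) \<le> s ^ n * f (u/s) (v/s) (w/s)"
        using s by (intro mult_left_mono) auto
      then have "\<epsilon> * \<mu> u v w \<le> f u v w"
        using f_hom[of s "u/s" "v/s" "w/s"] \<mu>_hom[of s "u/s" "v/s" "w/s"] s by (simp add: mult_ac)
      then show ?thesis using eps by (simp add: pos_le_divide_eq mult.commute)
    qed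
    with unbounded show False by blast
  qed
  from touching_point[OF compact_triangle this] obtain x where x: "x \<in> triangle"
    and touch: "\<And>H K C. continuous_on triangle H \<Longrightarrow>
         (\<forall>y\<in>triangle. 0 \<le> K y \<and> K y * H y \<le> F y \<and> M y \<le> C * K y) \<Longrightarrow> H x \<le> 0" by blast
  obtain p q r where xpqr: "x = (p, q, r)" by (cases x) auto
  show ?thesis
  proof (rule that[of p q r])
    show "p + q + r = 1" "p \<ge> 0" "q \<ge> 0" "r \<ge> 0" using x by (auto simp: xpqr triangle_def)
    have "h p q r \<le> 0"
      if h: "continuous_on UNIV (\<lambda>(u, v, w). h u v w)"
      and le: "\<And>u v w. 0 \<le> u \<Longrightarrow> 0 \<le> v \<Longrightarrow> 0 \<le> w \<Longrightarrow> u \<le> 1 \<Longrightarrow> v \<le> 1 \<Longrightarrow> w \<le> 1 \<Longrightarrow>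
        0 \<le> k u v w \<and> k u v w * h u v w \<le> f u v w \<and> \<mu> u v w \<le> k u v w" for h k :: real_fun3
    proof -
      have "(\<lambda>(u, v, w). h u v w) x \<le> 0"
      proof (rule touch[where K = "\<lambda>(u, v, w). k u v w" and C = 1])
        show "continuous_on triangle (\<lambda>(u, v, w). h u v w)"
          by (rule continuous_on_subset[OF h]) simp
      qed (use le in \<open>auto simp: F_def M_def triangle_def\<close>)
      then show ?thesis by (simp add: xpqr)
    qed
    then show "\<forall>h k. continuous_on UNIV (\<lambda>(u, v, w). h u v w) \<longrightarrow>
      (\<forall>u v w. 0 \<le> u \<longrightarrow> 0 \<le> v \<longrightarrow> 0 \<le> w \<longrightarrow> u \<le> 1 \<longrightarrow> v \<le> 1 \<longrightarrow> w \<le> 1 \<longrightarrow>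
        0 \<le> k u v w \<and> k u v w * h u v w \<le> f u v w \<and> \<mu> u v w \<le> k u v w) \<longrightarrow> h p q r \<le> 0"
      by blast
  qed
qed

text \<open>
  If \<open>f\<close> dominates \<open>u v w\<close>, it is a multiple of \<open>u v w\<close>, and the vertices are double points.  Otherwise
  a touching point for \<open>u v w\<close> is a double point: since every coordinate divides \<open>u v w\<close>, the touching
  inequality controls the partial derivative with respect to each coordinate that vanishes there, and
  \<open>f\<close> has a minimum with respect to the remaining ones.
\<close>

lemma exists_double_point:
  assumes ext: "extremal_cubic f"
  obtains p1 p2 p3 Q where "p1 \<ge> 0" "p2 \<ge> 0" "p3 \<ge> 0" "p1 + p2 + p3 > 0" "double_point f p1 p2 p3 Q"
proof -
  obtain a b c d e g h i j k where f: "\<And>u v w. f u v w =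
     a * u^3 + b * v^3 + c * w^3 + d * u^2 * v + e * u^2 * w + g * u * v^2
     + h * v^2 * w + i * u * w^2 + j * v * w^2 + k * u * v * w"
    using extremal_cubicD(1)[OF ext] unfolding cubic_def by blast
  note nonneg = extremal_cubicD(2)[OF ext]
  show ?thesis
  proof (cases "\<exists>C. \<forall>u\<ge>0. \<forall>v\<ge>0. \<forall>w\<ge>0. u * v * w \<le> C * f u v w")
    case True
    then obtain C where C: "\<And>u v w. u \<ge> 0 \<Longrightarrow> v \<ge> 0 \<Longrightarrow> w \<ge> 0 \<Longrightarrow> u * v * w \<le> C * f u v w" by blast
    have "0 \<le> u * v * w \<and> u * v * w \<le> C * f u v w" if "u \<ge> 0" "v \<ge> 0" "w \<ge> 0" for u v w
      using C[OF that] that by simp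
    moreover have "cubic (\<lambda>u v w. u * v * w)" by (rule cubicI[of _ 0 0 0 0 0 0 0 0 0 1]) simp
    ultimately obtain t where t: "\<And>u v w. u * v * w = t * f u v w"
      using extremal_cubic_dominated[OF ext] by blast
    from t[of 1 1 1] have "t \<noteq> 0" by auto
    then have fm: "f u v w = 1 / t * (u * v * w)" for u v w using t[of u v w] by simp
    have "quadric (\<lambda>u v w. 1 / t * (v * w))" by (rule quadricI[of _ 0 0 0 0 0 "1/t"]) simp
    then have "double_point f 1 0 0 (\<lambda>u v w. 1 / t * (v * w))"
      unfolding double_point_def by (simp add: fm algebra_simps)
    then show ?thesis by (intro that[of 1 0 0]) auto
  next
    case False
    have product_hom: "(t * u) * (t * v) * (t * w) = t^3 * (u * v * w)" for t u v w :: real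
      by (simp add: power3_eq_cube)
    obtain p q r where sum1: "p + q + r = 1" and pqr: "p \<ge> 0" "q \<ge> 0" "r \<ge> 0"
      and touch0: "\<forall>H K. continuous_on UNIV (\<lambda>(u, v, w). H u v w) \<longrightarrow>
      (\<forall>u v w. 0 \<le> u \<longrightarrow> 0 \<le> v \<longrightarrow> 0 \<le> w \<longrightarrow> u \<le> 1 \<longrightarrow> v \<le> 1 \<longrightarrow> w \<le> 1 \<longrightarrow>
        0 \<le> K u v w \<and> K u v w * H u v w \<le> f u v w \<and> u * v * w \<le> K u v w) \<longrightarrow> H p q r \<le> 0"
      by (rule touching_point_on_triangle[OF cubic_homogeneous[OF extremal_cubicD(1)[OF ext]] product_hom zero_less_numeral False])
         (rule that)
    note touch = touch0[rule_format]
    have prod: "u * v * w \<le> u" "u * v * w \<le> v" "u * v * w \<le> w" "u * v * w \<le> 1"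
      if b: "0 \<le> u" "0 \<le> v" "0 \<le> w" "u \<le> 1" "v \<le> 1" "w \<le> 1" for u v w :: real
    proof -
      have le1: "x * y \<le> 1" if "0 \<le> x" "0 \<le> y" "x \<le> 1" "y \<le> 1" for x y :: real
        using mult_mono[of x 1 y 1] that by simp
      show "u * v * w \<le> u" using mult_left_mono[OF le1[of v w], of u] b by (simp add: mult_ac)
      show "u * v * w \<le> v" using mult_left_mono[OF le1[of u w], of v] b by (simp add: mult_ac)
      show "u * v * w \<le> w" using mult_left_mono[OF le1[of u v], of w] b by (simp add: mult_ac)
      then show "u * v * w \<le> 1" using b by linarith
    qed
    have fle: "f p q r \<le> 0"
    proof (rule touch[where K = "\<lambda>u v w. 1"])
      show "continuous_on UNIV (\<lambda>(u, v, w). f u v w)"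
        unfolding f case_prod_unfold by (intro continuous_intros)
    qed (use prod(4) in simp)
    have hu: "a * p^2 + d * p * q + e * p * r + g * q^2 + i * r^2 + k * q * r \<le> 0"
    proof (rule touch[where K = "\<lambda>u v w. u"])
      show "continuous_on UNIV (\<lambda>(u, v, w). a * u^2 + d * u * v + e * u * w + g * v^2 + i * w^2 + k * v * w)"
        unfolding case_prod_unfold by (intro continuous_intros)
      fix u v w :: real assume b: "0 \<le> u" "0 \<le> v" "0 \<le> w" "u \<le> 1" "v \<le> 1" "w \<le> 1"
      have "u * (a * u^2 + d * u * v + e * u * w + g * v^2 + i * w^2 + k * v * w) = f u v w - f 0 v w"
        unfolding f by (simp add: algebra_simps power2_eq_square power3_eq_cube)
      then show "0 \<le> u \<and> u * (a * u^2 + d * u * v + e * u * w + g * v^2 + i * w^2 + k * v * w) \<le> f u v w \<and> u * v * w \<le> u"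
        using nonneg[of 0 v w] b prod(1)[OF b] by simp
    qed
    have hv: "b * q^2 + d * p^2 + g * p * q + h * q * r + j * r^2 + k * p * r \<le> 0"
    proof (rule touch[where K = "\<lambda>u v w. v"])
      show "continuous_on UNIV (\<lambda>(u, v, w). b * v^2 + d * u^2 + g * u * v + h * v * w + j * w^2 + k * u * w)"
        unfolding case_prod_unfold by (intro continuous_intros)
      fix u v w :: real assume b: "0 \<le> u" "0 \<le> v" "0 \<le> w" "u \<le> 1" "v \<le> 1" "w \<le> 1"
      have "v * (b * v^2 + d * u^2 + g * u * v + h * v * w + j * w^2 + k * u * w) = f u v w - f u 0 w"
        unfolding f by (simp add: algebra_simps power2_eq_square power3_eq_cube)
      then show "0 \<le> v \<and> v * (b * v^2 + d * u^2 + g * u * v + h * v * w + j * w^2 + k * u * w) \<le> f u v w \<and> u * v * w \<le> v"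
        using nonneg[of u 0 w] b prod(2)[OF b] by simp
    qed
    have hw: "c * r^2 + e * p^2 + h * q^2 + i * p * r + j * q * r + k * p * q \<le> 0"
    proof (rule touch[where K = "\<lambda>u v w. w"])
      show "continuous_on UNIV (\<lambda>(u, v, w). c * w^2 + e * u^2 + h * v^2 + i * u * w + j * v * w + k * u * v)"
        unfolding case_prod_unfold by (intro continuous_intros)
      fix u v w :: real assume b: "0 \<le> u" "0 \<le> v" "0 \<le> w" "u \<le> 1" "v \<le> 1" "w \<le> 1"
      have "w * (c * w^2 + e * u^2 + h * v^2 + i * u * w + j * v * w + k * u * v) = f u v w - f u v 0"
        unfolding f by (simp add: algebra_simps power2_eq_square power3_eq_cube)
      then show "0 \<le> w \<and> w * (c * w^2 + e * u^2 + h * v^2 + i * u * w + j * v * w + k * u * v) \<le> f u v w \<and> u * v * w \<le> w"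
        using nonneg[of u v 0] b prod(3)[OF b] by simp
    qed
    have fp: "f p q r = 0" using fle nonneg[OF pqr] by simp
    have du: "(g * q^2 + i * r^2 + k * q * r) + 2 * (d * q + e * r) * p + 3 * a * p^2 = 0"
    proof (rule cubic_at_minimum(2))
      show "0 \<le> (b * q^3 + c * r^3 + h * q^2 * r + j * q * r^2) + (g * q^2 + i * r^2 + k * q * r) * t + (d * q + e * r) * t^2 + a * t^3"
        if "t \<ge> 0" for t using nonneg[of t q r] that pqr unfolding f by (simp add: algebra_simps)
      show "(b * q^3 + c * r^3 + h * q^2 * r + j * q * r^2) + (g * q^2 + i * r^2 + k * q * r) * p + (d * q + e * r) * p^2 + a * p^3 \<le> 0"
        using fp unfolding f by (simp add: algebra_simps)
      show "g * q^2 + i * r^2 + k * q * r \<le> 0" if "p = 0" using hu that by simp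
    qed (rule pqr)
    have dv: "(d * p^2 + j * r^2 + k * p * r) + 2 * (g * p + h * r) * q + 3 * b * q^2 = 0"
    proof (rule cubic_at_minimum(2))
      show "0 \<le> (a * p^3 + c * r^3 + e * p^2 * r + i * p * r^2) + (d * p^2 + j * r^2 + k * p * r) * t + (g * p + h * r) * t^2 + b * t^3"
        if "t \<ge> 0" for t using nonneg[of p t r] that pqr unfolding f by (simp add: algebra_simps)
      show "(a * p^3 + c * r^3 + e * p^2 * r + i * p * r^2) + (d * p^2 + j * r^2 + k * p * r) * q + (g * p + h * r) * q^2 + b * q^3 \<le> 0"
        using fp unfolding f by (simp add: algebra_simps)
      show "d * p^2 + j * r^2 + k * p * r \<le> 0" if "q = 0" using hv that by simp
    qed (rule pqr)
    have dw: "(e * p^2 + h * q^2 + k * p * q) + 2 * (i * p + j * q) * r + 3 * c * r^2 = 0"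
    proof (rule cubic_at_minimum(2))
      show "0 \<le> (a * p^3 + b * q^3 + d * p^2 * q + g * p * q^2) + (e * p^2 + h * q^2 + k * p * q) * t + (i * p + j * q) * t^2 + c * t^3"
        if "t \<ge> 0" for t using nonneg[of p q t] that pqr unfolding f by (simp add: algebra_simps)
      show "(a * p^3 + b * q^3 + d * p^2 * q + g * p * q^2) + (e * p^2 + h * q^2 + k * p * q) * r + (i * p + j * q) * r^2 + c * r^3 \<le> 0"
        using fp unfolding f by (simp add: algebra_simps)
      show "e * p^2 + h * q^2 + k * p * q \<le> 0" if "r = 0" using hw that by simp
    qed (rule pqr)
    \<comment> \<open>The coefficient of \<open>s\<close> in \<open>f(x + s p)\<close>.\<close>
    define Q where "Q = (\<lambda>u v w. (3 * a * p + d * q + e * r) * u^2 + (3 * b * q + g * p + h * r) * v^2 + (3 * c * r + i * p + j * q) * w^2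
      + (2 * d * p + 2 * g * q + k * r) * u * v + (2 * e * p + 2 * i * r + k * q) * u * w + (2 * h * q + 2 * j * r + k * p) * v * w)"
    have "quadric Q" unfolding Q_def by (rule quadricI) simp
    moreover have "f (u + s * p) (v + s * q) (w + s * r) = f u v w + s * Q u v w" for s u v w
    proof -
      have "f (u + s * p) (v + s * q) (w + s * r) = f u v w + s * Q u v w
        + s^2 * (u * ((g * q^2 + i * r^2 + k * q * r) + 2 * (d * q + e * r) * p + 3 * a * p^2)
          + v * ((d * p^2 + j * r^2 + k * p * r) + 2 * (g * p + h * r) * q + 3 * b * q^2)
          + w * ((e * p^2 + h * q^2 + k * p * q) + 2 * (i * p + j * q) * r + 3 * c * r^2)) + s^3 * f p q r"
        unfolding f Q_def by (simp add: algebra_simps power2_eq_square power3_eq_cube)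
      then show ?thesis by (simp only: du dv dw fp) simp
    qed
    ultimately have "double_point f p q r Q" by (simp add: double_point_def)
    then show ?thesis using pqr sum1 by (intro that[of p q r]) auto
  qed
qed

section \<open>Binary cubics on the edges of the orthant\<close>

definition binary_cubic :: "(real \<Rightarrow> real \<Rightarrow> real) \<Rightarrow> bool" where
  "binary_cubic \<phi> \<longleftrightarrow> (\<exists>a b c d. \<forall>y z. \<phi> y z = a * y^3 + b * y^2 * z + c * y * z^2 + d * z^3)"

lemma binary_cubicI:
  assumes "\<And>y z. \<phi> y z = a * y^3 + b * y^2 * z + c * y * z^2 + d * z^3"
  shows "binary_cubic \<phi>"
  unfolding binary_cubic_def by (intro exI allI) (rule assms)

lemma binary_cubic_edges:
  assumes "cubic f"
  shows "binary_cubic (\<lambda>v w. f 0 v w)" "binary_cubic (\<lambda>u w. f u 0 w)" "binary_cubic (\<lambda>u v. f u v 0)"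
proof -
  obtain a b c d e g h i j k where f: "\<And>u v w. f u v w =
     a * u^3 + b * v^3 + c * w^3 + d * u^2 * v + e * u^2 * w + g * u * v^2
     + h * v^2 * w + i * u * w^2 + j * v * w^2 + k * u * v * w"
    using assms unfolding cubic_def by blast
  show "binary_cubic (\<lambda>v w. f 0 v w)" by (rule binary_cubicI[of _ b h j c]) (simp add: f)
  show "binary_cubic (\<lambda>u w. f u 0 w)" by (rule binary_cubicI[of _ a e i c]) (simp add: f)
  show "binary_cubic (\<lambda>u v. f u v 0)" by (rule binary_cubicI[of _ a d g b]) (simp add: f)
qed

text \<open>
  A critical point \<open>(X, Y)\<close> of a binary cubic form is a double zero by Euler's identity.
\<close>

lemma binary_cubic_factor:
  fixes a b c d X Y :: real
  assumes dX: "3 * a * X^2 + 2 * b * X * Y + c * Y^2 = 0"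
    and dY: "b * X^2 + 2 * c * X * Y + 3 * d * Y^2 = 0" and nz: "X \<noteq> 0 \<or> Y \<noteq> 0"
  shows "\<exists>\<gamma> \<delta>. \<forall>y z. a * y^3 + b * y^2 * z + c * y * z^2 + d * z^3 = (Y * y - X * z)^2 * (\<gamma> * y + \<delta> * z)"
proof -
  consider "Y = 0" "X \<noteq> 0" | "X = 0" "Y \<noteq> 0" | "X \<noteq> 0" "Y \<noteq> 0" using nz by blast
  then show ?thesis
  proof cases
    case 1
    then have "a = 0" "b = 0" using dX dY by auto
    then show ?thesis using 1
      by (intro exI[of _ "c / X^2"] exI[of _ "d / X^2"]) (simp add: field_simps power2_eq_square power3_eq_cube)
  next
    case 2
    then have "c = 0" "d = 0" using dX dY by auto
    then show ?thesis using 2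
      by (intro exI[of _ "a / Y^2"] exI[of _ "b / Y^2"]) (simp add: field_simps power2_eq_square power3_eq_cube)
  next
    case 3
    define \<gamma> \<delta> where "\<gamma> = a / Y^2" and "\<delta> = d / X^2"
    have a: "a = \<gamma> * Y^2" and d: "d = \<delta> * X^2" using 3 by (simp_all add: \<gamma>_def \<delta>_def)
    have "(X^2 * Y) * b = (X^2 * Y) * (\<delta> * Y^2 - 2 * X * Y * \<gamma>)"
      using dX dY unfolding a d by algebra
    then have b: "b = \<delta> * Y^2 - 2 * X * Y * \<gamma>" using 3 by simp
    have "Y^2 * c = Y^2 * (\<gamma> * X^2 - 2 * X * Y * \<delta>)"
      using dX unfolding a b by algebra
    then have c: "c = \<gamma> * X^2 - 2 * X * Y * \<delta>" using 3 by simp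
    show ?thesis unfolding a b c d
      by (intro exI[of _ \<gamma>] exI[of _ \<delta>]) (simp add: algebra_simps power2_eq_square power3_eq_cube)
  qed
qed

lemma binary_quadric_factor:
  fixes a b c X Y :: real
  assumes dX: "2 * a * X + b * Y = 0" and dY: "b * X + 2 * c * Y = 0" and nz: "X \<noteq> 0 \<or> Y \<noteq> 0"
  shows "\<exists>\<kappa>. \<forall>y z. a * y^2 + b * y * z + c * z^2 = \<kappa> * (Y * y - X * z)^2"
proof (cases "X = 0")
  case True
  then have "b = 0" "c = 0" "Y \<noteq> 0" using assms by auto
  then show ?thesis using True by (intro exI[of _ "a / Y^2"]) (simp add: field_simps)
next
  case False
  have "X * b = X * (- 2 * (c / X^2) * X * Y)" using dY False by (simp add: field_simps power2_eq_square)
  then have b: "b = - 2 * (c / X^2) * X * Y" using mult_left_cancel[OF False] by blast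
  have "X * a = X * ((c / X^2) * Y^2)" using dX unfolding b using False
    by (simp add: field_simps power2_eq_square)
  then have a: "a = (c / X^2) * Y^2" using mult_left_cancel[OF False] by blast
  have c: "c = (c / X^2) * X^2" using False by simp
  define \<kappa> where "\<kappa> = c / X^2"
  have "a * y^2 + b * y * z + c * z^2 = \<kappa> * (Y * y - X * z)^2" for y z
    using a b c unfolding \<kappa>_def[symmetric] by (simp only:) (simp add: algebra_simps power2_eq_square)
  then show ?thesis by blast
qed

text \<open>
  The double zero is the point \<open>(\<alpha>, \<beta>)\<close>.  It may be an end point of the edge; the remaining linear factor
  is then still required to be non-negative.
\<close>

definition double_zero :: "(real \<Rightarrow> real \<Rightarrow> real) \<Rightarrow> real \<Rightarrow> real \<Rightarrow> bool" where
  "double_zero \<phi> \<alpha> \<beta> \<longleftrightarrow> 0 \<le> \<alpha> \<and> 0 \<le> \<beta> \<and> 0 < \<alpha> + \<beta> \<and>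
     (\<exists>\<gamma>\<ge>0. \<exists>\<delta>\<ge>0. \<forall>y z. \<phi> y z = (\<beta> * y - \<alpha> * z)^2 * (\<gamma> * y + \<delta> * z))"

text \<open>
  If the cubic does not dominate \<open>y z (y + z)\<close>, then a touching point is a critical zero, by the argument of
  \<open>exists_double_point\<close> in two variables.
\<close>

lemma edge_dichotomy:
  assumes "binary_cubic \<phi>" and nonneg: "\<And>y z. y \<ge> 0 \<Longrightarrow> z \<ge> 0 \<Longrightarrow> 0 \<le> \<phi> y z"
  obtains \<alpha> \<beta> where "double_zero \<phi> \<alpha> \<beta>"
  | \<epsilon> where "\<epsilon> > 0" "\<And>y z. y \<ge> 0 \<Longrightarrow> z \<ge> 0 \<Longrightarrow> \<epsilon> * (y^2 * z + y * z^2) \<le> \<phi> y z"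
proof -
  obtain a b c d where \<phi>: "\<And>y z. \<phi> y z = a * y^3 + b * y^2 * z + c * y * z^2 + d * z^3"
    using assms(1) unfolding binary_cubic_def by blast
  have ad: "a \<ge> 0" "d \<ge> 0" using nonneg[of 1 0] nonneg[of 0 1] by (auto simp: \<phi>)
  define S where "S = {(y, z). 0 \<le> y \<and> 0 \<le> z \<and> y + z = (1::real)}"
  have compact: "compact S"
  proof -
    have "S = ({0..1} \<times> {0..1}) \<inter> {x. fst x + snd x = 1}" by (auto simp: S_def)
    moreover have "closed {x::real\<times>real. fst x + snd x = 1}"
      by (intro closed_Collect_eq continuous_intros)
    moreover have "compact ({0..1} \<times> {0..1::real} :: (real \<times> real) set)"
      by (intro compact_Times compact_Icc)
    ultimately show ?thesis using compact_Int_closed by fastforce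
  qed
  define F where "F = (\<lambda>(y, z). \<phi> y z)"
  define M :: "real \<times> real \<Rightarrow> real" where "M = (\<lambda>(y, z). y * z)"
  show ?thesis
  proof (cases "\<exists>\<epsilon>>0. \<forall>x\<in>S. \<epsilon> * M x \<le> F x")
    case True
    then obtain \<epsilon> where eps: "\<epsilon> > 0" "\<And>x. x \<in> S \<Longrightarrow> \<epsilon> * M x \<le> F x" by blast
    have "\<epsilon> * (y^2 * z + y * z^2) \<le> \<phi> y z" if nn: "y \<ge> 0" "z \<ge> 0" for y z
    proof (cases "y + z = 0")
      case True
      then have "y = 0" "z = 0" using nn by linarith+
      then show ?thesis by (simp add: \<phi>)
    next
      case False
      define s where "s = y + z"
      have s: "s > 0" using False nn by (simp add: s_def)
      have "(y/s, z/s) \<in> S" using s nn by (simp add: S_def s_def add_divide_distrib[symmetric])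
      then have "\<epsilon> * (y/s * (z/s)) \<le> \<phi> (y/s) (z/s)" using eps(2) by (force simp: F_def M_def)
      moreover have "\<phi> (y/s) (z/s) = \<phi> y z / s^3"
        by (simp add: \<phi> field_simps power3_eq_cube power2_eq_square add_divide_distrib)
      moreover have "y/s * (z/s) = (y^2 * z + y * z^2) / s^3"
      proof -
        have "y^2 * z + y * z^2 = y * z * s" by (simp add: s_def algebra_simps power2_eq_square)
        then show ?thesis using s by (simp add: power3_eq_cube)
      qed
      ultimately have "\<epsilon> * ((y^2 * z + y * z^2) / s^3) \<le> \<phi> y z / s^3" by (simp only:)
      then show ?thesis using s by (simp add: divide_le_cancel)
    qed
    then show ?thesis using eps(1) that(2) by blast
  next
    case False
    then have "\<exists>x\<in>S. F x < \<epsilon> * M x" if "\<epsilon> > 0" for \<epsilon>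
      using that by (meson not_le)
    from touching_point[OF compact this] obtain x where x: "x \<in> S"
      and touch: "\<And>H K C. continuous_on S H \<Longrightarrow>
           (\<forall>y\<in>S. 0 \<le> K y \<and> K y * H y \<le> F y \<and> M y \<le> C * K y) \<Longrightarrow> H x \<le> 0" by blast
    obtain p q where xpq: "x = (p, q)" by (cases x) auto
    have pq: "0 \<le> p" "0 \<le> q" "p + q = 1" using x by (auto simp: xpq S_def)
    have b: "0 \<le> y" "0 \<le> z" "y \<le> 1" "z \<le> 1" "y * z \<le> y" "y * z \<le> z" "y * z \<le> 1" if "(y, z) \<in> S" for y z
    proof -
      show *: "0 \<le> y" "0 \<le> z" "y \<le> 1" "z \<le> 1" using that by (auto simp: S_def)
      show "y * z \<le> y" "y * z \<le> z" using * by (simp_all add: mult_left_le mult_left_le_one_le)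
      then show "y * z \<le> 1" using * by linarith
    qed
    have "F x \<le> 0"
    proof (rule touch[of F "\<lambda>_. 1" 1])
      show "continuous_on S F"
        unfolding F_def \<phi> case_prod_unfold by (intro continuous_intros)
    qed (auto simp: M_def b)
    then have zero: "\<phi> p q \<le> 0" by (simp add: F_def xpq)
    have "(\<lambda>(y, z). a * y^2 + b * y * z + c * z^2) x \<le> 0"
    proof (rule touch[of _ fst 1])
      show "continuous_on S (\<lambda>(y, z). a * y^2 + b * y * z + c * z^2)"
        unfolding case_prod_unfold by (intro continuous_intros)
      show "\<forall>y\<in>S. 0 \<le> fst y \<and> fst y * (case y of (y, z) \<Rightarrow> a * y^2 + b * y * z + c * z^2) \<le> F y \<and> M y \<le> 1 * fst y"
      proof clarify
        fix y z assume s: "(y, z) \<in> S"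
        have "y * (a * y^2 + b * y * z + c * z^2) = \<phi> y z - d * z^3"
          by (simp add: \<phi> algebra_simps power2_eq_square power3_eq_cube)
        then show "0 \<le> fst (y, z) \<and> fst (y, z) * (a * y^2 + b * y * z + c * z^2) \<le> F (y, z) \<and> M (y, z) \<le> 1 * fst (y, z)"
          using b[OF s] ad by (simp add: F_def M_def)
      qed
    qed
    then have hy: "a * p^2 + b * p * q + c * q^2 \<le> 0" by (simp add: xpq)
    have "(\<lambda>(y, z). b * y^2 + c * y * z + d * z^2) x \<le> 0"
    proof (rule touch[of _ snd 1])
      show "continuous_on S (\<lambda>(y, z). b * y^2 + c * y * z + d * z^2)"
        unfolding case_prod_unfold by (intro continuous_intros)
      show "\<forall>y\<in>S. 0 \<le> snd y \<and> snd y * (case y of (y, z) \<Rightarrow> b * y^2 + c * y * z + d * z^2) \<le> F y \<and> M y \<le> 1 * snd y"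
      proof clarify
        fix y z assume s: "(y, z) \<in> S"
        have "z * (b * y^2 + c * y * z + d * z^2) = \<phi> y z - a * y^3"
          by (simp add: \<phi> algebra_simps power2_eq_square power3_eq_cube)
        then show "0 \<le> snd (y, z) \<and> snd (y, z) * (b * y^2 + c * y * z + d * z^2) \<le> F (y, z) \<and> M (y, z) \<le> 1 * snd (y, z)"
          using b[OF s] ad by (simp add: F_def M_def)
      qed
    qed
    then have hz: "b * p^2 + c * p * q + d * q^2 \<le> 0" by (simp add: xpq)
    have "c * q^2 + 2 * (b * q) * p + 3 * a * p^2 = 0"
    proof (rule cubic_at_minimum(2))
      show "0 \<le> d * q^3 + c * q^2 * t + b * q * t^2 + a * t^3" if "t \<ge> 0" for t
        using nonneg[of t q] that pq unfolding \<phi> by (simp add: algebra_simps)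
      show "d * q^3 + c * q^2 * p + b * q * p^2 + a * p^3 \<le> 0"
        using zero unfolding \<phi> by (simp add: algebra_simps)
      show "c * q^2 \<le> 0" if "p = 0" using hy that by simp
    qed (rule pq)
    moreover have "b * p^2 + 2 * (c * p) * q + 3 * d * q^2 = 0"
    proof (rule cubic_at_minimum(2))
      show "0 \<le> a * p^3 + b * p^2 * t + c * p * t^2 + d * t^3" if "t \<ge> 0" for t
        using nonneg[of p t] that pq unfolding \<phi> by (simp add: algebra_simps)
      show "a * p^3 + b * p^2 * q + c * p * q^2 + d * q^3 \<le> 0"
        using zero unfolding \<phi> by (simp add: algebra_simps)
      show "b * p^2 \<le> 0" if "q = 0" using hz that by simp
    qed (rule pq)
    ultimately obtain \<gamma> \<delta> where fac: "\<And>y z. \<phi> y z = (q * y - p * z)^2 * (\<gamma> * y + \<delta> * z)"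
      using binary_cubic_factor[of a p b q c d] pq unfolding \<phi> by (auto simp: algebra_simps)
    have "\<gamma> \<ge> 0"
    proof (cases "q = 0")
      case True
      then have "0 \<le> \<delta> + s * \<gamma>" if "s \<ge> 0" for s
        using nonneg[of s 1] that pq by (simp add: fac algebra_simps)
      then show ?thesis by (rule nonneg_linear)
    next
      case False
      then show ?thesis using nonneg[of 1 0] by (simp add: fac zero_le_mult_iff)
    qed
    moreover have "\<delta> \<ge> 0"
    proof (cases "p = 0")
      case True
      then have "0 \<le> \<gamma> + s * \<delta>" if "s \<ge> 0" for s
        using nonneg[of 1 s] that pq by (simp add: fac algebra_simps)
      then show ?thesis by (rule nonneg_linear)
    next
      case False
      then show ?thesis using nonneg[of 0 1] by (simp add: fac zero_le_mult_iff)
    qed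
    ultimately have "double_zero \<phi> p q" using fac pq unfolding double_zero_def by auto
    then show ?thesis by (rule that(1))
  qed
qed

text \<open>
  The square \<open>(\<kappa>1 y + \<kappa>2 z)^2\<close> contributes the monomial \<open>z^3\<close>, which the lower bound of \<open>edge_dichotomy\<close> does not
  control; it is dominated as soon as the cubic is positive at the vertex \<open>(0, 1)\<close>.
\<close>

lemma edge_bound_without_double_zero:
  assumes "binary_cubic \<phi>" and nonneg: "\<And>y z. y \<ge> 0 \<Longrightarrow> z \<ge> 0 \<Longrightarrow> 0 \<le> \<phi> y z"
    and nd: "\<nexists>\<alpha> \<beta>. double_zero \<phi> \<alpha> \<beta>" and \<kappa>: "\<kappa>2 = 0 \<or> \<phi> 0 1 > 0"
  shows "\<exists>C\<ge>0. \<forall>y\<ge>0. \<forall>z\<ge>0. z * (\<kappa>1 * y + \<kappa>2 * z)^2 \<le> C * \<phi> y z"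
proof -
  obtain \<epsilon> where eps: "\<epsilon> > 0" and \<epsilon>: "\<And>y z. y \<ge> 0 \<Longrightarrow> z \<ge> 0 \<Longrightarrow> \<epsilon> * (y^2 * z + y * z^2) \<le> \<phi> y z"
    using edge_dichotomy[OF assms(1) nonneg] nd by metis
  have mixed: "y^2 * z + y * z^2 \<le> \<phi> y z / \<epsilon>" if "y \<ge> 0" "z \<ge> 0" for y z
    using \<epsilon>[OF that] eps by (simp add: pos_le_divide_eq mult.commute)
  obtain a b c d where \<phi>: "\<And>y z. \<phi> y z = a * y^3 + b * y^2 * z + c * y * z^2 + d * z^3"
    using assms(1) unfolding binary_cubic_def by blast
  show ?thesis
  proof (cases "\<kappa>2 = 0")
    case True
    have "z * (\<kappa>1 * y + \<kappa>2 * z)^2 \<le> (\<kappa>1^2 / \<epsilon>) * \<phi> y z" if "y \<ge> 0" "z \<ge> 0" for y z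
    proof -
      have "z * (\<kappa>1 * y + \<kappa>2 * z)^2 = \<kappa>1^2 * (y^2 * z)" using True by (simp add: power_mult_distrib)
      also have "\<dots> \<le> \<kappa>1^2 * (\<phi> y z / \<epsilon>)"
        using mixed[OF that] that by (intro mult_left_mono) (auto simp: add_increasing2 intro: order_trans[rotated])
      finally show ?thesis by simp
    qed
    then show ?thesis using eps by (intro exI[of _ "\<kappa>1^2 / \<epsilon>"]) auto
  next
    case False
    then have d: "d > 0" using \<kappa> by (simp add: \<phi>)
    have a: "a \<ge> 0" using nonneg[of 1 0] by (simp add: \<phi>)
    define B where "B = \<bar>b\<bar> + \<bar>c\<bar>"
    define C where "C = 2 * \<kappa>1^2 / \<epsilon> + 2 * \<kappa>2^2 / d * (1 + B / \<epsilon>)"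
    have B: "B \<ge> 0" by (simp add: B_def)
    have "z * (\<kappa>1 * y + \<kappa>2 * z)^2 \<le> C * \<phi> y z" if yz: "y \<ge> 0" "z \<ge> 0" for y z
    proof -
      have m: "y^2 * z \<ge> 0" "y * z^2 \<ge> 0" using yz by auto
      have "- b \<le> B" "- c \<le> B" by (auto simp: B_def)
      then have "- b * (y^2 * z) \<le> B * (y^2 * z)" "- c * (y * z^2) \<le> B * (y * z^2)"
        using m by (intro mult_right_mono; simp)+
      then have "- b * (y^2 * z) - c * (y * z^2) \<le> B * (y^2 * z + y * z^2)" by (simp add: algebra_simps)
      also have "\<dots> \<le> B * (\<phi> y z / \<epsilon>)" using mixed[OF yz] B by (rule mult_left_mono)
      finally have "- b * (y^2 * z) - c * (y * z^2) \<le> B * (\<phi> y z / \<epsilon>)" .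
      moreover have "d * z^3 = \<phi> y z - a * y^3 - b * (y^2 * z) - c * (y * z^2)" by (simp add: \<phi>)
      moreover have "a * y^3 \<ge> 0" using a yz by simp
      moreover have "\<phi> y z * (1 + B / \<epsilon>) = \<phi> y z + B * (\<phi> y z / \<epsilon>)" by (simp add: algebra_simps)
      ultimately have "d * z^3 \<le> \<phi> y z * (1 + B / \<epsilon>)" by linarith
      then have z3: "z^3 \<le> \<phi> y z * (1 + B / \<epsilon>) / d" using d by (simp add: pos_le_divide_eq mult.commute)
      have "(\<kappa>1 * y + \<kappa>2 * z)^2 \<le> 2 * (\<kappa>1 * y)^2 + 2 * (\<kappa>2 * z)^2"
        using sum_squares_bound[of "\<kappa>1 * y" "\<kappa>2 * z"] by (simp add: power2_sum)
      then have "z * (\<kappa>1 * y + \<kappa>2 * z)^2 \<le> z * (2 * (\<kappa>1 * y)^2 + 2 * (\<kappa>2 * z)^2)"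
        using yz by (intro mult_left_mono)
      also have "\<dots> = 2 * \<kappa>1^2 * (y^2 * z) + 2 * \<kappa>2^2 * z^3"
        by (simp add: algebra_simps power2_eq_square power3_eq_cube)
      also have "\<dots> \<le> 2 * \<kappa>1^2 * (\<phi> y z / \<epsilon>) + 2 * \<kappa>2^2 * (\<phi> y z * (1 + B / \<epsilon>) / d)"
        using mixed[OF yz] m z3 by (intro add_mono mult_left_mono) auto
      also have "\<dots> = C * \<phi> y z" by (simp add: C_def algebra_simps)
      finally show ?thesis .
    qed
    then show ?thesis using eps d B by (intro exI[of _ C]) (auto simp: C_def)
  qed
qed

section \<open>Cubics divisible by a coordinate\<close>

definition divisible_by_variable :: "real_fun3 \<Rightarrow> bool" where
  "divisible_by_variable f \<longleftrightarrow> (\<forall>v w. f 0 v w = 0) \<or> (\<forall>u w. f u 0 w = 0) \<or> (\<forall>u v. f u v 0 = 0)"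

lemma divisible_swap12: "divisible_by_variable (\<lambda>u v w. f v u w) \<longleftrightarrow> divisible_by_variable f"
  unfolding divisible_by_variable_def by metis

lemma divisible_swap23: "divisible_by_variable (\<lambda>u v w. f u w v) \<longleftrightarrow> divisible_by_variable f"
  unfolding divisible_by_variable_def by metis

text \<open>
  The dominated cubic \<open>u m^2\<close> is a nonzero multiple of \<open>f\<close>, so the coordinate \<open>u\<close> divides \<open>f\<close>.
\<close>

lemma divisible_if_dominates_u:
  assumes ext: "extremal_cubic f" and m: "m1 \<noteq> 0 \<or> m2 \<noteq> 0 \<or> m3 \<noteq> 0"
    and le: "\<And>u v w. u \<ge> 0 \<Longrightarrow> v \<ge> 0 \<Longrightarrow> w \<ge> 0 \<Longrightarrow> u * (m1 * u + m2 * v + m3 * w)^2 \<le> C * f u v w"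
  shows "divisible_by_variable f"
proof -
  have "cubic (\<lambda>u v w. (1 * u + 0 * v + 0 * w) * (m1 * u + m2 * v + m3 * w)^2)"
    by (rule cubic_linear_times_square)
  then have c: "cubic (\<lambda>u v w. u * (m1 * u + m2 * v + m3 * w)^2)" by simp
  have "0 \<le> u * (m1 * u + m2 * v + m3 * w)^2 \<and> u * (m1 * u + m2 * v + m3 * w)^2 \<le> C * f u v w"
    if "u \<ge> 0" "v \<ge> 0" "w \<ge> 0" for u v w
    using le that by simp
  from extremal_cubic_dominated[OF ext c this]
  obtain a where a: "\<And>u v w. u * (m1 * u + m2 * v + m3 * w)^2 = a * f u v w" by blast
  have "m1 \<noteq> 0 \<or> m1 + m2 \<noteq> 0 \<or> m1 + m3 \<noteq> 0" using m by auto
  then have "a \<noteq> 0" using a[of 1 0 0] a[of 1 1 0] a[of 1 0 1] by auto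
  then have "f 0 v w = 0" for v w using a[of 0 v w] by simp
  then show ?thesis by (simp add: divisible_by_variable_def)
qed

lemma divisible_if_dominates_v:
  assumes ext: "extremal_cubic f" and m: "m1 \<noteq> 0 \<or> m2 \<noteq> 0 \<or> m3 \<noteq> 0"
    and le: "\<And>u v w. u \<ge> 0 \<Longrightarrow> v \<ge> 0 \<Longrightarrow> w \<ge> 0 \<Longrightarrow> v * (m1 * u + m2 * v + m3 * w)^2 \<le> C * f u v w"
  shows "divisible_by_variable f"
proof -
  have "divisible_by_variable (\<lambda>u v w. f v u w)"
  proof (rule divisible_if_dominates_u[OF extremal_cubic_swap12[OF ext], of m2 m1 m3 C])
    show "m2 \<noteq> 0 \<or> m1 \<noteq> 0 \<or> m3 \<noteq> 0" using m by blast
    show "u * (m2 * u + m1 * v + m3 * w)^2 \<le> C * f v u w" if "u \<ge> 0" "v \<ge> 0" "w \<ge> 0" for u v w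
      using le[of v u w] that by (simp add: add.commute)
  qed
  then show ?thesis using divisible_swap12[of f] by blast
qed

lemma divisible_if_dominates_w:
  assumes ext: "extremal_cubic f" and m: "m1 \<noteq> 0 \<or> m2 \<noteq> 0 \<or> m3 \<noteq> 0"
    and le: "\<And>u v w. u \<ge> 0 \<Longrightarrow> v \<ge> 0 \<Longrightarrow> w \<ge> 0 \<Longrightarrow> w * (m1 * u + m2 * v + m3 * w)^2 \<le> C * f u v w"
  shows "divisible_by_variable f"
proof -
  have "divisible_by_variable (\<lambda>u v w. f u w v)"
  proof (rule divisible_if_dominates_v[OF extremal_cubic_swap23[OF ext], of m1 m3 m2 C])
    show "m1 \<noteq> 0 \<or> m3 \<noteq> 0 \<or> m2 \<noteq> 0" using m by blast
    show "v * (m1 * u + m3 * v + m2 * w)^2 \<le> C * f u w v" if "u \<ge> 0" "v \<ge> 0" "w \<ge> 0" for u v w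
      using le[of u w v] that by (simp add: add.commute add.left_commute)
  qed
  then show ?thesis using divisible_swap23[of f] by blast
qed

text \<open>
  The points \<open>(1, t, t^2)\<close> approach the vertex at which the linear factor takes the value \<open>l1\<close>, and a nonzero linear
  form \<open>m\<close> vanishes at only finitely many of them.
\<close>

lemma nonneg_times_square_coeff:
  fixes l1 l2 l3 m1 m2 m3 :: real
  assumes nn: "\<And>u v w. u \<ge> 0 \<Longrightarrow> v \<ge> 0 \<Longrightarrow> w \<ge> 0 \<Longrightarrow>
      0 \<le> (l1 * u + l2 * v + l3 * w) * (m1 * u + m2 * v + m3 * w)^2"
    and m: "m1 \<noteq> 0 \<or> m2 \<noteq> 0 \<or> m3 \<noteq> 0"
  shows "0 \<le> l1"
proof (rule ccontr)
  assume "\<not> 0 \<le> l1"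
  have "((\<lambda>t. l1 + l2 * t + l3 * t^2) \<longlongrightarrow> l1 + l2 * 0 + l3 * 0^2) (at_right 0)"
    by (intro tendsto_intros)
  then have ev: "\<forall>\<^sub>F t in at_right 0. l1 + l2 * t + l3 * t^2 < 0"
    by (rule order_tendstoD) (use \<open>\<not> 0 \<le> l1\<close> in simp)
  have "\<forall>\<^sub>F t in at_right (0::real). 0 < t" by (simp add: eventually_at_right_less)
  with ev have "\<forall>\<^sub>F t in at_right 0. m1 + m2 * t + m3 * t^2 = 0"
  proof eventually_elim
    case (elim t)
    then have "0 \<le> (l1 + l2 * t + l3 * t^2) * (m1 + m2 * t + m3 * t^2)^2"
      using nn[of 1 t "t^2"] by simp
    then have "(m1 + m2 * t + m3 * t^2)^2 \<le> 0"
      using elim by (simp add: zero_le_mult_iff)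
    then show ?case by simp
  qed
  then obtain d where d: "d > 0" "\<And>t. 0 < t \<Longrightarrow> t < d \<Longrightarrow> m1 + m2 * t + m3 * t^2 = 0"
    unfolding eventually_at_right_field by auto
  have e: "m1 + m2 * (d/2) + m3 * (d/2)^2 = 0" "m1 + m2 * (d/3) + m3 * (d/3)^2 = 0"
    "m1 + m2 * (d/4) + m3 * (d/4)^2 = 0"
    using d(1) by (intro d(2); simp)+
  from e have "d * (m2 + m3 * (5/6 * d)) = 0" "d * (m2 + m3 * (3/4 * d)) = 0"
    by (simp_all add: algebra_simps power2_eq_square)
  then have "m2 + m3 * (5/6 * d) = 0" "m2 + m3 * (3/4 * d) = 0" using d(1) by simp_all
  then have "m2 + 5/6 * (m3 * d) = 0" "m2 + 3/4 * (m3 * d) = 0" by (simp_all add: algebra_simps)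
  then have "m3 * d = 0" by linarith
  then have "m3 = 0" using d(1) by simp
  with \<open>m2 + m3 * (5/6 * d) = 0\<close> e m show False by simp
qed

text \<open>
  The linear factor has non-negative coefficients, so \<open>f\<close> is a sum of terms such as \<open>l1 u m^2\<close>, each of
  which it dominates.
\<close>

lemma linear_times_square_divisible:
  assumes ext: "extremal_cubic f"
    and f: "\<And>u v w. f u v w = (l1 * u + l2 * v + l3 * w) * (m1 * u + m2 * v + m3 * w)^2"
  shows "divisible_by_variable f"
proof -
  obtain u0 v0 w0 where "f u0 v0 w0 \<noteq> 0" using extremal_cubicD(3)[OF ext] by blast
  then have m: "m1 \<noteq> 0 \<or> m2 \<noteq> 0 \<or> m3 \<noteq> 0" and l: "l1 \<noteq> 0 \<or> l2 \<noteq> 0 \<or> l3 \<noteq> 0" by (auto simp: f)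
  note nn = extremal_cubicD(2)[OF ext, unfolded f]
  have l1: "l1 \<ge> 0" by (rule nonneg_times_square_coeff[of l1 l2 l3 m1 m2 m3]) (use nn m in auto)
  have l2: "l2 \<ge> 0"
  proof (rule nonneg_times_square_coeff[of l2 l1 l3 m2 m1 m3])
    show "0 \<le> (l2 * u + l1 * v + l3 * w) * (m2 * u + m1 * v + m3 * w)^2"
      if "u \<ge> 0" "v \<ge> 0" "w \<ge> 0" for u v w using nn[of v u w] that by (simp add: add.commute)
  qed (use m in auto)
  have l3: "l3 \<ge> 0"
  proof (rule nonneg_times_square_coeff[of l3 l2 l1 m3 m2 m1])
    show "0 \<le> (l3 * u + l2 * v + l1 * w) * (m3 * u + m2 * v + m1 * w)^2"
      if "u \<ge> 0" "v \<ge> 0" "w \<ge> 0" for u v w using nn[of w v u] that by (simp add: add_ac)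
  qed (use m in auto)
  have part: "l1 * u * (m1 * u + m2 * v + m3 * w)^2 \<le> f u v w"
    "l2 * v * (m1 * u + m2 * v + m3 * w)^2 \<le> f u v w"
    "l3 * w * (m1 * u + m2 * v + m3 * w)^2 \<le> f u v w"
    if "u \<ge> 0" "v \<ge> 0" "w \<ge> 0" for u v w
    unfolding f using that l1 l2 l3 by (auto intro!: mult_right_mono)
  consider "l1 > 0" | "l2 > 0" | "l3 > 0" using l l1 l2 l3 by force
  then show ?thesis
  proof cases
    case 1
    show ?thesis
      by (rule divisible_if_dominates_u[OF ext m, of "1 / l1"]) (use part(1) 1 in \<open>simp add: field_simps\<close>)
  next
    case 2
    show ?thesis
      by (rule divisible_if_dominates_v[OF ext m, of "1 / l2"]) (use part(2) 2 in \<open>simp add: field_simps\<close>)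
  next
    case 3
    show ?thesis
      by (rule divisible_if_dominates_w[OF ext m, of "1 / l3"]) (use part(3) 3 in \<open>simp add: field_simps\<close>)
  qed
qed

section \<open>Semidefinite binary quadratic forms\<close>

lemma psd_binary_quadric_cases:
  fixes a b c :: real
  assumes psd: "\<And>X Y. 0 \<le> a * X^2 + b * X * Y + c * Y^2"
  obtains (definite) "\<And>\<kappa>1 \<kappa>2. \<exists>C\<ge>0. \<forall>X Y. (\<kappa>1 * X + \<kappa>2 * Y)^2 \<le> C * (a * X^2 + b * X * Y + c * Y^2)"
  | (square) X0 Y0 \<kappa> where "X0 \<noteq> 0 \<or> Y0 \<noteq> 0" "\<kappa> \<ge> 0"
      "\<And>X Y. a * X^2 + b * X * Y + c * Y^2 = \<kappa> * (Y0 * X - X0 * Y)^2"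
proof -
  define D where "D = 4 * a * c - b^2"
  have a: "a \<ge> 0" and c: "c \<ge> 0" using psd[of 1 0] psd[of 0 1] by auto
  have "0 \<le> a * D"
    using psd[of "-b" "2 * a"] by (simp add: D_def algebra_simps power2_eq_square)
  moreover have "0 \<le> c * D"
    using psd[of "2 * c" "-b"] by (simp add: D_def algebra_simps power2_eq_square)
  moreover have "b = 0" if "a = 0" "c = 0" using psd[of 1 1] psd[of 1 "-1"] that by simp
  ultimately have D: "D \<ge> 0" using a c by (cases "a = 0"; cases "c = 0") (auto simp: zero_le_mult_iff mult_le_0_iff D_def)
  show ?thesis
  proof (cases "D = 0")
    case True
    have "\<exists>X0 Y0. (X0 \<noteq> 0 \<or> Y0 \<noteq> 0) \<and> 2 * a * X0 + b * Y0 = 0 \<and> b * X0 + 2 * c * Y0 = 0"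
    proof (cases "a = 0")
      case True
      with \<open>D = 0\<close> have "b = 0" by (simp add: D_def)
      with True have "2 * a * 1 + b * 0 = 0" "b * 1 + 2 * c * 0 = 0" "(1::real) \<noteq> 0" by simp_all
      then show ?thesis by blast
    next
      case False
      with \<open>D = 0\<close> have "2 * a * (- b) + b * (2 * a) = 0" "b * (- b) + 2 * c * (2 * a) = 0" "2 * a \<noteq> 0"
        by (simp_all add: D_def power2_eq_square mult_ac)
      then show ?thesis by blast
    qed
    then obtain X0 Y0 where nz: "X0 \<noteq> 0 \<or> Y0 \<noteq> 0" and "2 * a * X0 + b * Y0 = 0" "b * X0 + 2 * c * Y0 = 0"
      by blast
    from binary_quadric_factor[OF this(2,3) nz] obtain \<kappa>
      where \<kappa>: "\<And>X Y. a * X^2 + b * X * Y + c * Y^2 = \<kappa> * (Y0 * X - X0 * Y)^2" by blast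
    have "0 \<le> \<kappa> * (Y0^2 + X0^2)^2"
      using psd[of Y0 "-X0"] unfolding \<kappa> by (simp add: power2_eq_square)
    moreover have "Y0^2 + X0^2 > 0" using nz by (simp add: sum_power2_gt_zero_iff disj_commute)
    ultimately have "\<kappa> \<ge> 0" using nz by (auto simp: zero_le_mult_iff)
    then show ?thesis using nz \<kappa> by (intro square)
  next
    case False
    with D have Dp: "D > 0" by simp
    have "\<exists>C\<ge>0. \<forall>X Y. (\<kappa>1 * X + \<kappa>2 * Y)^2 \<le> C * (a * X^2 + b * X * Y + c * Y^2)" for \<kappa>1 \<kappa>2
    proof (intro exI[of _ "8 * (\<kappa>1^2 * c + \<kappa>2^2 * a) / D"] conjI allI)
      show "0 \<le> 8 * (\<kappa>1^2 * c + \<kappa>2^2 * a) / D" using a c D by simp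
      fix X Y :: real
      let ?q = "a * X^2 + b * X * Y + c * Y^2"
      have "4 * c * ?q = D * X^2 + (b * X + 2 * c * Y)^2" "4 * a * ?q = D * Y^2 + (2 * a * X + b * Y)^2"
        by (simp_all add: D_def algebra_simps power2_eq_square)
      then have X: "D * X^2 \<le> 4 * c * ?q" and Y: "D * Y^2 \<le> 4 * a * ?q" by simp_all
      have "D * (\<kappa>1 * X + \<kappa>2 * Y)^2 \<le> D * (2 * (\<kappa>1 * X)^2 + 2 * (\<kappa>2 * Y)^2)"
        using sum_squares_bound[of "\<kappa>1 * X" "\<kappa>2 * Y"] D by (intro mult_left_mono) (simp_all add: power2_sum)
      also have "\<dots> = 2 * \<kappa>1^2 * (D * X^2) + 2 * \<kappa>2^2 * (D * Y^2)"
        by (simp add: algebra_simps power2_eq_square)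
      also have "\<dots> \<le> 2 * \<kappa>1^2 * (4 * c * ?q) + 2 * \<kappa>2^2 * (4 * a * ?q)"
        using X Y by (intro add_mono mult_left_mono) auto
      also have "\<dots> = 8 * (\<kappa>1^2 * c + \<kappa>2^2 * a) * ?q" by (simp add: algebra_simps)
      finally show "(\<kappa>1 * X + \<kappa>2 * Y)^2 \<le> 8 * (\<kappa>1^2 * c + \<kappa>2^2 * a) / D * ?q"
        using Dp by (simp add: pos_le_divide_eq mult.commute)
    qed
    then show ?thesis by (rule definite)
  qed
qed

text \<open>
  The form vanishes at \<open>(X0, Y0)\<close> together with its gradient, because the square is of second order there.
\<close>

lemma binary_quadric_below_square:
  fixes a b c C :: real
  assumes le: "\<And>X Y. \<bar>a * X^2 + b * X * Y + c * Y^2\<bar> \<le> C * (Y0 * X - X0 * Y)^2"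
    and nz: "X0 \<noteq> 0 \<or> Y0 \<noteq> 0"
  shows "\<exists>\<kappa>. \<forall>X Y. a * X^2 + b * X * Y + c * Y^2 = \<kappa> * (Y0 * X - X0 * Y)^2"
proof -
  have sm: "C * (z * x^2)^2 \<le> (\<bar>C\<bar> * z^2) * x^3" if "0 < x" "x \<le> 1" for x z :: real
  proof -
    have "C * (z * x^2)^2 = (C * z^2) * x^4" by (simp add: power_mult_distrib power4_eq_xxxx power2_eq_square)
    also have "\<dots> \<le> (\<bar>C\<bar> * z^2) * x^4" using that by (intro mult_right_mono) auto
    also have "\<dots> \<le> (\<bar>C\<bar> * z^2) * x^3" using that by (intro mult_left_mono power_decreasing) auto
    finally show ?thesis .
  qed
  have "a * X0^2 + b * X0 * Y0 + c * Y0^2 = 0 \<and> 2 * a * X0 + b * Y0 = 0"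
  proof (rule small_order_3)
    fix x :: real assume x: "0 < x" "x \<le> 1"
    have "\<bar>(a * X0^2 + b * X0 * Y0 + c * Y0^2) + (2 * a * X0 + b * Y0) * x^2 + a * x^4\<bar>
        = \<bar>a * (X0 + x^2)^2 + b * (X0 + x^2) * Y0 + c * Y0^2\<bar>"
      by (rule arg_cong[where f=abs]) (simp add: algebra_simps power2_eq_square power4_eq_xxxx)
    also have "\<dots> \<le> C * (Y0 * (X0 + x^2) - X0 * Y0)^2" by (rule le)
    also have "\<dots> = C * (Y0 * x^2)^2" by (simp add: algebra_simps)
    finally show "\<bar>(a * X0^2 + b * X0 * Y0 + c * Y0^2) + (2 * a * X0 + b * Y0) * x^2 + a * x^4\<bar>
       \<le> (\<bar>C\<bar> * Y0^2) * x^3" using sm[OF x, of Y0] by linarith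
  qed
  moreover have "a * X0^2 + b * X0 * Y0 + c * Y0^2 = 0 \<and> b * X0 + 2 * c * Y0 = 0"
  proof (rule small_order_3)
    fix x :: real assume x: "0 < x" "x \<le> 1"
    have "\<bar>(a * X0^2 + b * X0 * Y0 + c * Y0^2) + (b * X0 + 2 * c * Y0) * x^2 + c * x^4\<bar>
        = \<bar>a * X0^2 + b * X0 * (Y0 + x^2) + c * (Y0 + x^2)^2\<bar>"
      by (rule arg_cong[where f=abs]) (simp add: algebra_simps power2_eq_square power4_eq_xxxx)
    also have "\<dots> \<le> C * (Y0 * X0 - X0 * (Y0 + x^2))^2" by (rule le)
    also have "\<dots> = C * (X0 * x^2)^2" by (simp add: algebra_simps)
    finally show "\<bar>(a * X0^2 + b * X0 * Y0 + c * Y0^2) + (b * X0 + 2 * c * Y0) * x^2 + c * x^4\<bar>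
       \<le> (\<bar>C\<bar> * X0^2) * x^3" using sm[OF x, of X0] by linarith
  qed
  ultimately show ?thesis using nz by (intro binary_quadric_factor) auto
qed

section \<open>Cubics with a double point off the vertices\<close>

text \<open>
  The double point is \<open>(e, 1, 1)\<close>: the interior point \<open>(1, 1, 1)\<close> for \<open>e = 1\<close>, the midpoint \<open>(0, 1, 1)\<close> of an
  edge for \<open>e = 0\<close>.  The differences \<open>X = u - e w\<close> and \<open>Y = v - w\<close> are coordinates modulo this point, so
  forms that are invariant under translation by it are determined by their values on \<open>w = 0\<close>.
\<close>

locale node =
  fixes f Q :: real_fun3 and e :: real
  assumes ext: "extremal_cubic f" and dp: "double_point f e 1 1 Q" and e: "e = 0 \<or> e = 1"
    and ndiv: "\<not> divisible_by_variable f"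
begin

lemma nonneg: "u \<ge> 0 \<Longrightarrow> v \<ge> 0 \<Longrightarrow> w \<ge> 0 \<Longrightarrow> 0 \<le> f u v w"
  by (rule extremal_cubicD(2)[OF ext])

lemma shift: "f (u + s * e) (v + s) (w + s) = f u v w + s * Q u v w"
  using dp unfolding double_point_def by (metis mult.right_neutral)

lemma Q_shift: "Q (u + s * e) (v + s) (w + s) = Q u v w"
proof -
  have "f ((u + s * e) + 1 * e) ((v + s) + 1) ((w + s) + 1) = f u v w + (s + 1) * Q u v w"
    using shift[of u "s + 1" v w] by (simp add: distrib_right add.assoc)
  moreover have "f ((u + s * e) + 1 * e) ((v + s) + 1) ((w + s) + 1) = f (u + s * e) (v + s) (w + s) + 1 * Q (u + s * e) (v + s) (w + s)"
    by (rule shift)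
  ultimately show ?thesis unfolding shift[of u s v w] by (simp add: distrib_right)
qed

lemma normal_form: "f u v w = f (u - w * e) (v - w) 0 + w * Q u v w"
  using shift[of "u - w * e" w "v - w" 0] Q_shift[of "u - w * e" w "v - w" 0] by simp

lemma Q_normal_form: "Q u v w = Q (u - w * e) (v - w) 0"
  using Q_shift[of "u - w * e" w "v - w" 0] by simp

lemma Q_binary: obtains a b c where "\<And>X Y. Q X Y 0 = a * X^2 + b * X * Y + c * Y^2"
proof -
  have "quadric Q" using dp by (simp add: double_point_def)
  then obtain a b c d g h where "\<And>u v w. Q u v w = a * u^2 + b * v^2 + c * w^2 + d * u * v + g * u * w + h * v * w"
    unfolding quadric_def by blast
  then show ?thesis by (intro that[of a d b]) simp
qed

lemma eventually_in_orthant: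
  assumes "X \<ge> 0 \<or> e = 1" "s \<ge> \<bar>X\<bar> + \<bar>Y\<bar>"
  shows "0 \<le> X + s * e" "0 \<le> Y + s" "0 \<le> s"
  using assms e by auto

text \<open>
  Along the ray from \<open>(X, Y, 0)\<close> in the direction of the double point \<open>f\<close> is affine with slope \<open>Q\<close>, and the ray
  finally enters the orthant; for \<open>e = 0\<close> this needs \<open>X \<ge> 0\<close>, which is no restriction since \<open>Q\<close> is even.
\<close>

lemma Q_psd: "0 \<le> Q X Y 0"
proof -
  have *: "0 \<le> Q X Y 0" if "X \<ge> 0 \<or> e = 1" for X Y
  proof (rule nonneg_linear)
    fix s :: real assume s: "0 \<le> s"
    let ?s = "s + (\<bar>X\<bar> + \<bar>Y\<bar>)"
    have "0 \<le> f (X + ?s * e) (Y + ?s) (0 + ?s)"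
      using eventually_in_orthant[OF that, of Y ?s] s by (intro nonneg) auto
    then show "0 \<le> f X Y 0 + (\<bar>X\<bar> + \<bar>Y\<bar>) * Q X Y 0 + s * Q X Y 0"
      unfolding shift by (simp add: algebra_simps)
  qed
  obtain a b c where "\<And>X Y. Q X Y 0 = a * X^2 + b * X * Y + c * Y^2" using Q_binary by blast
  then have "Q X Y 0 = Q (- X) (- Y) 0" by simp
  then show ?thesis using *[of X Y] *[of "- X" "- Y"] e by (cases "X \<ge> 0") auto
qed

lemma Q_cases:
  obtains (definite) "\<And>\<kappa>1 \<kappa>2. \<exists>C\<ge>0. \<forall>X Y. (\<kappa>1 * X + \<kappa>2 * Y)^2 \<le> C * Q X Y 0"
  | (square) X0 Y0 \<kappa> where "X0 \<noteq> 0 \<or> Y0 \<noteq> 0" "\<kappa> \<ge> 0" "\<And>X Y. Q X Y 0 = \<kappa> * (Y0 * X - X0 * Y)^2"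
proof -
  obtain a b c where q: "\<And>X Y. Q X Y 0 = a * X^2 + b * X * Y + c * Y^2" using Q_binary by blast
  show ?thesis
    by (rule psd_binary_quadric_cases[of a b c]) (use Q_psd that in \<open>auto simp: q\<close>)
qed

text \<open>
  If both \<open>f\<close> and \<open>Q\<close> vanish at \<open>(X0, Y0, 0)\<close>, then \<open>f\<close> vanishes on the whole line joining this point to
  the double point.  The line meets the interior of the orthant, where \<open>f \<ge> 0\<close>, so the gradient of \<open>f\<close> vanishes along
  it.  Hence \<open>f = l m^2\<close> with the equation \<open>m\<close> of the plane spanned by the line, and \<open>f\<close> would be divisible by a
  coordinate.
\<close>

lemma no_line_of_zeros:
  assumes f0: "f X0 Y0 0 = 0" and Q0: "Q X0 Y0 0 = 0" and nz: "X0 \<noteq> 0 \<or> Y0 \<noteq> 0"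
    and pos: "X0 > 0 \<or> e = 1"
  shows False
proof -
  obtain q0 q1 q2 where Q: "\<And>X Y. Q X Y 0 = q0 * X^2 + q1 * X * Y + q2 * Y^2" using Q_binary by blast
  obtain k0 k1 k2 k3 where K: "\<And>X Y. f X Y 0 = k0 * X^3 + k1 * X^2 * Y + k2 * X * Y^2 + k3 * Y^3"
    using binary_cubic_edges(3)[OF extremal_cubicD(1)[OF ext]] unfolding binary_cubic_def by blast
  define s0 where "s0 = \<bar>X0\<bar> + \<bar>Y0\<bar> + 1"
  define d where "d = (if e = 1 then 1 else X0)"
  have d: "d > 0" using pos by (auto simp: d_def)
  have in_orthant: "0 \<le> X0 + x + s * e" "0 \<le> Y0 + y + s" "0 \<le> s"
    if "s \<ge> s0" "\<bar>x\<bar> < d" "\<bar>y\<bar> < 1" for s x y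
    using that e unfolding s0_def d_def by auto
  \<comment> \<open>For all large \<open>s\<close> the point lies in the interior of the orthant, and the derivatives
    of \<open>f\<close> are affine in \<open>s\<close>; so both coefficients vanish.\<close>
  have gX: "(3 * k0 * X0^2 + 2 * k1 * X0 * Y0 + k2 * Y0^2) + s * (2 * q0 * X0 + q1 * Y0) = 0" if "s \<ge> s0" for s
  proof (rule critical_point[OF _ d])
    fix t :: real assume t: "\<bar>t\<bar> < d"
    have "0 \<le> f (X0 + t + s * e) (Y0 + s) (0 + s)"
      using in_orthant[OF that t, of 0] by (intro nonneg) auto
    also have "\<dots> = f (X0 + t) Y0 0 + s * Q (X0 + t) Y0 0" by (rule shift)
    also have "\<dots> = (f X0 Y0 0 + s * Q X0 Y0 0) + ((3 * k0 * X0^2 + 2 * k1 * X0 * Y0 + k2 * Y0^2) + s * (2 * q0 * X0 + q1 * Y0)) * t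
       + (3 * k0 * X0 + k1 * Y0 + s * q0) * t^2 + k0 * t^3"
      unfolding K Q by (simp add: algebra_simps power2_eq_square power3_eq_cube)
    finally show "0 \<le> ((3 * k0 * X0^2 + 2 * k1 * X0 * Y0 + k2 * Y0^2) + s * (2 * q0 * X0 + q1 * Y0)) * t
       + (3 * k0 * X0 + k1 * Y0 + s * q0) * t^2 + k0 * t^3" by (simp only: f0 Q0)
  qed
  have gY: "(k1 * X0^2 + 2 * k2 * X0 * Y0 + 3 * k3 * Y0^2) + s * (q1 * X0 + 2 * q2 * Y0) = 0" if "s \<ge> s0" for s
  proof (rule critical_point)
    fix t :: real assume t: "\<bar>t\<bar> < 1"
    have "0 \<le> f (X0 + s * e) (Y0 + t + s) (0 + s)"
      using in_orthant[OF that _ t, of 0] d by (intro nonneg) auto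
    also have "\<dots> = f X0 (Y0 + t) 0 + s * Q X0 (Y0 + t) 0" by (rule shift)
    also have "\<dots> = (f X0 Y0 0 + s * Q X0 Y0 0) + ((k1 * X0^2 + 2 * k2 * X0 * Y0 + 3 * k3 * Y0^2) + s * (q1 * X0 + 2 * q2 * Y0)) * t
       + (k2 * X0 + 3 * k3 * Y0 + s * q2) * t^2 + k3 * t^3"
      unfolding K Q by (simp add: algebra_simps power2_eq_square power3_eq_cube)
    finally show "0 \<le> ((k1 * X0^2 + 2 * k2 * X0 * Y0 + 3 * k3 * Y0^2) + s * (q1 * X0 + 2 * q2 * Y0)) * t
       + (k2 * X0 + 3 * k3 * Y0 + s * q2) * t^2 + k3 * t^3" by (simp only: f0 Q0)
  qed simp
  have QX: "2 * q0 * X0 + q1 * Y0 = 0" using gX[of s0] gX[of "s0 + 1"] by (simp add: algebra_simps)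
  have QY: "q1 * X0 + 2 * q2 * Y0 = 0" using gY[of s0] gY[of "s0 + 1"] by (simp add: algebra_simps)
  have KX: "3 * k0 * X0^2 + 2 * k1 * X0 * Y0 + k2 * Y0^2 = 0" using gX[of s0] unfolding QX by simp
  have KY: "k1 * X0^2 + 2 * k2 * X0 * Y0 + 3 * k3 * Y0^2 = 0" using gY[of s0] unfolding QY by simp
  obtain \<kappa> where \<kappa>: "\<And>X Y. Q X Y 0 = \<kappa> * (Y0 * X - X0 * Y)^2"
    using binary_quadric_factor[OF QX QY nz] unfolding Q by blast
  obtain \<gamma> \<delta> where \<gamma>: "\<And>X Y. f X Y 0 = (Y0 * X - X0 * Y)^2 * (\<gamma> * X + \<delta> * Y)"
    using binary_cubic_factor[OF KX KY nz] unfolding K by blast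
  have "f u v w = (\<gamma> * u + \<delta> * v + (\<kappa> - \<gamma> * e - \<delta>) * w) * (Y0 * u + (- X0) * v + (X0 - Y0 * e) * w)^2" for u v w
  proof -
    have "Y0 * (u - w * e) - X0 * (v - w) = Y0 * u + (- X0) * v + (X0 - Y0 * e) * w" by (simp add: algebra_simps)
    then show ?thesis
      unfolding normal_form[of u v w] Q_normal_form[of u v w] \<gamma> \<kappa> by (simp add: algebra_simps)
  qed
  from linear_times_square_divisible[OF ext this] ndiv show False by simp
qed

text \<open>
  For \<open>m = \<kappa>1 X + \<kappa>2 Y\<close> the two sides of \<open>v m^2 \<le> C f\<close> are affine along the lines through the double point.  Each
  point of the orthant is a boundary point plus a non-negative multiple of the double point, so the inequality follows
  from its restriction to the boundary and the comparison \<open>m^2 \<le> C Q\<close> of the slopes.  On the edge \<open>v = 0\<close> the left-hand side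
  vanishes, and for \<open>e = 0\<close> the decomposition can be made without the edge \<open>u = 0\<close>.
\<close>

lemma edges_dominate_v_square:
  assumes nz: "\<kappa>1 \<noteq> 0 \<or> \<kappa>2 \<noteq> 0" and C: "C1 \<ge> 0" "C2 \<ge> 0" "C3 \<ge> 0"
    and Q: "\<And>X Y. (\<kappa>1 * X + \<kappa>2 * Y)^2 \<le> C1 * Q X Y 0"
    and w_edge: "\<And>u v. u \<ge> 0 \<Longrightarrow> v \<ge> 0 \<Longrightarrow> v * (\<kappa>1 * u + \<kappa>2 * v)^2 \<le> C2 * f u v 0"
    and u_edge: "\<And>v w. e = 1 \<Longrightarrow> v \<ge> 0 \<Longrightarrow> w \<ge> 0 \<Longrightarrow> v * (\<kappa>2 * v - (\<kappa>1 + \<kappa>2) * w)^2 \<le> C3 * f 0 v w"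
  shows False
proof -
  define C where "C = C1 + C2 + C3"
  have CC: "C1 \<le> C" "C2 \<le> C" "C3 \<le> C" "C \<ge> 0" using C by (auto simp: C_def)
  let ?m = "\<lambda>u v w. \<kappa>1 * u + \<kappa>2 * v + (- \<kappa>1 * e - \<kappa>2) * w"
  have boundary: "v * (?m u v w)^2 \<le> C * f u v w"
    if nn: "u \<ge> 0" "v \<ge> 0" "w \<ge> 0" and bd: "v = 0 \<or> w = 0 \<or> (e = 1 \<and> u = 0)" for u v w
  proof -
    have f: "0 \<le> f u v w" using nn by (rule nonneg)
    consider "v = 0" | "w = 0" | "e = 1" "u = 0" using bd by blast
    then show ?thesis
    proof cases
      case 1 then show ?thesis using f CC by simp
    next
      case 2
      then have "v * (?m u v w)^2 \<le> C2 * f u v w" using w_edge[OF nn(1,2)] by simp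
      also have "\<dots> \<le> C * f u v w" using f CC by (intro mult_right_mono) auto
      finally show ?thesis .
    next
      case 3
      have "?m u v w = \<kappa>2 * v - (\<kappa>1 + \<kappa>2) * w" using 3 by (simp add: algebra_simps)
      then have "v * (?m u v w)^2 \<le> C3 * f u v w" using u_edge[OF 3(1) nn(2,3)] 3 by simp
      also have "\<dots> \<le> C * f u v w" using f CC by (intro mult_right_mono) auto
      finally show ?thesis .
    qed
  qed
  have "divisible_by_variable f"
  proof (rule divisible_if_dominates_v[OF ext, of \<kappa>1 \<kappa>2 "- \<kappa>1 * e - \<kappa>2" C])
    show "\<kappa>1 \<noteq> 0 \<or> \<kappa>2 \<noteq> 0 \<or> - \<kappa>1 * e - \<kappa>2 \<noteq> 0" using nz by blast
    fix u v w :: real assume nn: "u \<ge> 0" "v \<ge> 0" "w \<ge> 0"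
    \<comment> \<open>The largest multiple of the double point that can be subtracted inside the orthant.\<close>
    define s where "s = (if e = 1 then min u (min v w) else min v w)"
    have s: "0 \<le> s" "0 \<le> u - s * e" "0 \<le> v - s" "0 \<le> w - s"
      "v - s = 0 \<or> w - s = 0 \<or> (e = 1 \<and> u - s * e = 0)"
      using nn e by (auto simp: s_def min_def)
    have m: "?m (u - s * e) (v - s) (w - s) = ?m u v w" by (simp add: algebra_simps)
    have "v * (?m u v w)^2 = (v - s) * (?m u v w)^2 + s * (?m u v w)^2" by (simp add: algebra_simps)
    also have "(v - s) * (?m u v w)^2 \<le> C * f (u - s * e) (v - s) (w - s)"
      using boundary[OF s(2-5)] unfolding m .
    also have "s * (?m u v w)^2 \<le> s * (C * Q u v w)"
    proof (rule mult_left_mono)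
      have "?m u v w = \<kappa>1 * (u - w * e) + \<kappa>2 * (v - w)" by (simp add: algebra_simps)
      then have "(?m u v w)^2 \<le> C1 * Q u v w" using Q unfolding Q_normal_form[of u v w] by simp
      also have "\<dots> \<le> C * Q u v w"
        using CC Q_psd unfolding Q_normal_form[of u v w] by (intro mult_right_mono) auto
      finally show "(?m u v w)^2 \<le> C * Q u v w" .
    qed (rule s)
    also have "C * f (u - s * e) (v - s) (w - s) + s * (C * Q u v w) = C * f u v w"
      using shift[of "u - s * e" s "v - s" "w - s"] Q_shift[of "u - s * e" s "v - s" "w - s"]
      by (simp add: algebra_simps)
    finally show "v * (?m u v w)^2 \<le> C * f u v w" by simp
  qed
  with ndiv show False by simp
qed

lemma node_swap23: "node (\<lambda>u v w. f u w v) (\<lambda>u v w. Q u w v) e"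
proof
  show "extremal_cubic (\<lambda>u v w. f u w v)" by (rule extremal_cubic_swap23[OF ext])
  show "double_point (\<lambda>u v w. f u w v) e 1 1 (\<lambda>u v w. Q u w v)"
    using dp quadric_swap23[of Q] by (simp add: double_point_def)
  show "\<not> divisible_by_variable (\<lambda>u v w. f u w v)" using ndiv divisible_swap23[of f] by blast
qed (rule e)

lemma node_swap12:
  assumes "e = 1" shows "node (\<lambda>u v w. f v u w) (\<lambda>u v w. Q v u w) e"
proof
  show "extremal_cubic (\<lambda>u v w. f v u w)" by (rule extremal_cubic_swap12[OF ext])
  show "double_point (\<lambda>u v w. f v u w) e 1 1 (\<lambda>u v w. Q v u w)"
    using dp quadric_swap12[of Q] assms by (simp add: double_point_def)
  show "\<not> divisible_by_variable (\<lambda>u v w. f v u w)" using ndiv divisible_swap12[of f] by blast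
qed (rule e)

end

section \<open>Quadratic forms dominated by a cubic\<close>

text \<open>
  This is the bound \<open>sqrt (u v) |A| \<le> f\<close> on the orthant, written with \<open>u = x^2\<close> and \<open>v = y^2\<close>.
\<close>

definition dominates :: "real_fun3 \<Rightarrow> real_fun3 \<Rightarrow> bool" where
  "dominates f A \<longleftrightarrow> quadric A \<and>
     (\<forall>x\<ge>0. \<forall>y\<ge>0. \<forall>w\<ge>0. x * y * \<bar>A (x^2) (y^2) w\<bar> \<le> f (x^2) (y^2) w)"

lemma dominates_swap12:
  assumes "dominates f A" shows "dominates (\<lambda>u v w. f v u w) (\<lambda>u v w. A v u w)"
  using assms quadric_swap12[of A] unfolding dominates_def
  by (metis (no_types, lifting) mult.commute)

lemma dominatesD:
  assumes "dominates f A" "x \<ge> 0" "y \<ge> 0" "w \<ge> 0"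
  shows "x * y * \<bar>A (x^2) (y^2) w\<bar> \<le> f (x^2) (y^2) w"
  using assms by (simp add: dominates_def)

lemma dominates_quadric: "dominates f A \<Longrightarrow> quadric A"
  by (simp add: dominates_def)

lemma dominates_sqrt:
  assumes "dominates f A" "u \<ge> 0" "v \<ge> 0" "w \<ge> 0"
  shows "sqrt u * sqrt v * \<bar>A u v w\<bar> \<le> f u v w"
  using dominatesD[OF assms(1), of "sqrt u" "sqrt v" w] assms by simp

text \<open>
  Near a zero of \<open>f\<close> on the edge \<open>u = 0\<close> one has \<open>f = O(u)\<close> in the direction of \<open>u\<close>, whereas \<open>sqrt u |A| \<le> f\<close>
  up to a positive factor.
\<close>

lemma dominated_zero_on_u_edge:
  assumes "cubic f" and dom: "dominates f A" and f0: "f 0 v w = 0" and vw: "v > 0" "w \<ge> 0"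
  shows "A 0 v w = 0"
proof -
  obtain a b c d e g h i j k where f: "\<And>u v w. f u v w =
     a * u^3 + b * v^3 + c * w^3 + d * u^2 * v + e * u^2 * w + g * u * v^2
     + h * v^2 * w + i * u * w^2 + j * v * w^2 + k * u * v * w"
    using assms(1) unfolding cubic_def by blast
  obtain a' b' c' d' e' g' where A: "\<And>u v w. A u v w =
     a' * u^2 + b' * v^2 + c' * w^2 + d' * u * v + e' * u * w + g' * v * w"
    using dominates_quadric[OF dom] unfolding quadric_def by blast
  have "sqrt v * A (0^2) v w = 0"
  proof (rule small_order_continuous)
    show "continuous_on UNIV (\<lambda>x. sqrt v * A (x^2) v w)"
      unfolding A by (intro continuous_intros)
    show "continuous_on UNIV (\<lambda>x. a * x^4 + (d * v + e * w) * x^2 + g * v^2 + i * w^2 + k * v * w)"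
      by (intro continuous_intros)
    fix x :: real assume x: "0 < x" "x \<le> 1"
    have "x * sqrt v * \<bar>A (x^2) v w\<bar> \<le> f (x^2) v w"
      using dominatesD[OF dom, of x "sqrt v" w] x vw by simp
    also have "\<dots> = f 0 v w + x * (x * (a * x^4 + (d * v + e * w) * x^2 + g * v^2 + i * w^2 + k * v * w))"
      unfolding f by (simp add: algebra_simps eval_nat_numeral)
    finally have "x * (sqrt v * \<bar>A (x^2) v w\<bar>) \<le> x * (x * (a * x^4 + (d * v + e * w) * x^2 + g * v^2 + i * w^2 + k * v * w))"
      by (simp add: f0 mult.assoc)
    then show "\<bar>sqrt v * A (x^2) v w\<bar> \<le> x * (a * x^4 + (d * v + e * w) * x^2 + g * v^2 + i * w^2 + k * v * w)"
      using x vw by (simp add: abs_mult)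
  qed
  then show ?thesis using vw by simp
qed

text \<open>
  Away from the vertex \<open>(0, 0, 1)\<close> this is \<open>dominated_zero_on_u_edge\<close>.  At the vertex a double zero gives
  \<open>f = O(u + v^2)\<close>, while \<open>sqrt (u v)\<close> is of order \<open>y^3\<close> on the curve \<open>u = y^4\<close>, \<open>v = y^2\<close>.
\<close>

lemma dominated_zero_at_double_zero:
  assumes "cubic f" and dom: "dominates f A" and dz: "double_zero (f 0) \<alpha> \<beta>"
  shows "A 0 \<alpha> \<beta> = 0"
proof -
  obtain \<gamma> \<delta> where \<gamma>: "\<And>y z. f 0 y z = (\<beta> * y - \<alpha> * z)^2 * (\<gamma> * y + \<delta> * z)"
    and ab: "0 \<le> \<alpha>" "0 \<le> \<beta>" "0 < \<alpha> + \<beta>"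
    using dz unfolding double_zero_def by blast
  show ?thesis
  proof (cases "\<alpha> = 0")
    case False
    then show ?thesis
      using ab by (intro dominated_zero_on_u_edge[OF assms(1) dom]) (auto simp: \<gamma>)
  next
    case True
    obtain a b c d e g h i j k where f: "\<And>u v w. f u v w =
       a * u^3 + b * v^3 + c * w^3 + d * u^2 * v + e * u^2 * w + g * u * v^2
       + h * v^2 * w + i * u * w^2 + j * v * w^2 + k * u * v * w"
      using assms(1) unfolding cubic_def by blast
    obtain a' b' c' d' e' g' where A: "\<And>u v w. A u v w =
       a' * u^2 + b' * v^2 + c' * w^2 + d' * u * v + e' * u * w + g' * v * w"
      using dominates_quadric[OF dom] unfolding quadric_def by blast
    have c: "c = 0" using \<gamma>[of 0 1] True by (simp add: f)
    \<comment> \<open>The coefficient of \<open>v w^2\<close>: the zero at the vertex is double.\<close>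
    have j: "j = 0"
      using \<gamma>[of 1 1] \<gamma>[of "-1" 1] \<gamma>[of 2 1] True c by (simp add: f algebra_simps power2_eq_square)
    define P where "P = (\<lambda>y. i * \<beta>^2 + h * \<beta> + (b + k * \<beta>) * y^2 + (e * \<beta> + g) * y^4 + d * y^6 + a * y^8)"
    have "A (0^4) (0^2) \<beta> = 0"
    proof (rule small_order_continuous)
      show "continuous_on UNIV (\<lambda>y. A (y^4) (y^2) \<beta>)"
        unfolding A by (intro continuous_intros)
      show "continuous_on UNIV P" unfolding P_def by (intro continuous_intros)
      fix y :: real assume y: "0 < y" "y \<le> 1"
      have "y^2 * y * \<bar>A ((y^2)^2) (y^2) \<beta>\<bar> \<le> f ((y^2)^2) (y^2) \<beta>"
        using dominatesD[OF dom, of "y^2" y \<beta>] y ab by simp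
      also have "\<dots> = (y^2 * y) * (y * P y)"
        unfolding f c j P_def by (simp add: algebra_simps eval_nat_numeral)
      finally have "(y^2 * y) * \<bar>A ((y^2)^2) (y^2) \<beta>\<bar> \<le> (y^2 * y) * (y * P y)" .
      then have "\<bar>A ((y^2)^2) (y^2) \<beta>\<bar> \<le> y * P y" using y by (simp add: mult_le_cancel_left_pos)
      then show "\<bar>A (y^4) (y^2) \<beta>\<bar> \<le> y * P y" by simp
    qed
    then show ?thesis using True by simp
  qed
qed

text \<open>
  On the edge \<open>w = 0\<close> the factor \<open>sqrt (u v)\<close> is positive in the interior, so \<open>A\<close> inherits the order of vanishing of
  \<open>f\<close>.  Approaching \<open>(\<alpha>, \<beta>)\<close> along \<open>(\<alpha> + x^2, \<beta>)\<close> with \<open>sqrt (\<alpha> + x^2) \<ge> x\<close> includes the case \<open>\<alpha> = 0\<close>.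
\<close>

lemma dominated_square_at_double_zero_aux:
  assumes dom: "dominates f A" and dz: "double_zero (\<lambda>u v. f u v 0) \<alpha> \<beta>" and \<beta>: "\<beta> > 0"
  shows "\<exists>\<kappa>. \<forall>u v. A u v 0 = \<kappa> * (\<beta> * u - \<alpha> * v)^2"
proof -
  obtain \<gamma> \<delta> where fw: "\<And>y z. f y z 0 = (\<beta> * y - \<alpha> * z)^2 * (\<gamma> * y + \<delta> * z)"
    and ab: "0 \<le> \<alpha>" "0 \<le> \<gamma>" "0 \<le> \<delta>"
    using dz unfolding double_zero_def by blast
  obtain a b c d e g where A: "\<And>u v w. A u v w =
     a * u^2 + b * v^2 + c * w^2 + d * u * v + e * u * w + g * v * w"
    using dominates_quadric[OF dom] unfolding quadric_def by blast
  define K where "K = \<beta>^2 * (\<gamma> * (\<alpha> + 1) + \<delta> * \<beta>)"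
  have K: "K \<ge> 0" using ab \<beta> by (simp add: K_def)
  have "sqrt \<beta> * (a * \<alpha>^2 + d * \<alpha> * \<beta> + b * \<beta>^2) = 0 \<and> sqrt \<beta> * (2 * a * \<alpha> + d * \<beta>) = 0"
  proof (rule small_order_3)
    fix x :: real assume x: "0 < x" "x \<le> 1"
    have x1: "x^2 \<le> 1" using x by (simp add: power_le_one)
    have expand: "sqrt \<beta> * (a * \<alpha>^2 + d * \<alpha> * \<beta> + b * \<beta>^2) + sqrt \<beta> * (2 * a * \<alpha> + d * \<beta>) * x^2 + (sqrt \<beta> * a) * x^4
      = sqrt \<beta> * A (\<alpha> + x^2) \<beta> 0"
      unfolding A by (simp add: algebra_simps eval_nat_numeral)
    have "x * (sqrt \<beta> * \<bar>A (\<alpha> + x^2) \<beta> 0\<bar>) \<le> sqrt (\<alpha> + x^2) * (sqrt \<beta> * \<bar>A (\<alpha> + x^2) \<beta> 0\<bar>)"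
      using x ab \<beta> by (intro mult_right_mono real_le_rsqrt) auto
    also have "\<dots> \<le> f (\<alpha> + x^2) \<beta> 0"
      using dominates_sqrt[OF dom, of "\<alpha> + x^2" \<beta> 0] ab \<beta> by (simp add: mult.assoc)
    also have "\<dots> = x^4 * (\<beta>^2 * (\<gamma> * (\<alpha> + x^2) + \<delta> * \<beta>))"
      unfolding fw by (simp add: algebra_simps eval_nat_numeral)
    also have "\<dots> \<le> x^4 * K"
      unfolding K_def using x1 ab by (intro mult_left_mono add_right_mono) auto
    also have "\<dots> = x * (K * x^3)" by (simp add: eval_nat_numeral)
    finally have "sqrt \<beta> * \<bar>A (\<alpha> + x^2) \<beta> 0\<bar> \<le> K * x^3" using x by simp
    then show "\<bar>sqrt \<beta> * (a * \<alpha>^2 + d * \<alpha> * \<beta> + b * \<beta>^2) + sqrt \<beta> * (2 * a * \<alpha> + d * \<beta>) * x^2 + (sqrt \<beta> * a) * x^4\<bar> \<le> K * x^3"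
      unfolding expand using \<beta> by (simp add: abs_mult)
  qed
  then have z: "a * \<alpha>^2 + d * \<alpha> * \<beta> + b * \<beta>^2 = 0" and dX: "2 * a * \<alpha> + d * \<beta> = 0" using \<beta> by auto
  have "\<beta> * (d * \<alpha> + 2 * b * \<beta>) = 2 * (a * \<alpha>^2 + d * \<alpha> * \<beta> + b * \<beta>^2) - \<alpha> * (2 * a * \<alpha> + d * \<beta>)"
    by (simp add: algebra_simps power2_eq_square)
  then have dY: "d * \<alpha> + 2 * b * \<beta> = 0" using z dX \<beta> by simp
  from binary_quadric_factor[OF dX dY] \<beta> obtain \<kappa>
    where \<kappa>: "\<And>y z. a * y^2 + d * y * z + b * z^2 = \<kappa> * (\<beta> * y - \<alpha> * z)^2" by auto
  have "A u v 0 = \<kappa> * (\<beta> * u - \<alpha> * v)^2" for u v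
    unfolding \<kappa>[symmetric] A by simp
  then show ?thesis by blast
qed

lemma double_zero_swap:
  assumes "double_zero \<phi> \<alpha> \<beta>" shows "double_zero (\<lambda>z y. \<phi> y z) \<beta> \<alpha>"
proof -
  obtain \<gamma> \<delta> where gd: "0 \<le> \<gamma>" "0 \<le> \<delta>" and \<phi>: "\<And>y z. \<phi> y z = (\<beta> * y - \<alpha> * z)^2 * (\<gamma> * y + \<delta> * z)"
    using assms unfolding double_zero_def by blast
  have "\<phi> y z = (\<alpha> * z - \<beta> * y)^2 * (\<delta> * z + \<gamma> * y)" for y z
    unfolding \<phi> by (simp add: power2_commute add.commute)
  with gd have "\<exists>\<gamma>\<ge>0. \<exists>\<delta>\<ge>0. \<forall>z y. \<phi> y z = (\<alpha> * z - \<beta> * y)^2 * (\<gamma> * z + \<delta> * y)" by blast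
  then show ?thesis using assms unfolding double_zero_def by (simp add: add.commute)
qed

lemma dominated_square_at_double_zero:
  assumes dom: "dominates f A" and dz: "double_zero (\<lambda>u v. f u v 0) \<alpha> \<beta>"
  shows "\<exists>\<kappa>. \<forall>u v. A u v 0 = \<kappa> * (\<beta> * u - \<alpha> * v)^2"
proof (cases "\<beta> > 0")
  case True
  then show ?thesis by (rule dominated_square_at_double_zero_aux[OF dom dz])
next
  case False
  then have "\<alpha> > 0" using dz by (auto simp: double_zero_def)
  from dominated_square_at_double_zero_aux[OF dominates_swap12[OF dom] double_zero_swap[OF dz] this]
  obtain \<kappa> where "\<And>u v. A v u 0 = \<kappa> * (\<alpha> * u - \<beta> * v)^2" by blast
  then have "A u v 0 = \<kappa> * (\<beta> * u - \<alpha> * v)^2" for u v by (simp add: power2_commute)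
  then show ?thesis by blast
qed

text \<open>
  Along \<open>x + t^2 p\<close> with \<open>p = (e, 1, 1)\<close> the form \<open>A\<close> is a polynomial in \<open>t^2\<close>.  Growth of order at most \<open>t\<close> makes it
  constant; this holds for an open set of \<open>x\<close> and therefore for all \<open>x\<close>.
\<close>

lemma quadric_invariant_if_slow_growth:
  assumes "quadric A"
    and slow: "\<And>u v w. u > 0 \<Longrightarrow> v \<ge> 0 \<Longrightarrow> w \<ge> 0 \<Longrightarrow>
      \<exists>K. \<forall>t\<ge>1. \<bar>A (u + t^2 * e) (v + t^2) (w + t^2)\<bar> \<le> K * t"
  shows "A (u + s * e) (v + s) (w + s) = A u v w"
proof -
  obtain a b c d g h where A: "\<And>u v w. A u v w =
     a * u^2 + b * v^2 + c * w^2 + d * u * v + g * u * w + h * v * w"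
    using assms(1) unfolding quadric_def by blast
  define L where "L = (\<lambda>u v w. (2 * a * e + d + g) * u + (2 * b + d * e + h) * v + (2 * c + g * e + h) * w)"
  have Ash: "A (u + s * e) (v + s) (w + s) = A u v w + s * L u v w + s^2 * A e 1 1" for u v w s
    unfolding A L_def by (simp add: algebra_simps power2_eq_square)
  have "L u v w = 0 \<and> A e 1 1 = 0" if uvw: "u > 0" "v \<ge> 0" "w \<ge> 0" for u v w
  proof -
    obtain K where "\<And>t. t \<ge> 1 \<Longrightarrow> \<bar>A (u + t^2 * e) (v + t^2) (w + t^2)\<bar> \<le> K * t"
      using slow[OF uvw] by blast
    then have "\<And>t. 1 \<le> t \<Longrightarrow> \<bar>A u v w + L u v w * t^2 + A e 1 1 * t^4\<bar> \<le> K * t"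
      unfolding Ash by (simp add: mult_ac)
    then show ?thesis by (rule large_order_1)
  qed
  from this[of 1 0 0] this[of 1 1 0] this[of 1 0 1] have "A e 1 1 = 0" "L u v w = 0"
    by (simp_all add: L_def)
  then show ?thesis by (simp add: Ash)
qed

context node
begin

text \<open>
  Thus \<open>A\<close> is singular at the double point.  Along \<open>x + t^2 p\<close> the cubic is of order \<open>t^2\<close>, whereas \<open>sqrt (u v)\<close> is at
  least of order \<open>t\<close>.
\<close>

lemma dominated_shift:
  assumes dom: "dominates f A"
  shows "A (u + s * e) (v + s) (w + s) = A u v w"
proof (rule quadric_invariant_if_slow_growth[OF dominates_quadric[OF dom]])
  fix u v w :: real assume uvw: "u > 0" "v \<ge> 0" "w \<ge> 0"
  have "\<bar>A (u + t^2 * e) (v + t^2) (w + t^2)\<bar> \<le> ((f u v w + Q u v w) / sqrt u) * t" if t: "1 \<le> t" for t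
  proof -
    have t1: "1 \<le> t^2" using t by (simp add: one_le_power)
    have e0: "e \<ge> 0" using e by auto
    have "sqrt u * t * \<bar>A (u + t^2 * e) (v + t^2) (w + t^2)\<bar>
      \<le> sqrt (u + t^2 * e) * sqrt (v + t^2) * \<bar>A (u + t^2 * e) (v + t^2) (w + t^2)\<bar>"
      using t uvw e0 by (intro mult_right_mono mult_mono real_le_rsqrt) auto
    also have "\<dots> \<le> f (u + t^2 * e) (v + t^2) (w + t^2)"
      using uvw e0 by (intro dominates_sqrt[OF dom]) auto
    also have "\<dots> = f u v w + t^2 * Q u v w" by (rule shift)
    also have "\<dots> \<le> t^2 * f u v w + t^2 * Q u v w"
      using mult_right_mono[OF t1 nonneg[of u v w]] uvw by simp
    also have "\<dots> = t * ((f u v w + Q u v w) * t)" by (simp add: algebra_simps power2_eq_square)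
    finally have "t * (sqrt u * \<bar>A (u + t^2 * e) (v + t^2) (w + t^2)\<bar>) \<le> t * ((f u v w + Q u v w) * t)"
      by (simp add: mult_ac)
    then have "sqrt u * \<bar>A (u + t^2 * e) (v + t^2) (w + t^2)\<bar> \<le> (f u v w + Q u v w) * t"
      using t by (simp add: mult_le_cancel_left_pos)
    then show ?thesis using uvw by (simp add: pos_le_divide_eq mult.commute)
  qed
  then show "\<exists>K. \<forall>t\<ge>1. \<bar>A (u + t^2 * e) (v + t^2) (w + t^2)\<bar> \<le> K * t" by blast
qed

lemma dominated_binary:
  assumes dom: "dominates f A"
  shows "A u v w = A (u - w * e) (v - w) 0"
  using dominated_shift[OF dom, of "u - w * e" w "v - w" 0] by simp

lemma dominated_zero:
  assumes dom: "dominates f A" and z: "\<And>X Y. X > 0 \<or> e = 1 \<Longrightarrow> A X Y 0 = 0"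
  shows "A u v w = 0"
proof -
  obtain a b c d g h where A: "\<And>u v w. A u v w =
     a * u^2 + b * v^2 + c * w^2 + d * u * v + g * u * w + h * v * w"
    using dominates_quadric[OF dom] unfolding quadric_def by blast
  have "A X Y 0 = 0" for X Y
    using z[of 1 0] z[of 1 1] z[of 1 "-1"] by (simp add: A)
  then show ?thesis using dominated_binary[OF dom] by simp
qed

text \<open>
  If \<open>Q\<close> vanishes at \<open>x\<close>, then \<open>f\<close> and \<open>A\<close> are constant along \<open>x + s p\<close>, while \<open>sqrt (u v)\<close> is unbounded.
\<close>

lemma dominated_zero_at_Q_zero:
  assumes dom: "dominates f A" and Q0: "Q X Y 0 = 0" and pos: "X > 0 \<or> e = 1"
  shows "A X Y 0 = 0"
proof (rule ccontr)
  assume ne: "A X Y 0 \<noteq> 0"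
  define s0 where "s0 = \<bar>X\<bar> + \<bar>Y\<bar> + 1"
  define u v where "u = X + s0 * e" and "v = Y + s0"
  have uv: "u > 0" "v \<ge> 0" "s0 \<ge> 0" using pos e by (auto simp: u_def v_def s0_def)
  define B where "B = sqrt u * \<bar>A X Y 0\<bar>"
  have B: "B > 0" using ne uv by (simp add: B_def)
  have bound: "sqrt s * B \<le> f X Y 0" if s: "s \<ge> 0" for s
  proof -
    have e0: "e \<ge> 0" using e by auto
    have "A (X + (s0 + s) * e) (Y + (s0 + s)) (0 + (s0 + s)) = A X Y 0" by (rule dominated_shift[OF dom])
    moreover have "f (X + (s0 + s) * e) (Y + (s0 + s)) (0 + (s0 + s)) = f X Y 0" using shift[of X "s0 + s" Y 0] Q0 by simp
    moreover have "0 \<le> X + (s0 + s) * e"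
      using uv(1) s e0 mult_nonneg_nonneg[OF s e0] unfolding u_def distrib_right by linarith
    ultimately have "sqrt (X + (s0 + s) * e) * sqrt (Y + (s0 + s)) * \<bar>A X Y 0\<bar> \<le> f X Y 0"
      using dominates_sqrt[OF dom, of "X + (s0 + s) * e" "Y + (s0 + s)" "0 + (s0 + s)"] uv s
      by (simp add: v_def)
    moreover have "sqrt u * sqrt s * \<bar>A X Y 0\<bar> \<le> sqrt (X + (s0 + s) * e) * sqrt (Y + (s0 + s)) * \<bar>A X Y 0\<bar>"
    proof (intro mult_right_mono mult_mono)
      show "sqrt u \<le> sqrt (X + (s0 + s) * e)"
        using mult_nonneg_nonneg[OF s e0] by (simp add: u_def distrib_right)
      show "0 \<le> sqrt (X + (s0 + s) * e)" using \<open>0 \<le> X + (s0 + s) * e\<close> by simp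
    qed (use uv s in \<open>auto simp: v_def\<close>)
    ultimately show ?thesis by (simp add: B_def mult_ac)
  qed
  have f0: "f X Y 0 \<ge> 0" using bound[of 0] by simp
  \<comment> \<open>At this \<open>s\<close> the left-hand side of the bound equals \<open>f X Y 0 + B\<close>.\<close>
  have "sqrt ((f X Y 0 / B + 1)^2) * B \<le> f X Y 0" by (rule bound) simp
  then have "(f X Y 0 / B + 1) * B \<le> f X Y 0" using f0 B by simp
  moreover have "(f X Y 0 / B + 1) * B = f X Y 0 + B" using B by (simp add: distrib_right)
  ultimately show False using B by simp
qed

text \<open>
  For an interior double point \<open>sqrt (u v)\<close> grows like \<open>s\<close> along \<open>x + s p\<close>, so the slopes can be compared.
\<close>

lemma dominated_by_Q:
  assumes dom: "dominates f A" and e1: "e = 1"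
  shows "\<bar>A X Y 0\<bar> \<le> Q X Y 0"
proof -
  define s0 where "s0 = \<bar>X\<bar> + \<bar>Y\<bar>"
  have "0 \<le> Q X Y 0 - \<bar>A X Y 0\<bar>"
  proof (rule nonneg_linear)
    fix s :: real assume s: "0 \<le> s"
    have u: "0 \<le> X + s0" "0 \<le> Y + s0" "0 \<le> s0" by (auto simp: s0_def)
    have "s * \<bar>A X Y 0\<bar> \<le> sqrt (X + (s0 + s)) * sqrt (Y + (s0 + s)) * \<bar>A X Y 0\<bar>"
    proof (rule mult_right_mono)
      have "s = sqrt s * sqrt s" using s by simp
      also have "\<dots> \<le> sqrt (X + (s0 + s)) * sqrt (Y + (s0 + s))"
        using u s by (intro mult_mono) auto
      finally show "s \<le> sqrt (X + (s0 + s)) * sqrt (Y + (s0 + s))" .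
    qed simp
    also have "\<dots> \<le> f X Y 0 + (s0 + s) * Q X Y 0"
      using dominates_sqrt[OF dom, of "X + (s0 + s)" "Y + (s0 + s)" "0 + (s0 + s)"] u s
        dominated_shift[OF dom, of X "s0 + s" Y 0] shift[of X "s0 + s" Y 0] e1 by simp
    finally show "0 \<le> (f X Y 0 + s0 * Q X Y 0) + s * (Q X Y 0 - \<bar>A X Y 0\<bar>)"
      by (simp add: algebra_simps)
  qed
  then show ?thesis by simp
qed

end

context node
begin

lemma f_cubic: "cubic f" by (rule extremal_cubicD(1)[OF ext])

lemma Q_quadric: "quadric Q" using dp by (simp add: double_point_def)

section \<open>Double points on an edge\<close>

text \<open>
  The restriction of \<open>f\<close> to the edge \<open>u = 0\<close> through the double point is \<open>(v - w)^2\<close> times a linear form, which is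
  nonzero and hence cannot vanish at both ends.
\<close>

lemma vertex_positive:
  assumes e0: "e = 0" shows "f 0 1 0 > 0 \<or> f 0 0 1 > 0"
proof (rule ccontr)
  assume "\<not> ?thesis"
  then have z: "f 0 1 0 = 0" "f 0 0 1 = 0"
    using nonneg[of 0 1 0] nonneg[of 0 0 1] by auto
  have fY: "f 0 Y 0 = 0" for Y using cubic_homogeneous[OF f_cubic, of Y 0 1 0] z by simp
  have "f 0 0 1 = f 0 (-1) 0 + 1 * Q 0 (-1) 0" using shift[of 0 1 "-1" 0] e0 by simp
  then have "Q 0 (-1) 0 = 0" using z fY by simp
  then have QY: "Q 0 Y 0 = 0" for Y using quadric_homogeneous[OF Q_quadric, of "-Y" 0 "-1" 0] by simp
  have "f 0 v w = 0" for v w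
    unfolding normal_form[of 0 v w] Q_normal_form[of 0 v w] e0 using fY QY by simp
  then show False using ndiv by (simp add: divisible_by_variable_def)
qed

text \<open>
  None of the inequalities \<open>v m^2 \<le> C f\<close> may hold.  If \<open>Q\<close> were definite, \<open>m\<close> could be chosen freely: through a double
  zero of \<open>f\<close> on the edge \<open>w = 0\<close> if there is one, and \<open>m = u\<close> otherwise.  If \<open>Q\<close> is the square of \<open>m\<close>, up to a factor,
  then this \<open>m\<close> is admissible unless the edge has a double zero.  That zero does not lie on \<open>m = 0\<close>, by
  \<open>no_line_of_zeros\<close>.
\<close>

lemma edge_node_structure:
  assumes e0: "e = 0" and f010: "f 0 1 0 > 0"
  obtains X0 Y0 \<kappa> \<alpha> \<beta> where "X0 > 0" "\<And>X Y. Q X Y 0 = \<kappa> * (Y0 * X - X0 * Y)^2"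
    "double_zero (\<lambda>u v. f u v 0) \<alpha> \<beta>" "\<alpha> > 0" "f \<alpha> \<beta> 0 = 0" "Y0 * \<alpha> \<noteq> X0 * \<beta>"
proof -
  let ?\<phi> = "\<lambda>u v. f u v 0"
  have bin: "binary_cubic ?\<phi>" by (rule binary_cubic_edges(3)[OF f_cubic])
  have nn: "\<And>y z. y \<ge> 0 \<Longrightarrow> z \<ge> 0 \<Longrightarrow> 0 \<le> ?\<phi> y z" by (rule nonneg) auto
  have without_dz: "\<exists>C\<ge>0. \<forall>u\<ge>0. \<forall>v\<ge>0. v * (\<kappa>1 * u + \<kappa>2 * v)^2 \<le> C * f u v 0"
    if "\<nexists>\<alpha> \<beta>. double_zero ?\<phi> \<alpha> \<beta>" for \<kappa>1 \<kappa>2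
    using edge_bound_without_double_zero[OF bin nn that, of \<kappa>2 \<kappa>1] f010 by simp
  show ?thesis
  proof (cases rule: Q_cases)
    case definite
    have False
    proof (cases "\<exists>\<alpha> \<beta>. double_zero ?\<phi> \<alpha> \<beta>")
      case True
      then obtain \<alpha> \<beta> \<gamma> \<delta> where gd: "0 \<le> \<gamma>" "0 \<le> \<delta>"
        and \<phi>: "\<And>u v. f u v 0 = (\<beta> * u - \<alpha> * v)^2 * (\<gamma> * u + \<delta> * v)"
        unfolding double_zero_def by blast
      have pos: "\<alpha> \<noteq> 0" "\<delta> > 0" using f010 gd by (auto simp: \<phi> zero_less_mult_iff)
      obtain C where C: "C \<ge> 0" "\<And>X Y. (\<beta> * X + (- \<alpha>) * Y)^2 \<le> C * Q X Y 0"
        using definite[of \<beta> "- \<alpha>"] by blast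
      show False
      proof (rule edges_dominate_v_square[of \<beta> "- \<alpha>" C "1 / \<delta>" 0])
        fix u v :: real assume uv: "u \<ge> 0" "v \<ge> 0"
        have "\<delta> * v * (\<beta> * u + - \<alpha> * v)^2 \<le> (\<gamma> * u + \<delta> * v) * (\<beta> * u + - \<alpha> * v)^2"
          using uv gd by (intro mult_right_mono) auto
        then show "v * (\<beta> * u + - \<alpha> * v)^2 \<le> 1 / \<delta> * f u v 0"
          using pos by (simp add: \<phi> pos_le_divide_eq mult_ac)
      qed (use C pos e0 in auto)
    next
      case False
      obtain C1 where C1: "C1 \<ge> 0" "\<And>X Y. (1 * X + 0 * Y)^2 \<le> C1 * Q X Y 0"
        using definite[of 1 0] by blast
      obtain C2 where C2: "C2 \<ge> 0" "\<And>u v. u \<ge> 0 \<Longrightarrow> v \<ge> 0 \<Longrightarrow> v * (1 * u + 0 * v)^2 \<le> C2 * f u v 0"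
        using without_dz[OF False, of 1 0] by blast
      show False
        by (rule edges_dominate_v_square[of 1 0 C1 C2 0]) (use C1 C2 e0 in auto)
    qed
    then show ?thesis ..
  next
    case (square X1 Y1 \<kappa>)
    have X1: "X1 \<noteq> 0" and \<kappa>: "\<kappa> > 0"
    proof -
      have "f 0 (-1) 0 = - f 0 1 0" using cubic_homogeneous[OF f_cubic, of "-1" 0 1 0] by simp
      then have "Q 0 (-1) 0 > 0" using shift[of 0 1 "-1" 0] nonneg[of 0 0 1] e0 f010 by simp
      then show "X1 \<noteq> 0" "\<kappa> > 0" using square(2) by (auto simp: square(3) zero_less_mult_iff)
    qed
    obtain X0 Y0 where X0: "X0 > 0" and Q: "\<And>X Y. Q X Y 0 = \<kappa> * (Y0 * X - X0 * Y)^2"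
    proof (cases "X1 > 0")
      case True then show ?thesis using that square(3) by blast
    next
      case False
      have "Q X Y 0 = \<kappa> * ((- Y1) * X - (- X1) * Y)^2" for X Y
        unfolding square(3) by (simp add: power2_commute)
      then show ?thesis using that[of "- X1" "- Y1"] False X1 by simp
    qed
    have "\<exists>\<alpha> \<beta>. double_zero ?\<phi> \<alpha> \<beta>"
    proof (rule ccontr)
      assume no: "\<not> ?thesis"
      obtain C2 where C2: "C2 \<ge> 0" "\<And>u v. u \<ge> 0 \<Longrightarrow> v \<ge> 0 \<Longrightarrow> v * (Y0 * u + (- X0) * v)^2 \<le> C2 * f u v 0"
        using without_dz[OF no, of Y0 "- X0"] by blast
      show False
        by (rule edges_dominate_v_square[of Y0 "- X0" "1 / \<kappa>" C2 0]) (use C2 e0 X0 \<kappa> in \<open>auto simp: Q\<close>)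
    qed
    then obtain \<alpha> \<beta> where dz: "double_zero ?\<phi> \<alpha> \<beta>" by blast
    then have \<alpha>: "\<alpha> \<ge> 0" "0 < \<alpha> + \<beta>" and f0: "f \<alpha> \<beta> 0 = 0" unfolding double_zero_def by auto
    have "\<alpha> \<noteq> 0"
    proof
      assume "\<alpha> = 0"
      then have "\<beta>^3 * f 0 1 0 = 0" using f0 cubic_homogeneous[OF f_cubic, of \<beta> 0 1 0] by simp
      then show False using f010 \<alpha> \<open>\<alpha> = 0\<close> by simp
    qed
    moreover have "Y0 * \<alpha> \<noteq> X0 * \<beta>"
    proof
      assume "Y0 * \<alpha> = X0 * \<beta>"
      then have "Q \<alpha> \<beta> 0 = 0" by (simp add: Q)
      then show False using no_line_of_zeros[OF f0] \<open>\<alpha> \<noteq> 0\<close> \<alpha> by simp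
    qed
    ultimately show ?thesis using that[OF X0 Q dz] \<alpha> f0 by simp
  qed
qed

text \<open>
  If \<open>f(0,1,0) > 0\<close>, then \<open>A\<close> is a multiple of the square determined by the double zero on \<open>w = 0\<close>, and vanishes also
  in the different direction in which \<open>Q\<close> degenerates.  Otherwise \<open>f(0,0,1) > 0\<close>, and \<open>A\<close> vanishes in three different
  directions: that of \<open>Q\<close>, that of the double zero on \<open>v = 0\<close>, and that of the vertex \<open>(0, 1, 0)\<close>.
\<close>

lemma dominated_at_edge_node:
  assumes e0: "e = 0" and dom: "dominates f A"
  shows "A u v w = 0"
proof (cases "f 0 1 0 > 0")
  case True
  obtain X0 Y0 \<kappa> \<alpha> \<beta> where X0: "X0 > 0" and Q: "\<And>X Y. Q X Y 0 = \<kappa> * (Y0 * X - X0 * Y)^2"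
    and dz: "double_zero (\<lambda>u v. f u v 0) \<alpha> \<beta>" and "\<alpha> > 0" "f \<alpha> \<beta> 0 = 0" and ne: "Y0 * \<alpha> \<noteq> X0 * \<beta>"
    by (rule edge_node_structure[OF e0 True]) (rule that)
  obtain \<mu> where \<mu>: "\<And>u v. A u v 0 = \<mu> * (\<beta> * u - \<alpha> * v)^2"
    using dominated_square_at_double_zero[OF dom dz] by blast
  have "A X0 Y0 0 = 0" by (rule dominated_zero_at_Q_zero[OF dom]) (use X0 in \<open>auto simp: Q\<close>)
  then have "\<mu> = 0" using ne by (auto simp: \<mu> mult.commute)
  show ?thesis by (rule dominated_zero[OF dom]) (simp add: \<mu> \<open>\<mu> = 0\<close>)
next
  case False
  then have f010: "f 0 1 0 = 0" using nonneg[of 0 1 0] by simp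
  have f001: "f 0 0 1 > 0" using vertex_positive[OF e0] f010 by simp
  interpret S: node "\<lambda>u v w. f u w v" "\<lambda>u v w. Q u w v" e by (rule node_swap23)
  obtain X0 Y0 \<kappa> \<alpha> \<beta> where X0: "X0 > 0" and Q: "\<And>X Y. Q X 0 Y = \<kappa> * (Y0 * X - X0 * Y)^2"
    and dz: "double_zero (\<lambda>u v. f u 0 v) \<alpha> \<beta>" and \<alpha>: "\<alpha> > 0" and f0: "f \<alpha> 0 \<beta> = 0" and ne: "Y0 * \<alpha> \<noteq> X0 * \<beta>"
    by (rule S.edge_node_structure[OF e0 f001]) (rule that)
  have \<beta>: "\<beta> \<ge> 0" using dz by (simp add: double_zero_def)
  have "Q X0 (- Y0) 0 = 0" using Q[of X0 Y0] Q_normal_form[of X0 0 Y0] e0 by simp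
  then have z1: "A X0 (- Y0) 0 = 0" using X0 by (intro dominated_zero_at_Q_zero[OF dom]) auto
  have "A \<alpha> 0 \<beta> = 0"
    using dominated_zero_on_u_edge[OF cubic_swap12[OF f_cubic] dominates_swap12[OF dom], of \<alpha> \<beta>] f0 \<alpha> \<beta> by simp
  then have z2: "A \<alpha> (- \<beta>) 0 = 0" using dominated_binary[OF dom, of \<alpha> 0 \<beta>] e0 by simp
  have z3: "A 0 1 0 = 0" by (rule dominated_zero_on_u_edge[OF f_cubic dom]) (use f010 in auto)
  obtain a b c d g h where A: "\<And>u v w. A u v w =
     a * u^2 + b * v^2 + c * w^2 + d * u * v + g * u * w + h * v * w"
    using dominates_quadric[OF dom] unfolding quadric_def by blast
  have b: "b = 0" using z3 by (simp add: A)
  have "X0 * (a * X0 - d * Y0) = 0" using z1 b by (simp add: A algebra_simps power2_eq_square)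
  then have 1: "a * X0 = d * Y0" using X0 by simp
  have "\<alpha> * (a * \<alpha> - d * \<beta>) = 0" using z2 b by (simp add: A algebra_simps power2_eq_square)
  then have 2: "a * \<alpha> = d * \<beta>" using \<alpha> by simp
  have "d * (Y0 * \<alpha> - X0 * \<beta>) = (d * Y0) * \<alpha> - X0 * (d * \<beta>)" by (simp add: algebra_simps)
  also have "\<dots> = 0" unfolding 1[symmetric] 2[symmetric] by simp
  finally have d: "d = 0" using ne by simp
  then have "a = 0" using 1 X0 by simp
  show ?thesis by (rule dominated_zero[OF dom]) (simp add: A b d \<open>a = 0\<close>)
qed

text \<open>
  Here the bound is \<open>sqrt (v w) |A| \<le> f\<close>, and both coordinates under the root are positive at the double point \<open>(0, 1, 1)\<close>.
  Therefore \<open>|A| \<le> Q\<close>, so that \<open>A\<close> is a multiple of \<open>Q\<close>, which is nonzero at the double zero on \<open>w = 0\<close>, where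
  \<open>A\<close> vanishes.
\<close>

lemma dominated_at_opposite_edge_node_aux:
  assumes e0: "e = 0" and f010: "f 0 1 0 > 0" and dom: "dominates (\<lambda>a b c. f c b a) (\<lambda>a b c. A c b a)"
  shows "A u v w = 0"
proof -
  have quad: "quadric A"
    using quadric_swap12[OF quadric_swap23[OF quadric_swap12[OF dominates_quadric[OF dom]]]] by simp
  have bound: "sqrt v * sqrt w * \<bar>A u v w\<bar> \<le> f u v w" if "u \<ge> 0" "v \<ge> 0" "w \<ge> 0" for u v w
    using dominates_sqrt[OF dom, of w v u] that by (simp add: mult.commute)
  have root: "t^2 \<le> sqrt (v + t^2) * sqrt (w + t^2)" if "v \<ge> 0" "w \<ge> 0" for t v w :: real
  proof -
    have "\<bar>t\<bar> * \<bar>t\<bar> \<le> sqrt (v + t^2) * sqrt (w + t^2)"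
      using that by (intro mult_mono real_le_rsqrt) auto
    then show ?thesis by (simp add: power2_eq_square)
  qed
  have grow: "t^2 * \<bar>A u (v + t^2) (w + t^2)\<bar> \<le> f u v w + t^2 * Q u v w"
    if "u \<ge> 0" "v \<ge> 0" "w \<ge> 0" for t u v w
  proof -
    have "t^2 * \<bar>A u (v + t^2) (w + t^2)\<bar> \<le> sqrt (v + t^2) * sqrt (w + t^2) * \<bar>A u (v + t^2) (w + t^2)\<bar>"
      using root[OF that(2,3)] by (intro mult_right_mono) auto
    also have "\<dots> \<le> f u (v + t^2) (w + t^2)" using that by (intro bound) auto
    also have "\<dots> = f u v w + t^2 * Q u v w" using shift[of u "t^2" v w] e0 by simp
    finally show ?thesis .
  qed
  have A_shift: "A (u + s * e) (v + s) (w + s) = A u v w" for u v w s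
  proof (rule quadric_invariant_if_slow_growth[OF quad])
    fix u v w :: real assume uvw: "u > 0" "v \<ge> 0" "w \<ge> 0"
    have "\<bar>A (u + t^2 * e) (v + t^2) (w + t^2)\<bar> \<le> (f u v w + Q u v w) * t" if t: "1 \<le> t" for t
    proof -
      have t1: "1 \<le> t^2" using t by (simp add: one_le_power)
      have f: "0 \<le> f u v w" using nonneg uvw by simp
      have Q: "0 \<le> Q u v w" unfolding Q_normal_form[of u v w] by (rule Q_psd)
      have "t^2 * \<bar>A u (v + t^2) (w + t^2)\<bar> \<le> t^2 * (f u v w + Q u v w)"
        using grow[of u v w t] mult_right_mono[OF t1 f] uvw by (simp add: algebra_simps)
      then have "\<bar>A u (v + t^2) (w + t^2)\<bar> \<le> f u v w + Q u v w" using t by simp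
      also have "\<dots> \<le> (f u v w + Q u v w) * t" using mult_left_mono[OF t, of "f u v w + Q u v w"] f Q by simp
      finally show ?thesis using e0 by simp
    qed
    then show "\<exists>K. \<forall>t\<ge>1. \<bar>A (u + t^2 * e) (v + t^2) (w + t^2)\<bar> \<le> K * t" by blast
  qed
  obtain a b c d g h where A: "\<And>u v w. A u v w =
     a * u^2 + b * v^2 + c * w^2 + d * u * v + g * u * w + h * v * w"
    using quad unfolding quadric_def by blast
  have le: "\<bar>A X Y 0\<bar> \<le> Q X Y 0" if X: "X \<ge> 0" for X Y
  proof -
    have "0 \<le> Q X Y 0 - \<bar>A X Y 0\<bar>"
    proof (rule nonneg_linear)
      fix s :: real assume s: "0 \<le> s"
      have "s * \<bar>A X (Y + \<bar>Y\<bar> + s) (\<bar>Y\<bar> + s)\<bar> \<le> f X (Y + \<bar>Y\<bar>) \<bar>Y\<bar> + s * Q X (Y + \<bar>Y\<bar>) \<bar>Y\<bar>"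
        using grow[of X "Y + \<bar>Y\<bar>" "\<bar>Y\<bar>" "sqrt s"] s X by simp
      moreover have "A X (Y + \<bar>Y\<bar> + s) (\<bar>Y\<bar> + s) = A X Y 0"
        using A_shift[of X "\<bar>Y\<bar> + s" Y 0] e0 by (simp add: add.assoc)
      moreover have "Q X (Y + \<bar>Y\<bar>) \<bar>Y\<bar> = Q X Y 0" using Q_shift[of X "\<bar>Y\<bar>" Y 0] e0 by simp
      ultimately show "0 \<le> f X (Y + \<bar>Y\<bar>) \<bar>Y\<bar> + s * (Q X Y 0 - \<bar>A X Y 0\<bar>)" by (simp add: algebra_simps)
    qed
    then show ?thesis by simp
  qed
  have le': "\<bar>A X Y 0\<bar> \<le> Q X Y 0" for X Y
    using le[of X Y] le[of "- X" "- Y"] quadric_homogeneous[OF quad, of "-1" X Y 0]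
      quadric_homogeneous[OF Q_quadric, of "-1" X Y 0] by (cases "X \<ge> 0") auto
  obtain X0 Y0 \<kappa> \<alpha> \<beta> where X0: "X0 > 0" and Q: "\<And>X Y. Q X Y 0 = \<kappa> * (Y0 * X - X0 * Y)^2"
    and dz: "double_zero (\<lambda>u v. f u v 0) \<alpha> \<beta>" and "\<alpha> > 0" "f \<alpha> \<beta> 0 = 0" and ne: "Y0 * \<alpha> \<noteq> X0 * \<beta>"
    by (rule edge_node_structure[OF e0 f010]) (rule that)
  have AXY: "A X Y 0 = a * X^2 + d * X * Y + b * Y^2" for X Y by (simp add: A)
  obtain \<mu> where \<mu>: "\<And>X Y. A X Y 0 = \<mu> * (Y0 * X - X0 * Y)^2"
    using binary_quadric_below_square[of a d b \<kappa> Y0 X0] le' X0 unfolding AXY[symmetric] Q by auto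
  have "cubic (\<lambda>a b c. f c b a)"
    using cubic_swap12[OF cubic_swap23[OF cubic_swap12[OF f_cubic]]] by simp
  from dominated_zero_at_double_zero[OF this dom double_zero_swap[OF dz]]
  have "A \<alpha> \<beta> 0 = 0" .
  then have "\<mu> = 0" using ne by (simp add: \<mu>)
  then have "A (u - 0 * e) (v - w) 0 = 0" for u v w by (simp add: \<mu>)
  then show ?thesis using A_shift[of u w "v - w" 0] e0 by simp
qed

lemma dominated_at_opposite_edge_node:
  assumes e0: "e = 0" and dom: "dominates (\<lambda>a b c. f c b a) (\<lambda>a b c. A c b a)"
  shows "A u v w = 0"
proof (cases "f 0 1 0 > 0")
  case True
  then show ?thesis by (rule dominated_at_opposite_edge_node_aux[OF e0 _ dom])
next
  case False
  then have f001: "f 0 0 1 > 0" using vertex_positive[OF e0] by simp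
  interpret S: node "\<lambda>u v w. f u w v" "\<lambda>u v w. Q u w v" e by (rule node_swap23)
  have "dominates (\<lambda>a b c. f c a b) (\<lambda>a b c. A c a b)" using dominates_swap12[OF dom] .
  then show ?thesis using S.dominated_at_opposite_edge_node_aux[OF e0, of "\<lambda>u v w. A u w v" u w v] f001 by simp
qed

end

section \<open>Interior double points\<close>

text \<open>
  In this form the condition is symmetric in the three coordinates, unlike definiteness as a form in \<open>X\<close> and
  \<open>Y\<close>.
\<close>

definition definite_mod_diagonal :: "real_fun3 \<Rightarrow> bool" where
  "definite_mod_diagonal Q \<longleftrightarrow> (\<forall>m1 m2 m3. m1 + m2 + m3 = 0 \<longrightarrow>
     (\<exists>C\<ge>0. \<forall>u v w. (m1 * u + m2 * v + m3 * w)^2 \<le> C * Q u v w))"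

lemma definite_swap12:
  assumes "definite_mod_diagonal Q" shows "definite_mod_diagonal (\<lambda>u v w. Q v u w)"
  unfolding definite_mod_diagonal_def
proof (intro allI impI)
  fix m1 m2 m3 :: real assume "m1 + m2 + m3 = 0"
  then have "m2 + m1 + m3 = 0" by simp
  then obtain C where "C \<ge> 0" "\<And>u v w. (m2 * u + m1 * v + m3 * w)^2 \<le> C * Q u v w"
    using assms unfolding definite_mod_diagonal_def by blast
  then show "\<exists>C\<ge>0. \<forall>u v w. (m1 * u + m2 * v + m3 * w)^2 \<le> C * Q v u w"
    by (metis add.commute)
qed

lemma definite_swap23:
  assumes "definite_mod_diagonal Q" shows "definite_mod_diagonal (\<lambda>u v w. Q u w v)"
  unfolding definite_mod_diagonal_def
proof (intro allI impI)
  fix m1 m2 m3 :: real assume "m1 + m2 + m3 = 0"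
  then have "m1 + m3 + m2 = 0" by simp
  then obtain C where C: "C \<ge> 0" "\<And>u v w. (m1 * u + m3 * v + m2 * w)^2 \<le> C * Q u v w"
    using assms unfolding definite_mod_diagonal_def by blast
  have "(m1 * u + m2 * v + m3 * w)^2 \<le> C * Q u w v" for u v w
    using C(2)[of u w v] by (simp add: add_ac)
  then show "\<exists>C\<ge>0. \<forall>u v w. (m1 * u + m2 * v + m3 * w)^2 \<le> C * Q u w v"
    using C(1) by blast
qed

lemma definite_zero:
  assumes "definite_mod_diagonal Q" "Q u v w = 0"
  shows "u = w" "v = w"
proof -
  obtain C where "\<And>u v w. (1 * u + 0 * v + (-1) * w)^2 \<le> C * Q u v w"
    using assms(1)[unfolded definite_mod_diagonal_def, rule_format, of 1 0 "-1"] by auto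
  from this[of u v w] show "u = w" by (simp add: assms(2))
  obtain C where "\<And>u v w. (0 * u + 1 * v + (-1) * w)^2 \<le> C * Q u v w"
    using assms(1)[unfolded definite_mod_diagonal_def, rule_format, of 0 1 "-1"] by auto
  from this[of u v w] show "v = w" by (simp add: assms(2))
qed

lemma double_zero_swap_iff: "double_zero (\<lambda>z y. \<phi> y z) \<beta> \<alpha> \<longleftrightarrow> double_zero \<phi> \<alpha> \<beta>"
  using double_zero_swap[of \<phi> \<alpha> \<beta>] double_zero_swap[of "\<lambda>z y. \<phi> y z" \<beta> \<alpha>] by auto

context node
begin

text \<open>
  With definite \<open>Q\<close> and no double zero on \<open>w = 0\<close>, the inequality \<open>v m^2 \<le> C f\<close> can only fail on the edge \<open>u = 0\<close> or at the vertex
  \<open>(0, 1, 0)\<close>.  For \<open>m\<close> through a double zero on \<open>u = 0\<close> it fails only if the remaining linear factor of \<open>f\<close> on this edge is a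
  multiple of \<open>w\<close>.
\<close>

lemma opposite_edge_shape:
  assumes e1: "e = 1" and def: "definite_mod_diagonal Q"
    and no: "\<nexists>\<alpha> \<beta>. double_zero (\<lambda>u v. f u v 0) \<alpha> \<beta>"
  obtains \<alpha> \<beta> \<delta> where "0 \<le> \<alpha>" "0 \<le> \<beta>" "0 < \<alpha> + \<beta>" "0 < \<delta>"
    "\<And>v w. f 0 v w = (\<beta> * v - \<alpha> * w)^2 * (\<delta> * w)"
proof -
  let ?\<phi> = "\<lambda>u v. f u v 0"
  have bin: "binary_cubic ?\<phi>" by (rule binary_cubic_edges(3)[OF f_cubic])
  have nn: "\<And>y z. y \<ge> 0 \<Longrightarrow> z \<ge> 0 \<Longrightarrow> 0 \<le> ?\<phi> y z" by (rule nonneg) auto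
  have Qb: "\<exists>C\<ge>0. \<forall>X Y. (\<kappa>1 * X + \<kappa>2 * Y)^2 \<le> C * Q X Y 0" for \<kappa>1 \<kappa>2
  proof -
    obtain C where C: "C \<ge> 0" "\<And>u v w. (\<kappa>1 * u + \<kappa>2 * v + (- \<kappa>1 - \<kappa>2) * w)^2 \<le> C * Q u v w"
      using def[unfolded definite_mod_diagonal_def, rule_format, of \<kappa>1 \<kappa>2 "- \<kappa>1 - \<kappa>2"] by auto
    have "(\<kappa>1 * X + \<kappa>2 * Y)^2 \<le> C * Q X Y 0" for X Y using C(2)[of X Y 0] by simp
    then show ?thesis using C(1) by blast
  qed
  have "\<exists>\<alpha> \<beta>. double_zero (f 0) \<alpha> \<beta>"
  proof (rule ccontr)
    assume no_u: "\<not> ?thesis"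
    obtain C1 where C1: "C1 \<ge> 0" "\<And>X Y. (1 * X + 0 * Y)^2 \<le> C1 * Q X Y 0"
      using Qb[of 1 0] by blast
    obtain C2 where C2: "C2 \<ge> 0" "\<And>u v. u \<ge> 0 \<Longrightarrow> v \<ge> 0 \<Longrightarrow> v * (1 * u + 0 * v)^2 \<le> C2 * f u v 0"
      using edge_bound_without_double_zero[OF bin nn no, of 0 1] by auto
    have bin': "binary_cubic (\<lambda>w v. f 0 v w)"
      using binary_cubic_edges(1)[OF cubic_swap23[OF f_cubic]] by simp
    have nn': "\<And>y z. y \<ge> 0 \<Longrightarrow> z \<ge> 0 \<Longrightarrow> 0 \<le> f 0 z y" by (rule nonneg) auto
    have no': "\<nexists>\<alpha> \<beta>. double_zero (\<lambda>w v. f 0 v w) \<alpha> \<beta>"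
      using no_u double_zero_swap_iff[of "f 0"] by blast
    obtain C3 where C3: "C3 \<ge> 0" "\<And>w v. w \<ge> 0 \<Longrightarrow> v \<ge> 0 \<Longrightarrow> v * (1 * w + 0 * v)^2 \<le> C3 * f 0 v w"
      using edge_bound_without_double_zero[OF bin' nn' no', of 0 1] by auto
    show False
      by (rule edges_dominate_v_square[of 1 0 C1 C2 C3]) (use C1 C2 C3 e1 in auto)
  qed
  then obtain \<alpha> \<beta> \<gamma> \<delta> where ab: "0 \<le> \<alpha>" "0 \<le> \<beta>" "0 < \<alpha> + \<beta>" and gd: "0 \<le> \<gamma>" "0 \<le> \<delta>"
    and fu: "\<And>v w. f 0 v w = (\<beta> * v - \<alpha> * w)^2 * (\<gamma> * v + \<delta> * w)"
    unfolding double_zero_def by blast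
  have \<gamma>: "\<gamma> = 0"
  proof (rule ccontr)
    assume "\<gamma> \<noteq> 0"
    then have \<gamma>: "\<gamma> > 0" using gd by simp
    \<comment> \<open>The linear form \<open>(\<alpha> - \<beta>) X + \<beta> Y\<close> vanishes at \<open>(0, \<alpha>, \<beta>)\<close> and \<open>(1, 1, 1)\<close>.\<close>
    obtain C1 where C1: "C1 \<ge> 0" "\<And>X Y. ((\<alpha> - \<beta>) * X + \<beta> * Y)^2 \<le> C1 * Q X Y 0"
      using Qb by blast
    have "\<beta> = 0 \<or> f 0 1 0 > 0" using \<gamma> by (auto simp: fu zero_less_mult_iff)
    then obtain C2 where C2: "C2 \<ge> 0" "\<And>u v. u \<ge> 0 \<Longrightarrow> v \<ge> 0 \<Longrightarrow> v * ((\<alpha> - \<beta>) * u + \<beta> * v)^2 \<le> C2 * f u v 0"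
      using edge_bound_without_double_zero[OF bin nn no, of \<beta> "\<alpha> - \<beta>"] by auto
    show False
    proof (rule edges_dominate_v_square[of "\<alpha> - \<beta>" \<beta> C1 C2 "1 / \<gamma>"])
      fix v w :: real assume vw: "v \<ge> 0" "w \<ge> 0"
      have "\<gamma> * v * (\<beta> * v - \<alpha> * w)^2 \<le> (\<gamma> * v + \<delta> * w) * (\<beta> * v - \<alpha> * w)^2"
        using vw gd by (intro mult_right_mono) auto
      then show "v * (\<beta> * v - (\<alpha> - \<beta> + \<beta>) * w)^2 \<le> 1 / \<gamma> * f 0 v w"
        using \<gamma> by (simp add: fu pos_le_divide_eq mult_ac)
    qed (use C1 C2 \<gamma> ab in auto)
  qed
  have "\<delta> \<noteq> 0"
  proof
    assume "\<delta> = 0"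
    then have "\<forall>v w. f 0 v w = 0" using \<gamma> by (simp add: fu)
    then show False using ndiv by (simp add: divisible_by_variable_def)
  qed
  then have "\<delta> > 0" using gd by simp
  moreover have "f 0 v w = (\<beta> * v - \<alpha> * w)^2 * (\<delta> * w)" for v w using \<gamma> by (simp add: fu)
  ultimately show ?thesis by (rule that[OF ab])
qed

text \<open>
  In the absence of double zeros on two edges, \<open>opposite_edge_shape\<close> applies twice to the third edge and makes the same
  binary cubic a multiple of \<open>v^2 w\<close> and of \<open>v w^2\<close>.
\<close>

lemma double_zero_on_two_edges:
  assumes e1: "e = 1" and def: "definite_mod_diagonal Q"
  shows "(\<exists>\<alpha> \<beta>. double_zero (\<lambda>u v. f u v 0) \<alpha> \<beta>) \<or> (\<exists>\<alpha> \<beta>. double_zero (\<lambda>u w. f u 0 w) \<alpha> \<beta>)"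
proof (rule ccontr)
  assume "\<not> ?thesis"
  then have no: "\<nexists>\<alpha> \<beta>. double_zero (\<lambda>u v. f u v 0) \<alpha> \<beta>" "\<nexists>\<alpha> \<beta>. double_zero (\<lambda>u w. f u 0 w) \<alpha> \<beta>" by auto
  interpret S: node "\<lambda>u v w. f u w v" "\<lambda>u v w. Q u w v" e by (rule node_swap23)
  obtain \<alpha> \<beta> \<delta> where 1: "0 \<le> \<alpha>" "0 \<le> \<beta>" "0 < \<alpha> + \<beta>" "0 < \<delta>"
    "\<And>v w. f 0 v w = (\<beta> * v - \<alpha> * w)^2 * (\<delta> * w)"
    by (rule opposite_edge_shape[OF e1 def no(1)]) (rule that)
  obtain \<alpha>' \<beta>' \<delta>' where 2: "0 \<le> \<alpha>'" "0 \<le> \<beta>'" "0 < \<alpha>' + \<beta>'" "0 < \<delta>'"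
    "\<And>v w. f 0 w v = (\<beta>' * v - \<alpha>' * w)^2 * (\<delta>' * w)"
    by (rule S.opposite_edge_shape[OF e1 definite_swap23[OF def] no(2)]) (rule that)
  have "\<alpha> = 0" using 1(5)[of 0 1] 2(5)[where v = 1 and w = 0] 1(4) by simp
  moreover have "\<alpha>' = 0" using 1(5)[of 1 0] 2(5)[where v = 0 and w = 1] 2(4) by simp
  ultimately have "f 0 1 1 = \<beta>^2 * \<delta>" "f 0 1 1 = \<beta>'^2 * \<delta>'"
    "f 0 2 1 = 4 * (\<beta>^2 * \<delta>)" "f 0 2 1 = 2 * (\<beta>'^2 * \<delta>')"
    using 1(5)[of 1 1] 2(5)[of 1 1] 1(5)[of 2 1] 2(5)[where v = 1 and w = 2] by (simp_all add: power_mult_distrib)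
  then have "\<beta>^2 * \<delta> = 0" by linarith
  then show False using 1 \<open>\<alpha> = 0\<close> by simp
qed

text \<open>
  On a line through the double point \<open>f\<close> has at most one further zero unless it vanishes identically, which would
  contradict definiteness of \<open>Q\<close>.
\<close>

lemma zeros_on_line_through_node:
  assumes e1: "e = 1" and def: "definite_mod_diagonal Q"
    and f1: "f u v w = 0" and f2: "f (\<mu> - t * u) (\<mu> - t * v) (\<mu> - t * w) = 0"
    and t: "\<mu> \<noteq> 0" "t \<noteq> 0"
  shows "u = w" "v = w"
proof -
  have "f (\<mu> - t * u) (\<mu> - t * v) (\<mu> - t * w) = f ((- t) * u) ((- t) * v) ((- t) * w) + \<mu> * Q ((- t) * u) ((- t) * v) ((- t) * w)"
    using shift[of "- t * u" \<mu> "- t * v" "- t * w"] e1 by simp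
  also have "\<dots> = \<mu> * (t^2 * Q u v w)"
    unfolding cubic_homogeneous[OF f_cubic] quadric_homogeneous[OF Q_quadric] f1 by simp
  finally have "Q u v w = 0" using f2 t by simp
  then show "u = w" "v = w" using definite_zero[OF def] by blast+
qed

text \<open>
  The equation says that the double zeros \<open>(\<alpha>, \<beta>, 0)\<close> and \<open>(0, \<alpha>', \<beta>')\<close> lie on a common line through \<open>(1, 1, 1)\<close>.
  Two different zeros are excluded by \<open>zeros_on_line_through_node\<close>.  The two can only coincide at the vertex
  \<open>(0, 1, 0)\<close>, at which \<open>f\<close> would then be singular, so that \<open>Q\<close> would vanish there.
\<close>

lemma double_zeros_not_collinear:
  assumes e1: "e = 1" and def: "definite_mod_diagonal Q"
    and w: "double_zero (\<lambda>u v. f u v 0) \<alpha> \<beta>" and u: "double_zero (f 0) \<alpha>' \<beta>'"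
  shows "\<alpha> * \<beta>' \<noteq> \<beta> * \<beta>' + \<alpha> * \<alpha>'"
proof
  assume coll: "\<alpha> * \<beta>' = \<beta> * \<beta>' + \<alpha> * \<alpha>'"
  obtain \<gamma> \<delta> where ab: "0 \<le> \<alpha>" "0 \<le> \<beta>" "0 < \<alpha> + \<beta>"
    and fw: "\<And>u v. f u v 0 = (\<beta> * u - \<alpha> * v)^2 * (\<gamma> * u + \<delta> * v)"
    using w unfolding double_zero_def by blast
  obtain \<gamma>' \<delta>' where ab': "0 \<le> \<alpha>'" "0 \<le> \<beta>'" "0 < \<alpha>' + \<beta>'"
    and fu: "\<And>v w. f 0 v w = (\<beta>' * v - \<alpha>' * w)^2 * (\<gamma>' * v + \<delta>' * w)"
    using u unfolding double_zero_def by blast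
  show False
  proof (cases "\<beta>' = 0")
    case False
    then have \<alpha>: "\<alpha> \<noteq> 0" using coll ab by auto
    \<comment> \<open>The line joining the two zeros contains \<open>(\<alpha>, \<alpha>, \<alpha>)\<close>.\<close>
    have "\<alpha> - \<alpha> / \<beta>' * \<alpha>' = \<beta>" using coll False by (simp add: field_simps)
    then have "f (\<alpha> - \<alpha> / \<beta>' * 0) (\<alpha> - \<alpha> / \<beta>' * \<alpha>') (\<alpha> - \<alpha> / \<beta>' * \<beta>') = 0"
      using False by (simp add: fw)
    from zeros_on_line_through_node[OF e1 def _ this \<alpha>] False \<alpha> show False by (simp add: fu)
  next
    case True
    then have "\<alpha>' > 0" and "\<alpha> = 0" and "\<beta> > 0" using coll ab ab' by auto
    obtain a b c d e' g h i j k where f: "\<And>u v w. f u v w =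
       a * u^3 + b * v^3 + c * w^3 + d * u^2 * v + e' * u^2 * w + g * u * v^2
       + h * v^2 * w + i * u * w^2 + j * v * w^2 + k * u * v * w"
      using f_cubic unfolding cubic_def by blast
    have "b = 0" using fu[of 1 0] True by (simp add: f)
    have "h = 0" using fu[of 1 1] fu[of 1 "-1"] fu[of 1 2] True \<open>b = 0\<close> by (simp add: f algebra_simps)
    have "g = 0" using fw[of 1 1] fw[of "-1" 1] fw[of 2 1] \<open>\<alpha> = 0\<close> \<open>b = 0\<close> by (simp add: f algebra_simps)
    have "f s (1 + s) s = s * Q 0 1 0" for s using shift[of 0 s 1 0] e1 \<open>b = 0\<close> by (simp add: f)
    from this[of 1] this[of "-1"] this[of 2] have "Q 0 1 0 = 0"
      by (simp add: f \<open>b = 0\<close> \<open>h = 0\<close> \<open>g = 0\<close>)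
    from definite_zero[OF def this] show False by simp
  qed
qed

lemma dominated_zero_if_two_double_zeros:
  assumes e1: "e = 1" and def: "definite_mod_diagonal Q" and dom: "dominates f A"
    and w: "double_zero (\<lambda>u v. f u v 0) \<alpha> \<beta>" and u: "double_zero (f 0) \<alpha>' \<beta>'"
  shows "A x y z = 0"
proof -
  obtain \<mu> where \<mu>: "\<And>u v. A u v 0 = \<mu> * (\<beta> * u - \<alpha> * v)^2"
    using dominated_square_at_double_zero[OF dom w] by blast
  have "A 0 \<alpha>' \<beta>' = 0" by (rule dominated_zero_at_double_zero[OF f_cubic dom u])
  then have "A (- \<beta>') (\<alpha>' - \<beta>') 0 = 0" using dominated_binary[OF dom, of 0 \<alpha>' \<beta>'] e1 by simp
  moreover have "\<beta> * (- \<beta>') - \<alpha> * (\<alpha>' - \<beta>') \<noteq> 0"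
    using double_zeros_not_collinear[OF e1 def w u] by (simp add: algebra_simps)
  ultimately have "\<mu> = 0" by (simp add: \<mu>)
  show ?thesis by (rule dominated_zero[OF dom]) (simp add: \<mu> \<open>\<mu> = 0\<close>)
qed

text \<open>
  When \<open>f(0, v, w)\<close> has a triple zero at the vertex \<open>(0, 1, 0)\<close>, the form \<open>(u - w) (v - w)\<close> passes all tests at zeros of \<open>f\<close>,
  and only the order of contact matters: on the curve \<open>(t^6, 1, t^2)\<close> one has \<open>f = O(t^6)\<close>, while \<open>sqrt (u v) |A|\<close> has
  order \<open>t^5\<close> unless \<open>c = 0\<close>.
\<close>

lemma dominated_at_motzkin_node:
  assumes dom: "dominates f A" and fu: "\<And>v w. f 0 v w = \<delta> * w^3" and A: "\<And>u v w. A u v w = c * ((u - w) * (v - w))"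
  shows "c = 0"
proof -
  obtain a b c' d e' g h i j k where f: "\<And>u v w. f u v w =
     a * u^3 + b * v^3 + c' * w^3 + d * u^2 * v + e' * u^2 * w + g * u * v^2
     + h * v^2 * w + i * u * w^2 + j * v * w^2 + k * u * v * w"
    using f_cubic unfolding cubic_def by blast
  have b: "b = 0" using fu[of 1 0] by (simp add: f)
  have hj: "h = 0" "j = 0"
    using fu[of 0 1] fu[of 1 1] fu[of 1 "-1"] b by (simp_all add: f)
  define P where "P = (\<lambda>t. c' + g + (k + d * t^4 + e' * t^6) * t^2 + i * t^4 + a * t^12)"
  have "(\<lambda>t. c * ((t^4 - 1) * (1 - t^2))) 0 = 0"
  proof (rule small_order_continuous)
    show "continuous_on UNIV (\<lambda>t. c * ((t^4 - 1) * (1 - t^2)))" by (intro continuous_intros)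
    show "continuous_on UNIV P" unfolding P_def by (intro continuous_intros)
    fix t :: real assume t: "0 < t" "t \<le> 1"
    have "t^3 * 1 * \<bar>A ((t^3)^2) (1^2) (t^2)\<bar> \<le> f ((t^3)^2) (1^2) (t^2)"
      using dominatesD[OF dom, of "t^3" 1 "t^2"] t by simp
    also have "\<dots> = t^5 * (t * P t)"
      unfolding f b hj P_def by (simp add: algebra_simps eval_nat_numeral)
    also have "A ((t^3)^2) (1^2) (t^2) = t^2 * (c * ((t^4 - 1) * (1 - t^2)))"
      unfolding A by (simp add: algebra_simps eval_nat_numeral)
    finally have "t^5 * \<bar>c * ((t^4 - 1) * (1 - t^2))\<bar> \<le> t^5 * (t * P t)"
      using t by (simp add: abs_mult eval_nat_numeral mult_ac)
    then show "\<bar>c * ((t^4 - 1) * (1 - t^2))\<bar> \<le> t * P t" using t by (simp add: mult_le_cancel_left_pos)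
  qed
  then show ?thesis by simp
qed

text \<open>
  A double zero on \<open>w = 0\<close> is accompanied by one on another edge, and \<open>A\<close>, being a multiple of a square, cannot vanish there
  as well.  In the absence of a double zero on \<open>w = 0\<close> the vertices \<open>(0, 1, 0)\<close> and \<open>(1, 0, 0)\<close> are zeros of \<open>f\<close>,
  which leaves multiples of \<open>(u - w) (v - w)\<close>.  A double zero on \<open>u = 0\<close> in which such a form vanishes is either \<open>(0, 1, 1)\<close>,
  which is collinear with \<open>(1, 0, 0)\<close> and the double point, or the vertex \<open>(0, 1, 0)\<close>, as in
  \<open>dominated_at_motzkin_node\<close>.
\<close>

lemma dominated_at_definite_interior_node:
  assumes e1: "e = 1" and def: "definite_mod_diagonal Q" and dom: "dominates f A"
  shows "A x y z = 0"
proof -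
  interpret S: node "\<lambda>u v w. f v u w" "\<lambda>u v w. Q v u w" e by (rule node_swap12[OF e1])
  note S_dom = dominates_swap12[OF dom]
  note S_def = definite_swap12[OF def]
  show ?thesis
  proof (cases "\<exists>\<alpha> \<beta>. double_zero (\<lambda>u v. f u v 0) \<alpha> \<beta>")
    case True
    then obtain \<alpha> \<beta> where w: "double_zero (\<lambda>u v. f u v 0) \<alpha> \<beta>" by blast
    interpret R: node "\<lambda>u v w. f v w u" "\<lambda>u v w. Q v w u" e
    proof -
      interpret S': node "\<lambda>u v w. f u w v" "\<lambda>u v w. Q u w v" e by (rule node_swap23)
      show "node (\<lambda>u v w. f v w u) (\<lambda>u v w. Q v w u) e" by (rule S'.node_swap12[OF e1])
    qed
    have "definite_mod_diagonal (\<lambda>u v w. Q v w u)"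
      using definite_swap12[OF definite_swap23[OF def]] .
    from R.double_zero_on_two_edges[OF e1 this] consider
      (v) \<alpha>' \<beta>' where "double_zero (\<lambda>u v. f v 0 u) \<alpha>' \<beta>'" | (u) \<alpha>' \<beta>' where "double_zero (\<lambda>u w. f 0 w u) \<alpha>' \<beta>'"
      by blast
    then show ?thesis
    proof cases
      case u
      then have "double_zero (f 0) \<beta>' \<alpha>'" using double_zero_swap_iff[of "f 0"] by simp
      then show ?thesis by (rule dominated_zero_if_two_double_zeros[OF e1 def dom w])
    next
      case v
      show ?thesis
        using S.dominated_zero_if_two_double_zeros[OF e1 S_def S_dom double_zero_swap[OF w] double_zero_swap[OF v], of x y z]
        by simp
    qed
  next
    case False
    then have no: "\<nexists>\<alpha> \<beta>. double_zero (\<lambda>u v. f u v 0) \<alpha> \<beta>" by simp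
    then have no': "\<nexists>\<alpha> \<beta>. double_zero (\<lambda>u v. f v u 0) \<alpha> \<beta>"
      using double_zero_swap_iff[of "\<lambda>u v. f u v 0"] by blast
    obtain \<alpha> \<beta> \<delta> where 1: "0 \<le> \<alpha>" "0 \<le> \<beta>" "0 < \<alpha> + \<beta>" "0 < \<delta>"
      and fu: "\<And>v w. f 0 v w = (\<beta> * v - \<alpha> * w)^2 * (\<delta> * w)"
      by (rule opposite_edge_shape[OF e1 def no]) (rule that)
    obtain \<alpha>' \<beta>' \<delta>' where "0 \<le> \<alpha>'" "0 \<le> \<beta>'" "0 < \<alpha>' + \<beta>'" "0 < \<delta>'"
      and fv: "\<And>v w. f v 0 w = (\<beta>' * v - \<alpha>' * w)^2 * (\<delta>' * w)"
      by (rule S.opposite_edge_shape[OF e1 S_def no']) (rule that)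
    have A010: "A 0 1 0 = 0" by (rule dominated_zero_on_u_edge[OF f_cubic dom]) (auto simp: fu)
    have A100: "A 1 0 0 = 0"
      using dominated_zero_on_u_edge[OF S.f_cubic S_dom, of 1 0] by (simp add: fv)
    obtain a b c d g h where A: "\<And>u v w. A u v w =
       a * u^2 + b * v^2 + c * w^2 + d * u * v + g * u * w + h * v * w"
      using dominates_quadric[OF dom] unfolding quadric_def by blast
    have ab: "a = 0" "b = 0" using A010 A100 by (simp_all add: A)
    have Aform: "A u v w = d * ((u - w) * (v - w))" for u v w
      using dominated_binary[OF dom, of u v w] e1 unfolding A[of "u - w * e"] by (simp add: ab mult.assoc)
    have "d = 0"
    proof (rule ccontr)
      assume d: "d \<noteq> 0"
      have "\<exists>\<gamma>\<ge>0. \<exists>\<delta>\<ge>0. \<forall>v w. f 0 v w = (\<beta> * v - \<alpha> * w)^2 * (\<gamma> * v + \<delta> * w)"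
      proof (intro exI conjI allI)
        show "f 0 v w = (\<beta> * v - \<alpha> * w)^2 * (0 * v + \<delta> * w)" for v w by (simp add: fu)
      qed (use 1 in auto)
      then have "double_zero (f 0) \<alpha> \<beta>" using 1 by (simp add: double_zero_def)
      from dominated_zero_at_double_zero[OF f_cubic dom this]
      have "\<beta> = 0 \<or> \<alpha> = \<beta>" using d by (auto simp: Aform)
      then show False
      proof
        assume "\<beta> = 0"
        then have "f 0 v w = (\<alpha>^2 * \<delta>) * w^3" for v w
          by (simp add: fu power_mult_distrib power2_eq_square power3_eq_cube)
        from dominated_at_motzkin_node[OF dom this Aform] d show False by simp
      next
        assume "\<alpha> = \<beta>"
        then have "f 0 \<alpha> \<alpha> = 0" by (simp add: fu)
        moreover have "f (\<alpha> - 1 * 0) (\<alpha> - 1 * \<alpha>) (\<alpha> - 1 * \<alpha>) = 0" by (simp add: fv)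
        moreover have "\<alpha> \<noteq> 0" using 1 \<open>\<alpha> = \<beta>\<close> by simp
        ultimately show False using zeros_on_line_through_node(1)[OF e1 def, of 0 \<alpha> \<alpha> \<alpha> 1] by simp
      qed
    qed
    then show ?thesis by (simp add: Aform)
  qed
qed

text \<open>
  If \<open>Q\<close> is a multiple of \<open>m^2\<close>, then so is \<open>A\<close>, since \<open>|A| \<le> Q\<close>.  If \<open>A\<close> is nonzero, then
  \<open>f\<close> and \<open>A\<close> have no common zero apart from the double point, by \<open>no_line_of_zeros\<close>.  So \<open>f\<close> has neither double zeros on the edges \<open>u = 0\<close> and
  \<open>w = 0\<close> nor a zero at \<open>(0, 1, 0)\<close>, which makes \<open>v m^2 \<le> C f\<close> true and is impossible.
\<close>

lemma dominated_at_interior_node: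
  assumes e1: "e = 1" and dom: "dominates f A"
  shows "A x y z = 0"
proof (cases rule: Q_cases)
  case definite
  have "definite_mod_diagonal Q"
    unfolding definite_mod_diagonal_def
  proof (intro allI impI)
    fix m1 m2 m3 :: real assume m: "m1 + m2 + m3 = 0"
    obtain C where C: "C \<ge> 0" "\<And>X Y. (m1 * X + m2 * Y)^2 \<le> C * Q X Y 0" using definite by blast
    have "(m1 * u + m2 * v + m3 * w)^2 \<le> C * Q u v w" for u v w
    proof -
      have "m3 = - m1 - m2" using m by simp
      then have "m1 * u + m2 * v + m3 * w = m1 * (u - w * e) + m2 * (v - w)"
        by (simp only: e1) (simp add: algebra_simps)
      then show ?thesis using C(2)[of "u - w * e" "v - w"] unfolding Q_normal_form[of u v w] by simp
    qed
    then show "\<exists>C\<ge>0. \<forall>u v w. (m1 * u + m2 * v + m3 * w)^2 \<le> C * Q u v w" using C(1) by blast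
  qed
  from dominated_at_definite_interior_node[OF e1 this dom] show ?thesis .
next
  case (square X0 Y0 \<kappa>)
  obtain a b c d g h where A: "\<And>u v w. A u v w =
     a * u^2 + b * v^2 + c * w^2 + d * u * v + g * u * w + h * v * w"
    using dominates_quadric[OF dom] unfolding quadric_def by blast
  have AXY: "A X Y 0 = a * X^2 + d * X * Y + b * Y^2" for X Y by (simp add: A)
  obtain \<mu> where \<mu>: "\<And>X Y. A X Y 0 = \<mu> * (Y0 * X - X0 * Y)^2"
    using binary_quadric_below_square[of a d b \<kappa> Y0 X0] dominated_by_Q[OF dom e1] square(1)
    unfolding AXY[symmetric] square(3) by auto
  have "\<mu> = 0"
  proof (rule ccontr)
    assume \<mu>0: "\<mu> \<noteq> 0"
    have nz: "Y0 * Y0 - X0 * (- X0) \<noteq> 0" using square(1) by (auto simp: sum_squares_eq_zero_iff)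
    have "\<kappa> \<noteq> 0"
      using dominated_by_Q[OF dom e1, of Y0 "- X0"] nz \<mu>0 unfolding square(3) \<mu> by auto
    then have \<kappa>: "\<kappa> > 0" using square(2) by simp
    have common: "u = w \<and> v = w" if "f u v w = 0" "A u v w = 0" for u v w
    proof -
      have "\<mu> * (Y0 * (u - w * e) - X0 * (v - w))^2 = 0"
        using that(2) unfolding dominated_binary[OF dom, of u v w] \<mu> .
      then have Q0: "Q (u - w * e) (v - w) 0 = 0" using \<mu>0 by (simp add: square(3))
      then have "f (u - w * e) (v - w) 0 = 0"
        using that(1) normal_form[of u v w] Q_normal_form[of u v w] by simp
      from no_line_of_zeros[OF this Q0] e1 show ?thesis by auto
    qed
    have "f 0 1 0 \<noteq> 0"
      using common[of 0 1 0] dominated_zero_on_u_edge[OF f_cubic dom, of 1 0] by auto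
    then have f010: "f 0 1 0 > 0" using nonneg[of 0 1 0] by simp
    have no_w: "\<nexists>\<alpha> \<beta>. double_zero (\<lambda>u v. f u v 0) \<alpha> \<beta>"
    proof clarify
      fix \<alpha> \<beta> assume dz: "double_zero (\<lambda>u v. f u v 0) \<alpha> \<beta>"
      then obtain \<nu> where "\<And>u v. A u v 0 = \<nu> * (\<beta> * u - \<alpha> * v)^2"
        using dominated_square_at_double_zero[OF dom] by blast
      then have "A \<alpha> \<beta> 0 = 0" by simp
      moreover have "f \<alpha> \<beta> 0 = 0" "0 < \<alpha> + \<beta>" using dz unfolding double_zero_def by auto
      ultimately show False using common[of \<alpha> \<beta> 0] by simp
    qed
    have no_u: "\<nexists>\<alpha> \<beta>. double_zero (\<lambda>w v. f 0 v w) \<alpha> \<beta>"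
    proof clarify
      fix \<alpha> \<beta> assume "double_zero (\<lambda>w v. f 0 v w) \<alpha> \<beta>"
      then have dz: "double_zero (f 0) \<beta> \<alpha>" using double_zero_swap_iff[of "f 0"] by simp
      have "f 0 \<beta> \<alpha> = 0" "0 < \<beta> + \<alpha>" using dz unfolding double_zero_def by auto
      then show False using common[OF _ dominated_zero_at_double_zero[OF f_cubic dom dz]] by simp
    qed
    have bin: "binary_cubic (\<lambda>u v. f u v 0)" by (rule binary_cubic_edges(3)[OF f_cubic])
    have nn: "\<And>y z. y \<ge> 0 \<Longrightarrow> z \<ge> 0 \<Longrightarrow> 0 \<le> f y z 0" by (rule nonneg) auto
    have bin': "binary_cubic (\<lambda>w v. f 0 v w)"
      using binary_cubic_edges(1)[OF cubic_swap23[OF f_cubic]] by simp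
    have nn': "\<And>y z. y \<ge> 0 \<Longrightarrow> z \<ge> 0 \<Longrightarrow> 0 \<le> f 0 z y" by (rule nonneg) auto
    obtain C2 where C2: "C2 \<ge> 0" "\<And>u v. u \<ge> 0 \<Longrightarrow> v \<ge> 0 \<Longrightarrow> v * (Y0 * u + (- X0) * v)^2 \<le> C2 * f u v 0"
      using edge_bound_without_double_zero[OF bin nn no_w, of "- X0" Y0] f010 by auto
    obtain C3 where C3: "C3 \<ge> 0" "\<And>w v. w \<ge> 0 \<Longrightarrow> v \<ge> 0 \<Longrightarrow> v * ((X0 - Y0) * w + (- X0) * v)^2 \<le> C3 * f 0 v w"
      using edge_bound_without_double_zero[OF bin' nn' no_u, of "- X0" "X0 - Y0"] f010 by auto
    show False
    proof (rule edges_dominate_v_square[of Y0 "- X0" "1 / \<kappa>" C2 C3])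
      show "v * (- X0 * v - (Y0 + - X0) * w)^2 \<le> C3 * f 0 v w" if "v \<ge> 0" "w \<ge> 0" for v w
        using C3(2)[OF that(2,1)] by (simp add: algebra_simps)
    qed (use square(1) \<kappa> C2 C3 in \<open>auto simp: square(3)\<close>)
  qed
  then show ?thesis by (intro dominated_zero[OF dom, of x y z]) (simp add: \<mu>)
qed

end

section \<open>Double points at a vertex\<close>

text \<open>
  Here \<open>f = w Q(u, v) + K(u, v)\<close> with both summands non-negative on the orthant.  By extremality one of them is zero.  A binary
  cubic \<open>K\<close> dominates a product of a coordinate and a square, by \<open>edge_dichotomy\<close>.
\<close>

lemma vertex_double_point_divisible:
  assumes ext: "extremal_cubic f" and dp: "double_point f 0 0 1 Q"
  shows "divisible_by_variable f"
proof -
  have quad: "quadric Q" and f: "\<And>u v w. f u v w = f u v 0 + w * Q u v 0"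
    using dp unfolding double_point_def by (metis add_0 add.right_neutral mult.right_neutral mult_zero_right)+
  note nonneg = extremal_cubicD(2)[OF ext]
  have Q: "0 \<le> Q u v 0" if "u \<ge> 0" "v \<ge> 0" for u v
    by (rule nonneg_linear[of "f u v 0"]) (use nonneg[OF that] f in metis)
  obtain a b c d e g where q: "\<And>u v w. Q u v w =
     a * u^2 + b * v^2 + c * w^2 + d * u * v + e * u * w + g * v * w"
    using quad unfolding quadric_def by blast
  have c: "cubic (\<lambda>u v w. w * Q u v 0)"
    by (rule cubicI[of _ 0 0 0 0 a 0 b 0 0 d]) (simp add: q algebra_simps)
  have "0 \<le> w * Q u v 0 \<and> w * Q u v 0 \<le> 1 * f u v w" if "u \<ge> 0" "v \<ge> 0" "w \<ge> 0" for u v w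
    using nonneg[of u v 0] Q that f[of u v w] by simp
  from extremal_cubic_dominated[OF ext c this] obtain t where t: "\<And>u v w. w * Q u v 0 = t * f u v w"
    by blast
  show ?thesis
  proof (cases "t = 0")
    case False
    then have "f u v 0 = 0" for u v using t[of 0 u v] by simp
    then show ?thesis by (simp add: divisible_by_variable_def)
  next
    case True
    then have "Q u v 0 = 0" for u v using t[of 1 u v] by simp
    then have fuv: "f u v w = f u v 0" for u v w using f[of u v w] by simp
    show ?thesis
    proof (rule edge_dichotomy[OF binary_cubic_edges(3)[OF extremal_cubicD(1)[OF ext]]])
      show "0 \<le> f y z 0" if "y \<ge> 0" "z \<ge> 0" for y z using that by (simp add: nonneg)
    next
      fix \<alpha> \<beta> assume "double_zero (\<lambda>u v. f u v 0) \<alpha> \<beta>"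
      then obtain \<gamma> \<delta> where "\<And>u v. f u v 0 = (\<beta> * u - \<alpha> * v)^2 * (\<gamma> * u + \<delta> * v)"
        unfolding double_zero_def by blast
      then have "f u v w = (\<gamma> * u + \<delta> * v + 0 * w) * (\<beta> * u + (- \<alpha>) * v + 0 * w)^2" for u v w
        using fuv[of u v w] by simp
      then show ?thesis by (rule linear_times_square_divisible[OF ext])
    next
      fix \<epsilon> :: real assume eps: "\<epsilon> > 0" and le: "\<And>y z. y \<ge> 0 \<Longrightarrow> z \<ge> 0 \<Longrightarrow> \<epsilon> * (y^2 * z + y * z^2) \<le> f y z 0"
      show ?thesis
      proof (rule divisible_if_dominates_v[OF ext, of 1 0 0 "1 / \<epsilon>"])
        fix u v w :: real assume nn: "u \<ge> 0" "v \<ge> 0" "w \<ge> 0"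
        have "\<epsilon> * (u^2 * v) \<le> \<epsilon> * (u^2 * v + u * v^2)" using nn eps by simp
        also have "\<dots> \<le> f u v w" using le[OF nn(1,2)] fuv[of u v w] by simp
        finally show "v * (1 * u + 0 * v + 0 * w)^2 \<le> 1 / \<epsilon> * f u v w"
          using eps by (simp add: pos_le_divide_eq mult_ac)
      qed simp
    qed
  qed
qed

section \<open>Products of a linear and a quadratic form\<close>

definition extremal_quadric :: "real_fun3 \<Rightarrow> bool" where
  "extremal_quadric q \<longleftrightarrow> quadric q \<and> (\<forall>u\<ge>0. \<forall>v\<ge>0. \<forall>w\<ge>0. 0 \<le> q u v w) \<and> (\<exists>u v w. q u v w \<noteq> 0) \<and>
     (\<forall>g C. quadric g \<longrightarrow> (\<forall>u\<ge>0. \<forall>v\<ge>0. \<forall>w\<ge>0. 0 \<le> g u v w \<and> g u v w \<le> C * q u v w) \<longrightarrow>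
        (\<exists>a. \<forall>u v w. g u v w = a * q u v w))"

lemma extremal_quadricD:
  assumes "extremal_quadric q"
  shows "quadric q" "\<And>u v w. u \<ge> 0 \<Longrightarrow> v \<ge> 0 \<Longrightarrow> w \<ge> 0 \<Longrightarrow> 0 \<le> q u v w"
    "\<exists>u v w. q u v w \<noteq> 0"
  using assms by (auto simp: extremal_quadric_def)

lemma extremal_quadric_dominated:
  assumes "extremal_quadric q" "quadric g"
    and "\<And>u v w. u \<ge> 0 \<Longrightarrow> v \<ge> 0 \<Longrightarrow> w \<ge> 0 \<Longrightarrow> 0 \<le> g u v w \<and> g u v w \<le> C * q u v w"
  obtains a where "\<And>u v w. g u v w = a * q u v w"
  using assms unfolding extremal_quadric_def by metis

text \<open>
  If \<open>g \<le> C q\<close>, then \<open>l g \<le> C f\<close>.  Dividing by the linear form \<open>l\<close> is legitimate where \<open>l\<close> does not vanish, and the remaining points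
  are reached as limits along \<open>(1, 1, 1)\<close>, where \<open>l\<close> is positive.
\<close>

lemma extremal_quotient:
  assumes ext: "extremal_cubic f" and f: "\<And>u v w. f u v w = (l1 * u + l2 * v + l3 * w) * q u v w"
    and l: "l1 \<ge> 0" "l2 \<ge> 0" "l3 \<ge> 0" "l1 + l2 + l3 > 0" and quad: "quadric q"
  shows "extremal_quadric q"
proof -
  obtain a b c d e g where q: "\<And>u v w. q u v w =
     a * u^2 + b * v^2 + c * w^2 + d * u * v + e * u * w + g * v * w"
    using quad unfolding quadric_def by blast
  have l_pos: "l1 * (u + t) + l2 * (v + t) + l3 * (w + t) > 0" if "u \<ge> 0" "v \<ge> 0" "w \<ge> 0" "t > 0" for u v w t
  proof -
    have "l1 * (u + t) + l2 * (v + t) + l3 * (w + t) = (l1 * u + l2 * v + l3 * w) + (l1 + l2 + l3) * t"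
      by (simp add: algebra_simps)
    moreover have "0 \<le> l1 * u + l2 * v + l3 * w" using l that by simp
    moreover have "0 < (l1 + l2 + l3) * t" using l that by simp
    ultimately show ?thesis by simp
  qed
  have nonneg: "0 \<le> q u v w" if nn: "u \<ge> 0" "v \<ge> 0" "w \<ge> 0" for u v w
  proof -
    have "0 \<le> q (u + 0) (v + 0) (w + 0)"
    proof (rule nonneg_at_limit)
      show "continuous_on UNIV (\<lambda>t. q (u + t) (v + t) (w + t))" unfolding q by (intro continuous_intros)
      show "0 \<le> q (u + t) (v + t) (w + t)" if "0 < t" for t
        using extremal_cubicD(2)[OF ext, of "u + t" "v + t" "w + t"] l_pos[OF nn that] nn that
        by (simp add: f zero_le_mult_iff)
    qed
    then show ?thesis by simp
  qed
  have "\<exists>k. \<forall>u v w. p u v w = k * q u v w"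
    if quadp: "quadric p" and le: "\<forall>u\<ge>0. \<forall>v\<ge>0. \<forall>w\<ge>0. 0 \<le> p u v w \<and> p u v w \<le> C * q u v w" for p C
  proof -
    obtain a' b' c' d' e' g' where p: "\<And>u v w. p u v w =
       a' * u^2 + b' * v^2 + c' * w^2 + d' * u * v + e' * u * w + g' * v * w"
      using quadp unfolding quadric_def by blast
    have c: "cubic (\<lambda>u v w. (l1 * u + l2 * v + l3 * w) * p u v w)"
      by (rule cubicI[of _ "l1 * a'" "l2 * b'" "l3 * c'" "l1 * d' + l2 * a'" "l1 * e' + l3 * a'" "l1 * b' + l2 * d'"
            "l2 * g' + l3 * b'" "l1 * c' + l3 * e'" "l2 * c' + l3 * g'" "l1 * g' + l2 * e' + l3 * d'"])
         (simp add: p algebra_simps power2_eq_square power3_eq_cube)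
    have "0 \<le> (l1 * u + l2 * v + l3 * w) * p u v w \<and> (l1 * u + l2 * v + l3 * w) * p u v w \<le> C * f u v w"
      if nn: "u \<ge> 0" "v \<ge> 0" "w \<ge> 0" for u v w
    proof -
      have L: "0 \<le> l1 * u + l2 * v + l3 * w" using l nn by simp
      have P: "0 \<le> p u v w" "p u v w \<le> C * q u v w" using le nn by auto
      have "(l1 * u + l2 * v + l3 * w) * p u v w \<le> (l1 * u + l2 * v + l3 * w) * (C * q u v w)"
        using P(2) L by (rule mult_left_mono)
      then show ?thesis using L P by (simp add: f mult_ac)
    qed
    from extremal_cubic_dominated[OF ext c this]
    obtain k where k: "\<And>u v w. (l1 * u + l2 * v + l3 * w) * p u v w = k * f u v w" by blast
    have pos: "p u v w = k * q u v w" if "l1 * u + l2 * v + l3 * w \<noteq> 0" for u v w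
      using k[of u v w] that by (simp add: f)
    have "p u v w = k * q u v w" for u v w
    proof -
      define L where "L = l1 * u + l2 * v + l3 * w"
      define S where "S = l1 + l2 + l3"
      show ?thesis
      proof (cases "L = 0")
        case False
        then show ?thesis using pos[of u v w] by (simp add: L_def)
      next
        case True
        have "p (u + 0) (v + 0) (w + 0) - k * q (u + 0) (v + 0) (w + 0) = 0"
        proof (rule small_order_continuous[where h = "\<lambda>_. 0"])
          show "continuous_on UNIV (\<lambda>t. p (u + t) (v + t) (w + t) - k * q (u + t) (v + t) (w + t))"
            unfolding p q by (intro continuous_intros)
          fix t :: real assume "0 < t"
          have "l1 * (u + t) + l2 * (v + t) + l3 * (w + t) = L + S * t" by (simp add: L_def S_def algebra_simps)
          then have "l1 * (u + t) + l2 * (v + t) + l3 * (w + t) \<noteq> 0" using True \<open>0 < t\<close> l by (simp add: S_def)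
          then show "\<bar>p (u + t) (v + t) (w + t) - k * q (u + t) (v + t) (w + t)\<bar> \<le> t * 0" by (simp add: pos)
        qed simp
        then show ?thesis by simp
      qed
    qed
    then show ?thesis by blast
  qed
  moreover have "\<exists>u v w. q u v w \<noteq> 0" using extremal_cubicD(3)[OF ext] by (auto simp: f)
  ultimately show ?thesis using quad nonneg unfolding extremal_quadric_def by blast
qed

text \<open>
  The analogue of \<open>exists_double_point\<close> for the monomial \<open>u v\<close>.  As \<open>w\<close> does not divide \<open>u v\<close>, a touching point on
  \<open>w = 0\<close> is only critical for the restriction to this edge, which is then a square \<open>(a u - b v)^2\<close> with \<open>a, b \<ge> 0\<close>.
\<close>

lemma quadric_pair_alternative:
  fixes \<alpha> \<beta> \<gamma> r s t :: real
  defines "q \<equiv> \<lambda>u v w. \<alpha> * u^2 + \<beta> * v^2 + \<gamma> * w^2 + 2 * t * (u * v) + 2 * s * (u * w) + 2 * r * (v * w)"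
  assumes nonneg: "\<And>u v w. u \<ge> 0 \<Longrightarrow> v \<ge> 0 \<Longrightarrow> w \<ge> 0 \<Longrightarrow> 0 \<le> q u v w"
  obtains (dominates) C where "\<And>u v w. u \<ge> 0 \<Longrightarrow> v \<ge> 0 \<Longrightarrow> w \<ge> 0 \<Longrightarrow> u * v \<le> C * q u v w"
  | (singular) p1 p2 p3 where "p1 \<ge> 0" "p2 \<ge> 0" "p3 \<ge> 0" "p1 + p2 + p3 > 0"
      "\<alpha> * p1 + t * p2 + s * p3 = 0" "t * p1 + \<beta> * p2 + r * p3 = 0" "s * p1 + r * p2 + \<gamma> * p3 = 0"
  | (square) "t^2 = \<alpha> * \<beta>" "t \<le> 0"
proof -
  show ?thesis
  proof (cases "\<exists>C. \<forall>u\<ge>0. \<forall>v\<ge>0. \<forall>w\<ge>0. u * v \<le> C * q u v w")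
    case True
    then show ?thesis using dominates by blast
  next
    case False
    have q_hom: "q (x * u) (x * v) (x * w) = x^2 * q u v w" for x u v w
      by (simp add: q_def algebra_simps power2_eq_square)
    have product_hom: "(x * u) * (x * v) = x^2 * (u * v)" for x u v :: real by (simp add: power2_eq_square)
    obtain p1 p2 p3 where sum1: "p1 + p2 + p3 = 1" and p: "p1 \<ge> 0" "p2 \<ge> 0" "p3 \<ge> 0"
      and touch0: "\<forall>H K. continuous_on UNIV (\<lambda>(u, v, w). H u v w) \<longrightarrow>
      (\<forall>u v w. 0 \<le> u \<longrightarrow> 0 \<le> v \<longrightarrow> 0 \<le> w \<longrightarrow> u \<le> 1 \<longrightarrow> v \<le> 1 \<longrightarrow> w \<le> 1 \<longrightarrow>
        0 \<le> K u v w \<and> K u v w * H u v w \<le> q u v w \<and> u * v \<le> K u v w) \<longrightarrow> H p1 p2 p3 \<le> 0"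
      by (rule touching_point_on_triangle[OF q_hom product_hom zero_less_numeral False]) (rule that)
    note touch = touch0[rule_format]
    have zero: "q p1 p2 p3 \<le> 0"
    proof (rule touch[where K = "\<lambda>u v w. 1"])
      show "continuous_on UNIV (\<lambda>(u, v, w). q u v w)"
        unfolding q_def case_prod_unfold by (intro continuous_intros)
      show "0 \<le> (1::real) \<and> 1 * q u v w \<le> q u v w \<and> u * v \<le> 1"
        if "0 \<le> u" "0 \<le> v" "u \<le> 1" "v \<le> 1" for u v w
        using mult_mono[of u 1 v 1] that by simp
    qed
    have hu: "\<alpha> * p1 + 2 * t * p2 + 2 * s * p3 \<le> 0"
    proof (rule touch[where K = "\<lambda>u v w. u"])
      show "continuous_on UNIV (\<lambda>(u, v, w). \<alpha> * u + 2 * t * v + 2 * s * w)"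
        unfolding case_prod_unfold by (intro continuous_intros)
      fix u v w :: real assume b: "0 \<le> u" "0 \<le> v" "0 \<le> w" "v \<le> 1"
      have "u * (\<alpha> * u + 2 * t * v + 2 * s * w) = q u v w - q 0 v w"
        by (simp add: q_def algebra_simps power2_eq_square)
      then show "0 \<le> u \<and> u * (\<alpha> * u + 2 * t * v + 2 * s * w) \<le> q u v w \<and> u * v \<le> u"
        using nonneg[of 0 v w] b by (simp add: mult_left_le)
    qed
    have hv: "\<beta> * p2 + 2 * t * p1 + 2 * r * p3 \<le> 0"
    proof (rule touch[where K = "\<lambda>u v w. v"])
      show "continuous_on UNIV (\<lambda>(u, v, w). \<beta> * v + 2 * t * u + 2 * r * w)"
        unfolding case_prod_unfold by (intro continuous_intros)
      fix u v w :: real assume b: "0 \<le> u" "0 \<le> v" "0 \<le> w" "u \<le> 1"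
      have "v * (\<beta> * v + 2 * t * u + 2 * r * w) = q u v w - q u 0 w"
        by (simp add: q_def algebra_simps power2_eq_square)
      then show "0 \<le> v \<and> v * (\<beta> * v + 2 * t * u + 2 * r * w) \<le> q u v w \<and> u * v \<le> v"
        using nonneg[of u 0 w] b by (simp add: mult_left_le_one_le)
    qed
    have "(2 * t * p2 + 2 * s * p3) + 2 * \<alpha> * p1 + 3 * 0 * p1^2 = 0"
    proof (rule cubic_at_minimum(2))
      show "0 \<le> q 0 p2 p3 + (2 * t * p2 + 2 * s * p3) * x + \<alpha> * x^2 + 0 * x^3" if "x \<ge> 0" for x
        using nonneg[of x p2 p3] that p by (simp add: q_def algebra_simps)
      show "q 0 p2 p3 + (2 * t * p2 + 2 * s * p3) * p1 + \<alpha> * p1^2 + 0 * p1^3 \<le> 0"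
        using zero by (simp add: q_def algebra_simps)
      show "2 * t * p2 + 2 * s * p3 \<le> 0" if "p1 = 0" using hu that by simp
    qed (rule p)
    then have du: "\<alpha> * p1 + t * p2 + s * p3 = 0" by simp
    have "(2 * t * p1 + 2 * r * p3) + 2 * \<beta> * p2 + 3 * 0 * p2^2 = 0"
    proof (rule cubic_at_minimum(2))
      show "0 \<le> q p1 0 p3 + (2 * t * p1 + 2 * r * p3) * x + \<beta> * x^2 + 0 * x^3" if "x \<ge> 0" for x
        using nonneg[of p1 x p3] that p by (simp add: q_def algebra_simps)
      show "q p1 0 p3 + (2 * t * p1 + 2 * r * p3) * p2 + \<beta> * p2^2 + 0 * p2^3 \<le> 0"
        using zero by (simp add: q_def algebra_simps)
      show "2 * t * p1 + 2 * r * p3 \<le> 0" if "p2 = 0" using hv that by simp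
    qed (rule p)
    then have dv: "t * p1 + \<beta> * p2 + r * p3 = 0" by simp
    show ?thesis
    proof (cases "p3 = 0")
      case False
      have "(2 * s * p1 + 2 * r * p2) + 2 * \<gamma> * p3 + 3 * 0 * p3^2 = 0"
      proof (rule cubic_at_minimum(2))
        show "0 \<le> q p1 p2 0 + (2 * s * p1 + 2 * r * p2) * x + \<gamma> * x^2 + 0 * x^3" if "x \<ge> 0" for x
          using nonneg[of p1 p2 x] that p by (simp add: q_def algebra_simps)
        show "q p1 p2 0 + (2 * s * p1 + 2 * r * p2) * p3 + \<gamma> * p3^2 + 0 * p3^3 \<le> 0"
          using zero by (simp add: q_def algebra_simps)
      qed (use p False in auto)
      then have "s * p1 + r * p2 + \<gamma> * p3 = 0" by simp
      then show ?thesis using singular[OF p _ du dv] sum1 by simp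
    next
      case True
      have ab: "\<alpha> \<ge> 0" "\<beta> \<ge> 0" using nonneg[of 1 0 0] nonneg[of 0 1 0] by (simp_all add: q_def)
      have 1: "\<alpha> * p1 = - t * p2" and 2: "\<beta> * p2 = - t * p1" using du dv True by simp_all
      have "t^2 = \<alpha> * \<beta> \<and> t \<le> 0"
      proof (cases "p1 = 0 \<or> p2 = 0")
        case True
        then show ?thesis using 1 2 p sum1 \<open>p3 = 0\<close> by auto
      next
        case False
        then have pp: "p1 > 0" "p2 > 0" using p by auto
        have "t * p2 \<le> 0" using 1 ab pp mult_nonneg_nonneg[of \<alpha> p1] by simp
        then have "t \<le> 0" using pp by (simp add: mult_le_0_iff)
        have "(\<alpha> * p1) * (\<beta> * p2) = t^2 * (p1 * p2)" unfolding 1 2 by (simp add: power2_eq_square)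
        then have "(p1 * p2) * (\<alpha> * \<beta>) = (p1 * p2) * t^2" by (simp only: mult_ac)
        then show ?thesis using \<open>t \<le> 0\<close> pp by auto
      qed
      then show ?thesis using square by blast
    qed
  qed
qed

lemma quadric_invariant_along_singular:
  fixes q :: real_fun3
  assumes q: "\<And>u v w. q u v w = \<alpha> * u^2 + \<beta> * v^2 + \<gamma> * w^2 + 2 * t * (u * v) + 2 * s * (u * w) + 2 * r * (v * w)"
    and d: "\<alpha> * p1 + t * p2 + s * p3 = 0" "t * p1 + \<beta> * p2 + r * p3 = 0" "s * p1 + r * p2 + \<gamma> * p3 = 0"
  shows "q (u + x * p1) (v + x * p2) (w + x * p3) = q u v w"
proof -
  have "q (u + x * p1) (v + x * p2) (w + x * p3) = q u v w + (2 * x * u + x^2 * p1) * (\<alpha> * p1 + t * p2 + s * p3)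
    + (2 * x * v + x^2 * p2) * (t * p1 + \<beta> * p2 + r * p3) + (2 * x * w + x^2 * p3) * (s * p1 + r * p2 + \<gamma> * p3)"
    unfolding q by (simp add: algebra_simps power2_eq_square)
  then show ?thesis unfolding d by simp
qed

text \<open>
  If none of \<open>u v\<close>, \<open>u w\<close>, \<open>v w\<close> is dominated and no singular point exists, then all three edges carry squares, and
  \<open>q = a^2 u^2 + b^2 v^2 + c^2 w^2 - 2 a b u v - 2 a c u w - 2 b c v w\<close>.  This is negative at \<open>(b c, c a, a b)\<close> unless one of \<open>a, b, c\<close>
  is zero, and then \<open>q\<close> is singular after all.  A form that is singular at \<open>(0, 0, 1)\<close> depends on \<open>u\<close> and \<open>v\<close> only, and is
  a multiple of \<open>u v\<close> or a square, so that another singular point can be chosen.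
\<close>

lemma extremal_quadric_alternatives:
  assumes ext: "extremal_quadric q"
  obtains (uv) \<kappa> where "\<And>u v w. q u v w = \<kappa> * (u * v)"
  | (uw) \<kappa> where "\<And>u v w. q u v w = \<kappa> * (u * w)"
  | (vw) \<kappa> where "\<And>u v w. q u v w = \<kappa> * (v * w)"
  | (singular) p1 p2 p3 where "p1 \<ge> 0" "p2 \<ge> 0" "p3 \<ge> 0" "p1 + p2 > 0"
      "\<And>x u v w. q (u + x * p1) (v + x * p2) (w + x * p3) = q u v w"
proof -
  obtain \<alpha> \<beta> \<gamma> d e g where q0: "\<And>u v w. q u v w =
     \<alpha> * u^2 + \<beta> * v^2 + \<gamma> * w^2 + d * u * v + e * u * w + g * v * w"
    using extremal_quadricD(1)[OF ext] unfolding quadric_def by blast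
  define t s r where "t = d / 2" and "s = e / 2" and "r = g / 2"
  have q: "q u v w = \<alpha> * u^2 + \<beta> * v^2 + \<gamma> * w^2 + 2 * t * (u * v) + 2 * s * (u * w) + 2 * r * (v * w)" for u v w
    by (simp add: q0 t_def s_def r_def)
  note nonneg = extremal_quadricD(2)[OF ext]
  obtain u0 v0 w0 where nz: "q u0 v0 w0 \<noteq> 0" using extremal_quadricD(3)[OF ext] by blast
  have abc: "\<alpha> \<ge> 0" "\<beta> \<ge> 0" "\<gamma> \<ge> 0"
    using nonneg[of 1 0 0] nonneg[of 0 1 0] nonneg[of 0 0 1] by (simp_all add: q)
  note invariant = quadric_invariant_along_singular[of q, OF q]
  have proportional: "\<exists>\<kappa>. \<forall>u v w. q u v w = \<kappa> * m u v w"
    if m: "quadric m" "m 1 1 1 = 1" "\<And>u v w. u \<ge> 0 \<Longrightarrow> v \<ge> 0 \<Longrightarrow> w \<ge> 0 \<Longrightarrow> 0 \<le> m u v w"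
      and le: "\<And>u v w. u \<ge> 0 \<Longrightarrow> v \<ge> 0 \<Longrightarrow> w \<ge> 0 \<Longrightarrow> m u v w \<le> C * q u v w" for m C
  proof -
    have "0 \<le> m u v w \<and> m u v w \<le> C * q u v w" if "u \<ge> 0" "v \<ge> 0" "w \<ge> 0" for u v w
      using m(3) le that by simp
    from extremal_quadric_dominated[OF ext m(1) this] obtain a where a: "\<And>u v w. m u v w = a * q u v w" by blast
    from a[of 1 1 1] m(2) have "a \<noteq> 0" by auto
    then have "q u v w = 1 / a * m u v w" for u v w using a[of u v w] by simp
    then show ?thesis by blast
  qed
  have m_uv: "quadric (\<lambda>u v w. u * v)" by (rule quadricI[of _ 0 0 0 1 0 0]) simp
  have m_uw: "quadric (\<lambda>u v w. u * w)" by (rule quadricI[of _ 0 0 0 0 1 0]) simp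
  have m_vw: "quadric (\<lambda>u v w. v * w)" by (rule quadricI[of _ 0 0 0 0 0 1]) simp
  have dom_uv: thesis if "\<And>u v w. u \<ge> 0 \<Longrightarrow> v \<ge> 0 \<Longrightarrow> w \<ge> 0 \<Longrightarrow> u * v \<le> C * q u v w" for C
    using proportional[OF m_uv _ _ that] uv by auto
  have dom_uw: thesis if "\<And>u v w. u \<ge> 0 \<Longrightarrow> v \<ge> 0 \<Longrightarrow> w \<ge> 0 \<Longrightarrow> u * w \<le> C * q u v w" for C
    using proportional[OF m_uw _ _ that] uw by auto
  have dom_vw: thesis if "\<And>u v w. u \<ge> 0 \<Longrightarrow> v \<ge> 0 \<Longrightarrow> w \<ge> 0 \<Longrightarrow> v * w \<le> C * q u v w" for C
    using proportional[OF m_vw _ _ that] vw by auto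
  have sing: thesis if p: "p1 \<ge> 0" "p2 \<ge> 0" "p3 \<ge> 0" "p1 + p2 + p3 > 0"
    and g: "\<alpha> * p1 + t * p2 + s * p3 = 0" "t * p1 + \<beta> * p2 + r * p3 = 0" "s * p1 + r * p2 + \<gamma> * p3 = 0" for p1 p2 p3
  proof (cases "p1 + p2 > 0")
    case True
    then show ?thesis using singular[OF p(1-3) _ invariant[OF g]] by blast
  next
    case False
    then have "p1 = 0" "p2 = 0" "p3 > 0" using p by auto
    then have c: "s = 0" "r = 0" "\<gamma> = 0" using g by auto
    have qb: "q u v w = \<alpha> * u^2 + \<beta> * v^2 + 2 * t * (u * v)" for u v w by (simp add: q c)
    define a b where "a = sqrt \<alpha>" and "b = sqrt \<beta>"
    have ab: "a \<ge> 0" "b \<ge> 0" "\<alpha> = a^2" "\<beta> = b^2" using abc by (simp_all add: a_def b_def)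
    \<comment> \<open>What remains of \<open>q\<close> after splitting off a square is a multiple of \<open>u v\<close>.\<close>
    have low: "2 * (a * b + t) * (u * v) \<le> q u v w" for u v w
    proof -
      have "q u v w = (a * u - b * v)^2 + 2 * (a * b + t) * (u * v)"
        by (simp add: qb ab algebra_simps power2_eq_square)
      then show ?thesis by simp
    qed
    show ?thesis
    proof (cases "a * b + t > 0")
      case True
      have "u * v \<le> 1 / (2 * (a * b + t)) * q u v w" for u v w
        using low[of u v w] True by (simp add: field_simps)
      then show ?thesis by (rule dom_uv)
    next
      case False
      have "a * b + t = 0"
      proof (cases "a * b = 0")
        case True
        have "0 \<le> t"
        proof (cases "a = 0")
          case True
          have "0 \<le> \<beta> + x * (2 * t)" if "x \<ge> 0" for x
            using nonneg[of x 1 0] that True by (simp add: qb ab algebra_simps)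
          from nonneg_linear[OF this] show ?thesis by simp
        next
          case False
          then have "b = 0" using \<open>a * b = 0\<close> by simp
          have "0 \<le> \<alpha> + x * (2 * t)" if "x \<ge> 0" for x
            using nonneg[of 1 x 0] that \<open>b = 0\<close> by (simp add: qb ab algebra_simps)
          from nonneg_linear[OF this] show ?thesis by simp
        qed
        then show ?thesis using \<open>a * b = 0\<close> \<open>\<not> a * b + t > 0\<close> by linarith
      next
        case ne: False
        have "0 \<le> 2 * (a * b) * (a * b + t)"
          using nonneg[of b a 0] ab by (simp add: qb algebra_simps power2_eq_square)
        moreover have "a * b > 0" using ne ab by (simp add: less_le)
        ultimately show ?thesis using False by (simp add: zero_le_mult_iff)
      qed
      then have t: "t = - (a * b)" by simp
      have "a + b > 0"
      proof (rule ccontr)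
        assume "\<not> a + b > 0"
        then have "a = 0" "b = 0" using ab by auto
        then have "q u v w = 0" for u v w by (simp add: qb ab t)
        then show False using nz by simp
      qed
      then show ?thesis
        by (intro singular[of b a 0] invariant) (use ab in \<open>auto simp: t c power2_eq_square\<close>)
    qed
  qed
  show thesis
  proof (rule quadric_pair_alternative[of \<alpha> \<beta> \<gamma> t s r])
    show "0 \<le> \<alpha> * u^2 + \<beta> * v^2 + \<gamma> * w^2 + 2 * t * (u * v) + 2 * s * (u * w) + 2 * r * (v * w)"
      if "u \<ge> 0" "v \<ge> 0" "w \<ge> 0" for u v w using nonneg[OF that] by (simp add: q)
    show thesis if "\<And>u v w. u \<ge> 0 \<Longrightarrow> v \<ge> 0 \<Longrightarrow> w \<ge> 0 \<Longrightarrow>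
        u * v \<le> C * (\<alpha> * u^2 + \<beta> * v^2 + \<gamma> * w^2 + 2 * t * (u * v) + 2 * s * (u * w) + 2 * r * (v * w))" for C
      by (rule dom_uv[of C]) (use that q in simp)
    show thesis if t: "t^2 = \<alpha> * \<beta>" "t \<le> 0"
    proof (rule quadric_pair_alternative[of \<alpha> \<gamma> \<beta> s t r])
      show "0 \<le> \<alpha> * u^2 + \<gamma> * v^2 + \<beta> * w^2 + 2 * s * (u * v) + 2 * t * (u * w) + 2 * r * (v * w)"
        if "u \<ge> 0" "v \<ge> 0" "w \<ge> 0" for u v w using nonneg[of u w v] that by (simp add: q algebra_simps)
      show thesis if le: "\<And>u v w. u \<ge> 0 \<Longrightarrow> v \<ge> 0 \<Longrightarrow> w \<ge> 0 \<Longrightarrow>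
          u * v \<le> C * (\<alpha> * u^2 + \<gamma> * v^2 + \<beta> * w^2 + 2 * s * (u * v) + 2 * t * (u * w) + 2 * r * (v * w))" for C
      proof (rule dom_uw[of C])
        show "u * w \<le> C * q u v w" if "u \<ge> 0" "v \<ge> 0" "w \<ge> 0" for u v w
          using le[of u w v] that
          by (simp add: q algebra_simps)
      qed
      show thesis if s: "s^2 = \<alpha> * \<gamma>" "s \<le> 0"
      proof (rule quadric_pair_alternative[of \<beta> \<gamma> \<alpha> r t s])
        show "0 \<le> \<beta> * u^2 + \<gamma> * v^2 + \<alpha> * w^2 + 2 * r * (u * v) + 2 * t * (u * w) + 2 * s * (v * w)"
          if "u \<ge> 0" "v \<ge> 0" "w \<ge> 0" for u v w using nonneg[of w u v] that by (simp add: q algebra_simps)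
        show thesis if le: "\<And>u v w. u \<ge> 0 \<Longrightarrow> v \<ge> 0 \<Longrightarrow> w \<ge> 0 \<Longrightarrow>
            u * v \<le> C * (\<beta> * u^2 + \<gamma> * v^2 + \<alpha> * w^2 + 2 * r * (u * v) + 2 * t * (u * w) + 2 * s * (v * w))" for C
        proof (rule dom_vw[of C])
          show "v * w \<le> C * q u v w" if "u \<ge> 0" "v \<ge> 0" "w \<ge> 0" for u v w
            using le[of v w u] that
            by (simp add: q algebra_simps)
        qed
        show thesis if r: "r^2 = \<beta> * \<gamma>" "r \<le> 0"
        proof -
          define a b c where "a = sqrt \<alpha>" and "b = sqrt \<beta>" and "c = sqrt \<gamma>"
          have abc': "a \<ge> 0" "b \<ge> 0" "c \<ge> 0" "\<alpha> = a^2" "\<beta> = b^2" "\<gamma> = c^2"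
            using abc by (simp_all add: a_def b_def c_def)
          have root: "x = - y" if "x^2 = y^2" "x \<le> 0" "y \<ge> 0" for x y :: real
            using that by (auto simp: power2_eq_iff)
          have tsr: "t = - (a * b)" "s = - (a * c)" "r = - (b * c)"
            using t s r abc' by (auto intro!: root simp: power_mult_distrib)
          have "q (b * c) (c * a) (a * b) = - (3 * (a * b * c)^2)"
            by (simp add: q tsr abc' algebra_simps power2_eq_square)
          moreover have "0 \<le> q (b * c) (c * a) (a * b)" using abc' by (intro nonneg) auto
          ultimately have "a * b * c = 0" by simp
          then consider "c = 0" | "a = 0" | "b = 0" by auto
          then show thesis
          proof cases
            case 1
            have "a + b > 0"
            proof (rule ccontr)
              assume "\<not> a + b > 0"
              then have "a = 0" "b = 0" using abc' by auto
              then have "q u v w = 0" for u v w by (simp add: q tsr abc' 1)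
              then show False using nz by simp
            qed
            then show thesis
              by (intro sing[of b a 0]) (use abc' in \<open>auto simp: tsr 1 power2_eq_square\<close>)
          next
            case 2
            then show thesis by (intro sing[of 1 0 0]) (auto simp: tsr abc')
          next
            case 3
            then show thesis by (intro sing[of 0 1 0]) (auto simp: tsr abc')
          qed
        qed
        show thesis if "p1 \<ge> 0" "p2 \<ge> 0" "p3 \<ge> 0" "p1 + p2 + p3 > 0" "\<beta> * p1 + r * p2 + t * p3 = 0"
          "r * p1 + \<gamma> * p2 + s * p3 = 0" "t * p1 + s * p2 + \<alpha> * p3 = 0" for p1 p2 p3
          by (rule sing[of p3 p1 p2]) (use that in auto)
      qed
      show thesis if "p1 \<ge> 0" "p2 \<ge> 0" "p3 \<ge> 0" "p1 + p2 + p3 > 0" "\<alpha> * p1 + s * p2 + t * p3 = 0"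
        "s * p1 + \<gamma> * p2 + r * p3 = 0" "t * p1 + r * p2 + \<beta> * p3 = 0" for p1 p2 p3
        by (rule sing[of p1 p3 p2]) (use that in auto)
    qed
    show thesis if "p1 \<ge> 0" "p2 \<ge> 0" "p3 \<ge> 0" "p1 + p2 + p3 > 0" "\<alpha> * p1 + t * p2 + s * p3 = 0"
      "t * p1 + \<beta> * p2 + r * p3 = 0" "s * p1 + r * p2 + \<gamma> * p3 = 0" for p1 p2 p3
      by (rule sing[OF that])
  qed
qed

text \<open>
  At a singular point \<open>p\<close> with \<open>p1 + p2 > 0\<close> the quadratic form is of order \<open>x^4\<close> along \<open>p + x^2 y\<close>, whereas \<open>sqrt (u v)\<close> is
  at least of order \<open>x\<close>.  Hence the linear form vanishes at \<open>p\<close> and in all directions \<open>y\<close>.  For the monomials one compares orders at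
  the coordinate planes.
\<close>

lemma linear_below_extremal_quadric:
  assumes ext: "extremal_quadric q"
    and le: "\<And>x y w. x \<ge> 0 \<Longrightarrow> y \<ge> 0 \<Longrightarrow> w \<ge> 0 \<Longrightarrow>
      x * y * \<bar>a1 * x^2 + a2 * y^2 + a3 * w\<bar> \<le> q (x^2) (y^2) w"
  shows "a1 = 0 \<and> a2 = 0 \<and> a3 = 0"
  using ext
proof (cases rule: extremal_quadric_alternatives)
  case (uv \<kappa>)
  have x: "a2 * y^2 + a3 * w = 0" if "y > 0" "w \<ge> 0" for y w
  proof -
    have "a1 * 0^2 + a2 * y^2 + a3 * w = 0"
    proof (rule small_order_continuous[where h = "\<lambda>_. \<kappa> * y"])
      fix x :: real assume x: "0 < x"
      have "(x * y) * \<bar>a1 * x^2 + a2 * y^2 + a3 * w\<bar> \<le> (x * y) * (x * (\<kappa> * y))"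
        using le[of x y w] x that by (simp add: uv power2_eq_square mult_ac)
      then show "\<bar>a1 * x^2 + a2 * y^2 + a3 * w\<bar> \<le> x * (\<kappa> * y)" using x that by simp
    qed (intro continuous_intros)+
    then show ?thesis by simp
  qed
  have y: "a1 = 0"
  proof -
    have "a1 * 1^2 + a2 * 0^2 = 0"
    proof (rule small_order_continuous[where h = "\<lambda>_. \<kappa>"])
      fix y :: real assume y: "0 < y"
      have "y * \<bar>a1 * 1^2 + a2 * y^2\<bar> \<le> y * (y * \<kappa>)"
        using le[of 1 y 0] y by (simp add: uv power2_eq_square mult_ac)
      then show "\<bar>a1 * 1^2 + a2 * y^2\<bar> \<le> y * \<kappa>" using y by simp
    qed (intro continuous_intros)+
    then show ?thesis by simp
  qed
  show ?thesis using x[of 1 0] x[of 1 1] y by simp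
next
  case (uw \<kappa>)
  have x: "a2 + a3 * w = 0" if "w \<ge> 0" for w
  proof -
    have "a1 * 0^2 + a2 * 1^2 + a3 * w = 0"
    proof (rule small_order_continuous[where h = "\<lambda>_. \<kappa> * w"])
      fix x :: real assume x: "0 < x"
      have "x * \<bar>a1 * x^2 + a2 * 1^2 + a3 * w\<bar> \<le> x * (x * (\<kappa> * w))"
        using le[of x 1 w] x that by (simp add: uw power2_eq_square mult_ac)
      then show "\<bar>a1 * x^2 + a2 * 1^2 + a3 * w\<bar> \<le> x * (\<kappa> * w)" using x by simp
    qed (intro continuous_intros)+
    then show ?thesis by simp
  qed
  show ?thesis using x[of 0] x[of 1] le[of 1 1 0] by (simp add: uw)
next
  case (vw \<kappa>)
  have x: "a1 + a3 * w = 0" if "w \<ge> 0" for w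
  proof -
    have "a1 * 1^2 + a2 * 0^2 + a3 * w = 0"
    proof (rule small_order_continuous[where h = "\<lambda>_. \<kappa> * w"])
      fix y :: real assume y: "0 < y"
      have "y * \<bar>a1 * 1^2 + a2 * y^2 + a3 * w\<bar> \<le> y * (y * (\<kappa> * w))"
        using le[of 1 y w] y that by (simp add: vw power2_eq_square mult_ac)
      then show "\<bar>a1 * 1^2 + a2 * y^2 + a3 * w\<bar> \<le> y * (\<kappa> * w)" using y by simp
    qed (intro continuous_intros)+
    then show ?thesis by simp
  qed
  show ?thesis using x[of 0] x[of 1] le[of 1 1 0] by (simp add: vw)
next
  case (singular p1 p2 p3)
  have sq: "sqrt u * sqrt v * \<bar>a1 * u + a2 * v + a3 * w\<bar> \<le> q u v w" if "u \<ge> 0" "v \<ge> 0" "w \<ge> 0" for u v w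
    using le[of "sqrt u" "sqrt v" w] that by simp
  have z: "a1 * y1 + a2 * y2 + a3 * y3 = 0" if y: "y1 > 0" "y2 > 0" "y3 \<ge> 0" for y1 y2 y3
  proof -
    \<comment> \<open>A lower bound for \<open>sqrt (u v) / x\<close> along \<open>p + x^2 y\<close>.\<close>
    define \<rho> where "\<rho> = (if p1 > 0 then sqrt p1 * sqrt y2 else sqrt y1 * sqrt p2)"
    have \<rho>: "\<rho> > 0" using singular(1-4) y by (auto simp: \<rho>_def)
    have "\<rho> * (a1 * p1 + a2 * p2 + a3 * p3) = 0 \<and> \<rho> * (a1 * y1 + a2 * y2 + a3 * y3) = 0"
    proof (rule small_order_3)
      fix x :: real assume x: "0 < x" "x \<le> 1"
      let ?u = "x^2 * y1 + 1 * p1" and ?v = "x^2 * y2 + 1 * p2" and ?w = "x^2 * y3 + 1 * p3"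
      have nn: "?u \<ge> 0" "?v \<ge> 0" "?w \<ge> 0" using singular(1-4) y by auto
      have root: "x * \<rho> \<le> sqrt ?u * sqrt ?v"
      proof (cases "p1 > 0")
        case True
        have "x * sqrt y2 = sqrt (x^2 * y2)" using x by (simp add: real_sqrt_mult)
        also have "\<dots> \<le> sqrt ?v" using singular(2) by simp
        finally have "sqrt p1 * (x * sqrt y2) \<le> sqrt ?u * sqrt ?v"
          using True x y by (intro mult_mono) auto
        then show ?thesis using True by (simp add: \<rho>_def mult_ac)
      next
        case False
        have "x * sqrt y1 = sqrt (x^2 * y1)" using x by (simp add: real_sqrt_mult)
        also have "\<dots> \<le> sqrt ?u" using singular(1) by simp
        finally have "(x * sqrt y1) * sqrt p2 \<le> sqrt ?u * sqrt ?v"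
          using singular(1,2) x y by (intro mult_mono) auto
        then show ?thesis using False by (simp add: \<rho>_def mult_ac)
      qed
      let ?a = "a1 * ?u + a2 * ?v + a3 * ?w"
      have "x * (\<rho> * \<bar>?a\<bar>) \<le> sqrt ?u * sqrt ?v * \<bar>?a\<bar>"
        using mult_right_mono[OF root, of "\<bar>?a\<bar>"] by (simp add: mult_ac)
      also have "\<dots> \<le> q ?u ?v ?w" by (rule sq[OF nn])
      also have "\<dots> = q (x^2 * y1) (x^2 * y2) (x^2 * y3)" by (rule singular(5))
      also have "\<dots> = x * (q y1 y2 y3 * x^3)"
        unfolding quadric_homogeneous[OF extremal_quadricD(1)[OF ext]] by (simp add: eval_nat_numeral)
      finally have "\<rho> * \<bar>?a\<bar> \<le> q y1 y2 y3 * x^3" using x by simp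
      moreover have "\<rho> * (a1 * p1 + a2 * p2 + a3 * p3) + \<rho> * (a1 * y1 + a2 * y2 + a3 * y3) * x^2 + 0 * x^4 = \<rho> * ?a"
        by (simp add: algebra_simps)
      ultimately show "\<bar>\<rho> * (a1 * p1 + a2 * p2 + a3 * p3) + \<rho> * (a1 * y1 + a2 * y2 + a3 * y3) * x^2 + 0 * x^4\<bar> \<le> q y1 y2 y3 * x^3"
        using \<rho> by (simp add: abs_mult)
    qed
    then show ?thesis using \<rho> by simp
  qed
  from z[of 1 1 0] z[of 2 1 0] z[of 1 1 1] show ?thesis by simp
qed

text \<open>
  On \<open>u = 0\<close> the form \<open>A\<close> vanishes, so \<open>u\<close> cancels from \<open>f\<close> and \<open>A\<close>, which leaves a linear form below an extremal quadratic
  form.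
\<close>

lemma dominated_if_u_divides:
  assumes ext: "extremal_cubic f" and f0: "\<And>v w. f 0 v w = 0" and dom: "dominates f A"
  shows "A u v w = 0"
proof -
  obtain a b c d e g h i j k where f: "\<And>u v w. f u v w =
     a * u^3 + b * v^3 + c * w^3 + d * u^2 * v + e * u^2 * w + g * u * v^2
     + h * v^2 * w + i * u * w^2 + j * v * w^2 + k * u * v * w"
    using extremal_cubicD(1)[OF ext] unfolding cubic_def by blast
  have z: "b = 0" "c = 0" "h = 0" "j = 0"
    using f0[of 1 0] f0[of 0 1] f0[of 1 1] f0[of 1 "-1"] by (simp_all add: f)
  define q where "q = (\<lambda>u v w. a * u^2 + g * v^2 + i * w^2 + d * u * v + e * u * w + k * v * w)"
  have quad: "quadric q" unfolding q_def by (rule quadricI) simp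
  have fq: "f u v w = (1 * u + 0 * v + 0 * w) * q u v w" for u v w
    by (simp add: f z q_def algebra_simps power2_eq_square power3_eq_cube)
  have extq: "extremal_quadric q" by (rule extremal_quotient[OF ext fq _ _ _ _ quad]) auto
  obtain a' b' c' d' e' g' where A: "\<And>u v w. A u v w =
     a' * u^2 + b' * v^2 + c' * w^2 + d' * u * v + e' * u * w + g' * v * w"
    using dominates_quadric[OF dom] unfolding quadric_def by blast
  have A0: "A 0 v w = 0" if "v > 0" "w \<ge> 0" for v w
    by (rule dominated_zero_on_u_edge[OF extremal_cubicD(1)[OF ext] dom f0 that])
  have z': "b' = 0" "c' = 0" "g' = 0"
    using A0[of 1 0] A0[of 1 1] A0[of 1 2] by (simp_all add: A)
  have "a' = 0 \<and> d' = 0 \<and> e' = 0"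
  proof (rule linear_below_extremal_quadric[OF extq])
    fix x y w :: real assume nn: "x \<ge> 0" "y \<ge> 0" "w \<ge> 0"
    show "x * y * \<bar>a' * x^2 + d' * y^2 + e' * w\<bar> \<le> q (x^2) (y^2) w"
    proof (cases "x = 0")
      case True
      then show ?thesis using extremal_quadricD(2)[OF extq, of 0 "y^2" w] nn by simp
    next
      case False
      have "A (x^2) (y^2) w = x^2 * (a' * x^2 + d' * y^2 + e' * w)"
        by (simp add: A z' algebra_simps power2_eq_square)
      then have "x^2 * (x * y * \<bar>a' * x^2 + d' * y^2 + e' * w\<bar>) \<le> x^2 * q (x^2) (y^2) w"
        using dominatesD[OF dom nn] by (simp add: fq abs_mult mult_ac)
      then show ?thesis using False by simp
    qed
  qed
  then show ?thesis by (simp add: A z')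
qed

lemma dominated_if_w_divides:
  assumes ext: "extremal_cubic f" and f0: "\<And>u v. f u v 0 = 0" and dom: "dominates f A"
  shows "A u v w = 0"
proof -
  obtain a b c d e g h i j k where f: "\<And>u v w. f u v w =
     a * u^3 + b * v^3 + c * w^3 + d * u^2 * v + e * u^2 * w + g * u * v^2
     + h * v^2 * w + i * u * w^2 + j * v * w^2 + k * u * v * w"
    using extremal_cubicD(1)[OF ext] unfolding cubic_def by blast
  have z: "a = 0" "b = 0" "d = 0" "g = 0"
    using f0[of 1 0] f0[of 0 1] f0[of 1 1] f0[of 1 "-1"] by (simp_all add: f)
  define q where "q = (\<lambda>u v w. e * u^2 + h * v^2 + c * w^2 + k * u * v + i * u * w + j * v * w)"
  have quad: "quadric q" unfolding q_def by (rule quadricI) simp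
  have fq: "f u v w = (0 * u + 0 * v + 1 * w) * q u v w" for u v w
    by (simp add: f z q_def algebra_simps power2_eq_square power3_eq_cube)
  have extq: "extremal_quadric q" by (rule extremal_quotient[OF ext fq _ _ _ _ quad]) auto
  obtain a' b' c' d' e' g' where A: "\<And>u v w. A u v w =
     a' * u^2 + b' * v^2 + c' * w^2 + d' * u * v + e' * u * w + g' * v * w"
    using dominates_quadric[OF dom] unfolding quadric_def by blast
  have A0: "A u v 0 = 0" if "u > 0" "v > 0" for u v
    using dominates_sqrt[OF dom, of u v 0] that by (simp add: f0 mult_le_0_iff)
  have z': "a' = 0" "b' = 0" "d' = 0"
    using A0[of 1 1] A0[of 1 2] A0[of 2 1] by (simp_all add: A)
  have "e' = 0 \<and> g' = 0 \<and> c' = 0"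
  proof (rule linear_below_extremal_quadric[OF extq])
    fix x y w :: real assume nn: "x \<ge> 0" "y \<ge> 0" "w \<ge> 0"
    have "0 \<le> q (x^2) (y^2) (w + 0) - x * y * \<bar>e' * x^2 + g' * y^2 + c' * (w + 0)\<bar>"
    proof (rule nonneg_at_limit)
      show "continuous_on UNIV (\<lambda>t. q (x^2) (y^2) (w + t) - x * y * \<bar>e' * x^2 + g' * y^2 + c' * (w + t)\<bar>)"
        unfolding q_def by (intro continuous_intros)
      fix t :: real assume t: "0 < t"
      have "A (x^2) (y^2) (w + t) = (w + t) * (e' * x^2 + g' * y^2 + c' * (w + t))"
        by (simp add: A z' algebra_simps power2_eq_square)
      then have "(w + t) * (x * y * \<bar>e' * x^2 + g' * y^2 + c' * (w + t)\<bar>) \<le> (w + t) * q (x^2) (y^2) (w + t)"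
        using dominatesD[OF dom nn(1,2), of "w + t"] nn t by (simp add: fq abs_mult mult_ac)
      then show "0 \<le> q (x^2) (y^2) (w + t) - x * y * \<bar>e' * x^2 + g' * y^2 + c' * (w + t)\<bar>"
        using t nn by (simp add: mult_le_cancel_left)
    qed
    then show "x * y * \<bar>e' * x^2 + g' * y^2 + c' * w\<bar> \<le> q (x^2) (y^2) w" by simp
  qed
  then show ?thesis by (simp add: A z')
qed

section \<open>The dominated quadratic form vanishes\<close>

lemma dominated_if_divisible:
  assumes ext: "extremal_cubic f" and div: "divisible_by_variable f" and dom: "dominates f A"
  shows "A u v w = 0"
proof -
  consider "\<forall>v w. f 0 v w = 0" | "\<forall>u w. f u 0 w = 0" | "\<forall>u v. f u v 0 = 0"
    using div unfolding divisible_by_variable_def by blast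
  then show ?thesis
  proof cases
    case 1
    then show ?thesis using dominated_if_u_divides[OF ext _ dom] by simp
  next
    case 2
    then show ?thesis
      using dominated_if_u_divides[OF extremal_cubic_swap12[OF ext] _ dominates_swap12[OF dom], of u v w] by simp
  next
    case 3
    then show ?thesis using dominated_if_w_divides[OF ext _ dom] by simp
  qed
qed

lemma dominated_at_normalised_double_point:
  assumes ext: "extremal_cubic f" and ndiv: "\<not> divisible_by_variable f" and dom: "dominates f A"
    and dp: "double_point f e1 e2 e3 Q"
    and e: "e1 = 0 \<or> e1 = 1" "e2 = 0 \<or> e2 = 1" "e3 = 0 \<or> e3 = 1" "e1 + e2 + e3 > 0"
  shows "A u v w = 0"
proof -
  have quad: "quadric Q" and sh: "\<And>s u v w. f (u + s * e1) (v + s * e2) (w + s * e3) = f u v w + s * Q u v w"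
    using dp unfolding double_point_def by auto
  have ext13: "extremal_cubic (\<lambda>u v w. f w v u)"
    using extremal_cubic_swap12[OF extremal_cubic_swap23[OF extremal_cubic_swap12[OF ext]]] .
  have ndiv13: "\<not> divisible_by_variable (\<lambda>u v w. f w v u)"
    using ndiv divisible_swap12[of f] divisible_swap23[of "\<lambda>u v w. f v u w"]
      divisible_swap12[of "\<lambda>u v w. f w u v"] by simp
  have quad13: "quadric (\<lambda>u v w. Q w v u)"
    using quadric_swap12[OF quadric_swap23[OF quadric_swap12[OF quad]]] .
  have nz: "\<not> (e1 = 0 \<and> e2 = 0 \<and> e3 = 0)" using e(4) by auto
  have no_vertex: False if vx: "e1 = 0 \<and> e2 = 0 \<or> e1 = 0 \<and> e3 = 0 \<or> e2 = 0 \<and> e3 = 0"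
  proof -
    consider "e1 = 0" "e2 = 0" "e3 = 1" | "e1 = 0" "e3 = 0" "e2 = 1" | "e2 = 0" "e3 = 0" "e1 = 1"
      using vx e(1-3) nz by blast
    then show False
    proof cases
      case 1
      then show False using vertex_double_point_divisible[OF ext] dp ndiv by auto
    next
      case 2
      have "double_point (\<lambda>u v w. f u w v) 0 0 1 (\<lambda>u v w. Q u w v)"
        unfolding double_point_def using quadric_swap23[OF quad] sh 2 by auto
      then show False
        using vertex_double_point_divisible[OF extremal_cubic_swap23[OF ext]] ndiv divisible_swap23[of f] by simp
    next
      case 3
      have "double_point (\<lambda>u v w. f w v u) 0 0 1 (\<lambda>u v w. Q w v u)"
        unfolding double_point_def using quad13 sh 3 by auto
      then show False
        using vertex_double_point_divisible[OF ext13] ndiv13 by simp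
    qed
  qed
  \<comment> \<open>In the last case the exchange of the first and third coordinate turns the bound on
    \<open>sqrt (u v) |A|\<close> into one on \<open>sqrt (v w) |A|\<close>.\<close>
  consider "e2 = 1" "e3 = 1" | "e1 = 1" "e2 = 0" "e3 = 1" | "e1 = 1" "e2 = 1" "e3 = 0"
    using no_vertex e(1-3) by blast
  then show ?thesis
  proof cases
    case 1
    interpret node f Q e1 by unfold_locales (use ext ndiv dp e 1 in auto)
    show ?thesis using e(1) dominated_at_edge_node[OF _ dom] dominated_at_interior_node[OF _ dom] by blast
  next
    case 2
    interpret node "\<lambda>u v w. f v u w" "\<lambda>u v w. Q v u w" 0
    proof
      show "extremal_cubic (\<lambda>u v w. f v u w)" by (rule extremal_cubic_swap12[OF ext])
      show "double_point (\<lambda>u v w. f v u w) 0 1 1 (\<lambda>u v w. Q v u w)"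
        unfolding double_point_def using quadric_swap12[OF quad] sh 2 by auto
      show "\<not> divisible_by_variable (\<lambda>u v w. f v u w)" using ndiv divisible_swap12[of f] by blast
    qed simp
    show ?thesis using dominated_at_edge_node[OF refl dominates_swap12[OF dom], of u v w] by simp
  next
    case 3
    interpret node "\<lambda>u v w. f w v u" "\<lambda>u v w. Q w v u" 0
    proof
      show "double_point (\<lambda>u v w. f w v u) 0 1 1 (\<lambda>u v w. Q w v u)"
        unfolding double_point_def using quad13 sh 3 by auto
    qed (use ext13 ndiv13 in auto)
    show ?thesis using dominated_at_opposite_edge_node[OF refl, of "\<lambda>u v w. A w v u" w v u] dom by simp
  qed
qed

theorem extremal_cubic_dominates_only_zero:
  assumes ext: "extremal_cubic f" and dom: "dominates f A"
  shows "A u v w = 0"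
proof (cases "divisible_by_variable f")
  case True
  then show ?thesis by (rule dominated_if_divisible[OF ext _ dom])
next
  case False
  obtain p1 p2 p3 Q where p: "p1 \<ge> 0" "p2 \<ge> 0" "p3 \<ge> 0" "p1 + p2 + p3 > 0" and dp: "double_point f p1 p2 p3 Q"
    by (rule exists_double_point[OF ext])
  \<comment> \<open>The rescaling that sends the positive coordinates of the double point to 1.\<close>
  define \<alpha> \<beta> \<gamma> where "\<alpha> = (if p1 = 0 then 1 else p1)" and "\<beta> = (if p2 = 0 then 1 else p2)"
    and "\<gamma> = (if p3 = 0 then 1 else p3)"
  have pos: "\<alpha> > 0" "\<beta> > 0" "\<gamma> > 0" using p by (auto simp: \<alpha>_def \<beta>_def \<gamma>_def)
  let ?f = "\<lambda>u v w. f (\<alpha> * u) (\<beta> * v) (\<gamma> * w)"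
  let ?A = "\<lambda>u v w. (sqrt \<alpha> * sqrt \<beta>) * A (\<alpha> * u) (\<beta> * v) (\<gamma> * w)"
  let ?e = "\<lambda>p. if p = (0::real) then 0 else (1::real)"
  have ndiv: "\<not> divisible_by_variable ?f"
  proof
    assume "divisible_by_variable ?f"
    then consider "\<forall>v w. f 0 (\<beta> * v) (\<gamma> * w) = 0" | "\<forall>u w. f (\<alpha> * u) 0 (\<gamma> * w) = 0"
      | "\<forall>u v. f (\<alpha> * u) (\<beta> * v) 0 = 0"
      unfolding divisible_by_variable_def by auto
    then have "divisible_by_variable f"
    proof cases
      case 1
      have "f 0 v w = 0" for v w using 1[rule_format, of "v / \<beta>" "w / \<gamma>"] pos by simp
      then show ?thesis by (simp add: divisible_by_variable_def)
    next
      case 2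
      have "f u 0 w = 0" for u w using 2[rule_format, of "u / \<alpha>" "w / \<gamma>"] pos by simp
      then show ?thesis by (simp add: divisible_by_variable_def)
    next
      case 3
      have "f u v 0 = 0" for u v using 3[rule_format, of "u / \<alpha>" "v / \<beta>"] pos by simp
      then show ?thesis by (simp add: divisible_by_variable_def)
    qed
    with False show False by simp
  qed
  have domf: "dominates ?f ?A"
    unfolding dominates_def
  proof (intro conjI allI impI)
    show "quadric ?A" by (rule quadric_scale[OF dominates_quadric[OF dom]])
    fix x y w :: real assume nn: "x \<ge> 0" "y \<ge> 0" "w \<ge> 0"
    have "(sqrt \<alpha> * x) * (sqrt \<beta> * y) * \<bar>A ((sqrt \<alpha> * x)^2) ((sqrt \<beta> * y)^2) (\<gamma> * w)\<bar>
      \<le> f ((sqrt \<alpha> * x)^2) ((sqrt \<beta> * y)^2) (\<gamma> * w)"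
      using nn pos by (intro dominatesD[OF dom]) auto
    then show "x * y * \<bar>?A (x^2) (y^2) w\<bar> \<le> ?f (x^2) (y^2) w"
      using pos by (simp add: power_mult_distrib abs_mult mult_ac)
  qed
  have dpf: "double_point ?f (?e p1) (?e p2) (?e p3) (\<lambda>u v w. Q (\<alpha> * u) (\<beta> * v) (\<gamma> * w))"
  proof -
    have quad: "quadric Q" and sh: "\<And>s u v w. f (u + s * p1) (v + s * p2) (w + s * p3) = f u v w + s * Q u v w"
      using dp unfolding double_point_def by auto
    have "\<alpha> * ?e p1 = p1" "\<beta> * ?e p2 = p2" "\<gamma> * ?e p3 = p3" by (auto simp: \<alpha>_def \<beta>_def \<gamma>_def)
    then have "\<alpha> * (u + s * ?e p1) = \<alpha> * u + s * p1" "\<beta> * (v + s * ?e p2) = \<beta> * v + s * p2"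
      "\<gamma> * (w + s * ?e p3) = \<gamma> * w + s * p3" for u v w s
      by (metis distrib_left mult.left_commute)+
    then show ?thesis
      unfolding double_point_def using quadric_scale[OF quad, of 1 \<alpha> \<beta> \<gamma>] sh by simp
  qed
  have "?A (u / \<alpha>) (v / \<beta>) (w / \<gamma>) = 0"
    by (rule dominated_at_normalised_double_point[OF extremal_cubic_scale[OF ext pos] ndiv domf dpf]) (use p in auto)
  then show ?thesis using pos by simp
qed

section \<open>From cubics to even sextics\<close>

lemma ternary_cubic_iff: "f \<in> ternary_forms 3 \<longleftrightarrow> cubic (\<lambda>u v w. f (u, v, w))"
proof
  assume "f \<in> ternary_forms 3"
  then obtain c :: "nat \<Rightarrow> nat \<Rightarrow> real" where c: "\<And>x y z. f (x, y, z) =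
      (\<Sum>i\<le>3. \<Sum>j\<le>3 - i. c i j * x ^ i * y ^ j * z ^ (3 - i - j))"
    unfolding ternary_forms_def by blast
  show "cubic (\<lambda>u v w. f (u, v, w))"
    by (rule cubicI[of _ "c 3 0" "c 0 3" "c 0 0" "c 2 1" "c 2 0" "c 1 2" "c 0 2" "c 1 0" "c 0 1" "c 1 1"])
       (simp add: c eval_nat_numeral algebra_simps)
next
  assume "cubic (\<lambda>u v w. f (u, v, w))"
  then obtain a b c d e g h i j k where f: "\<And>u v w. f (u, v, w) =
     a * u^3 + b * v^3 + c * w^3 + d * u^2 * v + e * u^2 * w + g * u * v^2
     + h * v^2 * w + i * u * w^2 + j * v * w^2 + k * u * v * w"
    unfolding cubic_def by blast
  \<comment> \<open>The coefficient of \<open>x ^ m * y ^ n * z ^ (3 - m - n)\<close>.\<close>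
  define C :: "nat \<Rightarrow> nat \<Rightarrow> real" where
    "C = (\<lambda>m n. [[c, j, h, b], [i, k, g], [e, d], [a]] ! m ! n)"
  have "f (x, y, z) = (\<Sum>i\<le>3. \<Sum>j\<le>3 - i. C i j * x ^ i * y ^ j * z ^ (3 - i - j))" for x y z
    by (simp add: f C_def eval_nat_numeral algebra_simps)
  then show "f \<in> ternary_forms 3" unfolding ternary_forms_def by blast
qed

lemma cubic_in_squares_is_sextic:
  assumes "cubic f" shows "(\<lambda>(x, y, z). f (x^2) (y^2) (z^2)) \<in> ternary_forms 6"
proof -
  obtain a b c d e g h i j k where f: "\<And>u v w. f u v w =
     a * u^3 + b * v^3 + c * w^3 + d * u^2 * v + e * u^2 * w + g * u * v^2
     + h * v^2 * w + i * u * w^2 + j * v * w^2 + k * u * v * w"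
    using assms unfolding cubic_def by blast
  \<comment> \<open>The coefficient of \<open>x ^ m * y ^ n * z ^ (6 - m - n)\<close>.\<close>
  define C :: "nat \<Rightarrow> nat \<Rightarrow> real" where
    "C = (\<lambda>m n. [[c, 0, j, 0, h, 0, b], [0, 0, 0, 0, 0, 0], [i, 0, k, 0, g], [0, 0, 0, 0], [e, 0, d], [0, 0], [a]] ! m ! n)"
  have "f (x^2) (y^2) (z^2) = (\<Sum>i\<le>6. \<Sum>j\<le>6 - i. C i j * x ^ i * y ^ j * z ^ (6 - i - j))" for x y z
    by (simp add: f C_def eval_nat_numeral algebra_simps)
  then show ?thesis unfolding ternary_forms_def by auto
qed

text \<open>
  The monomials of degree 6 are sorted by the parities of their three exponents, of which none or two are odd.
\<close>

lemma sextic_parity_decomposition: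
  assumes "G \<in> ternary_forms 6"
  obtains g A B C where "cubic g" "quadric A" "quadric B" "quadric C"
    "\<And>x y z. G (x, y, z) = g (x^2) (y^2) (z^2) + x * y * A (x^2) (y^2) (z^2)
       + x * z * B (x^2) (y^2) (z^2) + y * z * C (x^2) (y^2) (z^2)"
proof -
  obtain c :: "nat \<Rightarrow> nat \<Rightarrow> real" where c: "\<And>x y z. G (x, y, z) =
      (\<Sum>i\<le>6. \<Sum>j\<le>6 - i. c i j * x ^ i * y ^ j * z ^ (6 - i - j))"
    using assms unfolding ternary_forms_def by blast
  define g where "g = (\<lambda>u v w. c 6 0 * u^3 + c 0 6 * v^3 + c 0 0 * w^3 + c 4 2 * u^2 * v + c 4 0 * u^2 * w
     + c 2 4 * u * v^2 + c 0 4 * v^2 * w + c 2 0 * u * w^2 + c 0 2 * v * w^2 + c 2 2 * u * v * w)"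
  define A where "A = (\<lambda>u v w. c 5 1 * u^2 + c 1 5 * v^2 + c 1 1 * w^2 + c 3 3 * u * v + c 3 1 * u * w + c 1 3 * v * w)"
  define B where "B = (\<lambda>u v w. c 5 0 * u^2 + c 1 4 * v^2 + c 1 0 * w^2 + c 3 2 * u * v + c 3 0 * u * w + c 1 2 * v * w)"
  define C where "C = (\<lambda>u v w. c 4 1 * u^2 + c 0 5 * v^2 + c 0 1 * w^2 + c 2 3 * u * v + c 2 1 * u * w + c 0 3 * v * w)"
  show ?thesis
  proof (rule that[of g A B C])
    show "cubic g" unfolding g_def by (rule cubicI) simp
    show "quadric A" unfolding A_def by (rule quadricI) simp
    show "quadric B" unfolding B_def by (rule quadricI) simp
    show "quadric C" unfolding C_def by (rule quadricI) simp
    show "G (x, y, z) = g (x^2) (y^2) (z^2) + x * y * A (x^2) (y^2) (z^2)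
       + x * z * B (x^2) (y^2) (z^2) + y * z * C (x^2) (y^2) (z^2)" for x y z
      by (simp add: c g_def A_def B_def C_def eval_nat_numeral algebra_simps)
  qed
qed

lemma cubic_zero_on_orthant:
  assumes "cubic f" and z: "\<And>u v w. u \<ge> 0 \<Longrightarrow> v \<ge> 0 \<Longrightarrow> w \<ge> 0 \<Longrightarrow> f u v w = 0"
  shows "f u v w = 0"
proof -
  obtain a b c d e g h i j k where f: "\<And>u v w. f u v w =
     a * u^3 + b * v^3 + c * w^3 + d * u^2 * v + e * u^2 * w + g * u * v^2
     + h * v^2 * w + i * u * w^2 + j * v * w^2 + k * u * v * w"
    using assms(1) unfolding cubic_def by blast
  have "a = 0" "b = 0" "c = 0" using z[of 1 0 0] z[of 0 1 0] z[of 0 0 1] by (simp_all add: f)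
  moreover from this have "d = 0" "g = 0" using z[of 1 1 0] z[of 2 1 0] by (simp_all add: f)
  moreover from calculation have "e = 0" "i = 0" using z[of 1 0 1] z[of 2 0 1] by (simp_all add: f)
  moreover from calculation have "h = 0" "j = 0" using z[of 0 1 1] z[of 0 2 1] by (simp_all add: f)
  moreover from calculation have "k = 0" using z[of 1 1 1] by (simp add: f)
  ultimately show ?thesis by (simp add: f)
qed

text \<open>
  For \<open>0 \<le> g \<le> D f\<close> with \<open>D > 0\<close> the decomposition \<open>f = g / D + (f - g / D)\<close> lies in the cone.
\<close>

lemma extremal_cubic_of_extremal_form:
  assumes "f \<in> extremal_elements (psd_forms_orthant 3)"
  shows "extremal_cubic (\<lambda>u v w. f (u, v, w))"
proof -
  have fP: "f \<in> psd_forms_orthant 3" and nz: "f \<noteq> (\<lambda>p. 0)"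
    and split: "\<And>g h. g \<in> psd_forms_orthant 3 \<Longrightarrow> h \<in> psd_forms_orthant 3 \<Longrightarrow> f = (\<lambda>p. g p + h p) \<Longrightarrow>
      \<exists>a. g = (\<lambda>p. a * f p)"
    using assms unfolding extremal_elements_def by auto
  have cub: "cubic (\<lambda>u v w. f (u, v, w))"
    and nonneg: "\<And>u v w. u \<ge> 0 \<Longrightarrow> v \<ge> 0 \<Longrightarrow> w \<ge> 0 \<Longrightarrow> 0 \<le> f (u, v, w)"
    using fP by (auto simp: psd_forms_orthant_def ternary_cubic_iff)
  obtain u0 v0 w0 where nz': "f (u0, v0, w0) \<noteq> 0" using nz by (metis prod_cases3)
  show ?thesis
  proof (rule extremal_cubicI[OF cub nonneg nz'])
    fix g C assume g: "cubic g"
      and le: "\<And>u v w. u \<ge> 0 \<Longrightarrow> v \<ge> 0 \<Longrightarrow> w \<ge> 0 \<Longrightarrow> 0 \<le> g u v w \<and> g u v w \<le> C * f (u, v, w)"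
    define D where "D = max C 1"
    have D: "D > 0" by (simp add: D_def)
    have leD: "g u v w \<le> D * f (u, v, w)" if "u \<ge> 0" "v \<ge> 0" "w \<ge> 0" for u v w
    proof -
      have "g u v w \<le> C * f (u, v, w)" using le that by simp
      also have "\<dots> \<le> D * f (u, v, w)" using nonneg[OF that] by (intro mult_right_mono) (auto simp: D_def)
      finally show ?thesis .
    qed
    obtain a b c d e g' h i j k where gf: "\<And>u v w. g u v w =
       a * u^3 + b * v^3 + c * w^3 + d * u^2 * v + e * u^2 * w + g' * u * v^2
       + h * v^2 * w + i * u * w^2 + j * v * w^2 + k * u * v * w"
      using g unfolding cubic_def by blast
    obtain a2 b2 c2 d2 e2 g2 h2 i2 j2 k2 where ff: "\<And>u v w. f (u, v, w) =
       a2 * u^3 + b2 * v^3 + c2 * w^3 + d2 * u^2 * v + e2 * u^2 * w + g2 * u * v^2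
       + h2 * v^2 * w + i2 * u * w^2 + j2 * v * w^2 + k2 * u * v * w"
      using cub unfolding cubic_def by blast
    define G where "G = (\<lambda>(u, v, w). g u v w / D)"
    define H where "H = (\<lambda>(u, v, w). f (u, v, w) - g u v w / D)"
    have "cubic (\<lambda>u v w. g u v w / D)"
      by (rule cubicI[of _ "a/D" "b/D" "c/D" "d/D" "e/D" "g'/D" "h/D" "i/D" "j/D" "k/D"])
         (simp add: gf add_divide_distrib)
    then have G: "G \<in> psd_forms_orthant 3"
      using le D by (auto simp: psd_forms_orthant_def ternary_cubic_iff G_def)
    have "cubic (\<lambda>u v w. f (u, v, w) - g u v w / D)"
      by (rule cubicI[of _ "a2-a/D" "b2-b/D" "c2-c/D" "d2-d/D" "e2-e/D" "g2-g'/D" "h2-h/D" "i2-i/D" "j2-j/D" "k2-k/D"])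
         (simp add: gf ff add_divide_distrib algebra_simps)
    moreover have "0 \<le> f (u, v, w) - g u v w / D" if "u \<ge> 0" "v \<ge> 0" "w \<ge> 0" for u v w
      using leD[OF that] D by (simp add: pos_divide_le_eq mult.commute)
    ultimately have H: "H \<in> psd_forms_orthant 3"
      by (auto simp: psd_forms_orthant_def ternary_cubic_iff H_def)
    have "f = (\<lambda>p. G p + H p)" by (auto simp: G_def H_def)
    from split[OF G H this] obtain t where t: "G = (\<lambda>p. t * f p)" by blast
    have "g u v w = (D * t) * f (u, v, w)" for u v w
      using fun_cong[OF t, of "(u, v, w)"] D by (simp add: G_def field_simps)
    then show "\<exists>a. \<forall>u v w. g u v w = a * f (u, v, w)" by blast
  qed
qed

text \<open>
  Each parity component of \<open>G\<close> is a signed average of \<open>G\<close> over sign changes of the coordinates.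
\<close>

lemma summand_of_extremal_sextic:
  assumes ext: "extremal_cubic f" and G: "G \<in> ternary_forms 6"
    and nn: "\<And>x y z. 0 \<le> G (x, y, z)" and le: "\<And>x y z. G (x, y, z) \<le> f (x^2) (y^2) (z^2)"
  shows "\<exists>a. \<forall>x y z. G (x, y, z) = a * f (x^2) (y^2) (z^2)"
proof -
  obtain g A B C where g: "cubic g" and quad: "quadric A" "quadric B" "quadric C"
    and dec: "\<And>x y z. G (x, y, z) = g (x^2) (y^2) (z^2) + x * y * A (x^2) (y^2) (z^2)
       + x * z * B (x^2) (y^2) (z^2) + y * z * C (x^2) (y^2) (z^2)"
    using sextic_parity_decomposition[OF G] by metis
  have bounds: "0 \<le> G (x, y, z)" "0 \<le> G (- x, y, z)" "0 \<le> G (x, - y, z)" "0 \<le> G (x, y, - z)"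
    "G (x, y, z) \<le> f (x^2) (y^2) (z^2)" "G (- x, y, z) \<le> f (x^2) (y^2) (z^2)"
    "G (x, - y, z) \<le> f (x^2) (y^2) (z^2)" "G (x, y, - z) \<le> f (x^2) (y^2) (z^2)" for x y z
    using nn le[of x y z] le[of "- x" y z] le[of x "- y" z] le[of x y "- z"] by auto
  have even: "0 \<le> g (x^2) (y^2) (z^2) \<and> g (x^2) (y^2) (z^2) \<le> f (x^2) (y^2) (z^2)" for x y z
    using bounds[of x y z] by (simp add: dec)
  have odd: "\<bar>x * y * A (x^2) (y^2) (z^2)\<bar> \<le> f (x^2) (y^2) (z^2)"
    "\<bar>x * z * B (x^2) (y^2) (z^2)\<bar> \<le> f (x^2) (y^2) (z^2)"
    "\<bar>y * z * C (x^2) (y^2) (z^2)\<bar> \<le> f (x^2) (y^2) (z^2)" for x y z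
    using bounds[of x y z] unfolding dec by (simp_all add: abs_le_iff)
  have "0 \<le> g u v w \<and> g u v w \<le> 1 * f u v w" if "u \<ge> 0" "v \<ge> 0" "w \<ge> 0" for u v w
    using even[of "sqrt u" "sqrt v" "sqrt w"] that by simp
  from extremal_cubic_dominated[OF ext g this] obtain a where a: "\<And>u v w. g u v w = a * f u v w" by blast
  have "dominates f A"
    unfolding dominates_def
  proof (intro conjI allI impI)
    show "x * y * \<bar>A (x^2) (y^2) w\<bar> \<le> f (x^2) (y^2) w" if "x \<ge> 0" "y \<ge> 0" "w \<ge> 0" for x y w
      using odd(1)[of x y "sqrt w"] that by (simp add: abs_mult)
  qed (rule quad)
  then have A: "A u v w = 0" for u v w by (rule extremal_cubic_dominates_only_zero[OF ext])
  have "dominates (\<lambda>u v w. f u w v) (\<lambda>u v w. B u w v)"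
    unfolding dominates_def
  proof (intro conjI allI impI)
    show "x * z * \<bar>B (x^2) w (z^2)\<bar> \<le> f (x^2) w (z^2)" if "x \<ge> 0" "z \<ge> 0" "w \<ge> 0" for x z w
      using odd(2)[of x z "sqrt w"] that by (simp add: abs_mult)
  qed (rule quadric_swap23[OF quad(2)])
  then have B: "B u w v = 0" for u v w
    by (rule extremal_cubic_dominates_only_zero[OF extremal_cubic_swap23[OF ext]])
  have "dominates (\<lambda>u v w. f w u v) (\<lambda>u v w. C w u v)"
    unfolding dominates_def
  proof (intro conjI allI impI)
    show "y * z * \<bar>C w (y^2) (z^2)\<bar> \<le> f w (y^2) (z^2)" if "y \<ge> 0" "z \<ge> 0" "w \<ge> 0" for y z w
      using odd(3)[of y z "sqrt w"] that by (simp add: abs_mult)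
  qed (use quadric_swap23[OF quadric_swap12[OF quad(3)]] in simp)
  moreover have "extremal_cubic (\<lambda>u v w. f w u v)"
    using extremal_cubic_swap23[OF extremal_cubic_swap12[OF ext]] .
  ultimately have C: "C w u v = 0" for u v w
    using extremal_cubic_dominates_only_zero by blast
  have "G (x, y, z) = a * f (x^2) (y^2) (z^2)" for x y z
    by (simp add: dec A B C a)
  then show ?thesis by blast
qed

theorem theorem1p7:
  fixes f :: "real \<times> real \<times> real \<Rightarrow> real"
  assumes "f \<in> extremal_elements (psd_forms_orthant 3)"
  shows "(\<lambda>(x, y, z). f (x\<^sup>2, y\<^sup>2, z\<^sup>2)) \<in> extremal_elements (psd_forms 6)"
proof -
  define f' where "f' = (\<lambda>u v w. f (u, v, w))"
  define F where "F = (\<lambda>(x, y, z). f (x\<^sup>2, y\<^sup>2, z\<^sup>2))"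
  have ext: "extremal_cubic f'"
    unfolding f'_def by (rule extremal_cubic_of_extremal_form[OF assms])
  have F: "F (x, y, z) = f' (x\<^sup>2) (y\<^sup>2) (z\<^sup>2)" for x y z by (simp add: F_def f'_def)
  have "F \<in> ternary_forms 6"
    using cubic_in_squares_is_sextic[OF extremal_cubicD(1)[OF ext]] by (simp add: F_def f'_def)
  then have psd: "F \<in> psd_forms 6"
    by (simp add: psd_forms_def F extremal_cubicD(2)[OF ext])
  have nonzero: "F \<noteq> (\<lambda>p. 0)"
  proof
    assume z: "F = (\<lambda>p. 0)"
    have "f' u v w = 0" if "u \<ge> 0" "v \<ge> 0" "w \<ge> 0" for u v w
      using fun_cong[OF z, of "(sqrt u, sqrt v, sqrt w)"] that by (simp add: F)
    then have "f' u v w = 0" for u v w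
      by (rule cubic_zero_on_orthant[OF extremal_cubicD(1)[OF ext]])
    then show False using extremal_cubicD(3)[OF ext] by blast
  qed
  have summand: "\<exists>a. G = (\<lambda>p. a * F p)"
    if G: "G \<in> psd_forms 6" and H: "H \<in> psd_forms 6" and sum: "F = (\<lambda>p. G p + H p)" for G H
  proof -
    have "G (x, y, z) \<le> f' (x\<^sup>2) (y\<^sup>2) (z\<^sup>2)" for x y z
      using fun_cong[OF sum, of "(x, y, z)"] H by (simp add: F psd_forms_def)
    then obtain a where "\<And>x y z. G (x, y, z) = a * F (x, y, z)"
      using summand_of_extremal_sextic[OF ext, of G] G unfolding F psd_forms_def by blast
    then have "G = (\<lambda>p. a * F p)" by auto
    then show ?thesis by blast
  qed
  have "F \<in> extremal_elements (psd_forms 6)"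
    unfolding extremal_elements_def
  proof (intro CollectI conjI ballI impI psd nonzero)
    fix G H assume GH: "G \<in> psd_forms 6" "H \<in> psd_forms 6" "F = (\<lambda>p. G p + H p)"
    show "\<exists>a. G = (\<lambda>p. a * F p)" by (rule summand[OF GH])
    show "\<exists>b. H = (\<lambda>p. b * F p)"
      by (rule summand[OF GH(2,1)]) (simp add: GH(3) add.commute)
  qed
  then show ?thesis by (simp add: F_def)
qed

end
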